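(* Let $Q\subset\mathbb{R}^n$ be a bounded closed convex set that is the closure of its interior, let $c\in\mathbb{R}^n$, let $F$ be a $\nu$-self-concordant barrier for $Q$ and let $\epsilon>0$. For the given $c$, $F$, $\epsilon$, let $N_S$ and $N_A$ be the number of Newton steps of the short step and adaptive step algorithms (described in the context), respectively, for the problem $\min\{c^Tx: x\in Q\}$. Then $$N_A\le16\left\lceil0.76+0.73\log(1+9\sqrt\nu)\right\rceil N_S.$$
   Context: Put $\beta=1/9$, $\gamma=5/36$ and $\|v\|_x^*=\sqrt{v^T[F''(x)]^{-1}v}$; $\log$ is the natural logarithm. Both algorithms consist of an auxiliary phase, started from a given interior point $\hat x$ of $Q$, followed by a main phase. Short step algorithm. Auxiliary phase: $x^{(0)}=\hat x$, $t_0=1$, $G=-F'(x^{(0)})$; iterate $t_{k+1}=t_k-\gamma/\|G\|^*_{x^{(k)}}$, $x^{(k+1)}=x^{(k)}-[F''(x^{(k)})]^{-1}(t_{k+1}G+F'(x^{(k)}))$; stop if $\|F'(x^{(k)})\|^*_{x^{(k)}}\le\frac{\sqrt\beta}{1+\sqrt\beta}$ and set $\bar x=x^{(k)}-[F''(x^{(k)})]^{-1}F'(x^{(k)})$. Main phase: $x^{(0)}=\bar x$, $t_0=0$; iterate $t_{k+1}=t_k+\gamma/\|c\|^*_{x^{(k)}}$, $x^{(k+1)}=x^{(k)}-[F''(x^{(k)})]^{-1}(t_{k+1}c+F'(x^{(k)}))$; stop if $t_k\ge\left(\nu+\frac{(\beta+\sqrt\nu)\beta}{1-\beta}\right)\epsilon^{-1}$.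 Adaptive step algorithm. It has the same initializations and stopping criteria, but with a step parameter $\kappa_k$ depending on the iteration, $\kappa_0=10$. In the main phase, $$t_{k+1}=\begin{cases}\max\{\kappa_{k+1}t_k,\ t_k+\gamma/\|c\|^*_{x^{(k)}}\}&\text{if }\|t_kc+F'(x^{(k)})\|^*_{x^{(k)}}\le\beta,\\ t_k&\text{otherwise,}\end{cases}$$ $$x^{(k+1)}=x^{(k)}-r_k[F''(x^{(k)})]^{-1}(t_{k+1}c+F'(x^{(k)})),$$ where $0<r_k\le1$ is found by standard backtracking line search on $x\mapsto t_{k+1}c^Tx+F(x)$ (Armijo constant $0.01$, backtracking factor $0.25$, initial trial $r_k=1$). The auxiliary phase is implemented in a similar fashion with $G$ in place of $c$ and $t$ decreasing: if $\|t_kG+F'(x^{(k)})\|^*_{x^{(k)}}\le\beta$ then $t_{k+1}=\min\{t_k/\kappa_{k+1},\ t_k-\gamma/\|G\|^*_{x^{(k)}}\}$, otherwise $t_{k+1}=t_k$. One says $x^{(k)}$ is accepted if $\|t_kc+F'(x^{(k)})\|^*_{x^{(k)}}\le\beta$ (main phase) or $\|t_kG+F'(x^{(k)})\|^*_{x^{(k)}}\le\beta$ (auxiliary phase); otherwise $x^{(k)}$ is a slow step. The step parameter is updated as follows: 1. If $x^{(k)}$ is accepted after 2 or fewer slow steps, put $\kappa_{k+1}=\min\{\kappa_0,\kappa_k^2\}$. 2. If $x^{(k)}$ is accepted after 8 or more slow steps, put $\kappa_{k+1}=\sqrt{\kappa_k}$. 3. If $x^{(k)}$ is still not accepted after 15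 slow steps, replace $x^{(k+1)}$ and $t_{k+1}$ by the most recently accepted step and put $\kappa_{k+1}=\kappa_k^{1/4}$ (a rejection). 4. Otherwise, put $\kappa_{k+1}=\kappa_k$. Whenever $t_{k+1}$ coincides with the short step value, the step is automatically accepted. $N_S$ and $N_A$ count all Newton steps. *)

theory Defs
  imports "HOL-Analysis.Analysis" "HOL-Library.Extended_Nat"
begin

subsection \<open>Derivatives and self-concordant barriers\<close>

definition gradient :: "(real ^ 'n \<Rightarrow> real) \<Rightarrow> real ^ 'n \<Rightarrow> real ^ 'n" where
  "gradient F x = (\<chi> i. frechet_derivative F (at x) (axis i 1))"

definition hessian :: "(real ^ 'n \<Rightarrow> real) \<Rightarrow> real ^ 'n \<Rightarrow> real ^ 'n ^ 'n" where
  "hessian F x = matrix (frechet_derivative (gradient F) (at x))"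

definition third_deriv :: "(real ^ 'n \<Rightarrow> real) \<Rightarrow> real ^ 'n \<Rightarrow> real ^ 'n \<Rightarrow> real ^ 'n ^ 'n" where
  "third_deriv F x h = frechet_derivative (hessian F) (at x) h"

definition C3_on :: "(real ^ 'n) set \<Rightarrow> (real ^ 'n \<Rightarrow> real) \<Rightarrow> bool" where
  "C3_on S F \<longleftrightarrow>
     (\<forall>x\<in>S. F differentiable (at x)) \<and>
     (\<forall>x\<in>S. gradient F differentiable (at x)) \<and>
     (\<forall>x\<in>S. hessian F differentiable (at x)) \<and>
     (\<forall>h. continuous_on S (\<lambda>x. third_deriv F x h))"

text \<open>Only the values of \<open>F\<close> on the interior of \<open>Q\<close> matter; outside, \<open>F\<close> is to be thought of
  as \<open>+\<infinity>\<close>. Nondegeneracy of the Hessian is not required: it is a consequence when \<open>Q\<close> is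
  bounded.\<close>

definition self_concordant_barrier ::
  "real \<Rightarrow> (real ^ 'n) set \<Rightarrow> (real ^ 'n \<Rightarrow> real) \<Rightarrow> bool" where
  "self_concordant_barrier \<nu> Q F \<longleftrightarrow>
     C3_on (interior Q) F \<and>
     convex_on (interior Q) F \<and>
     (\<forall>z\<in>frontier Q. filterlim F at_top (at z within interior Q)) \<and>
     (\<forall>x\<in>interior Q. \<forall>h.
        \<bar>h \<bullet> (third_deriv F x h *v h)\<bar> \<le> 2 * (h \<bullet> (hessian F x *v h)) powr (3/2)) \<and>
     (\<forall>x\<in>interior Q. \<forall>h. (gradient F x \<bullet> h)\<^sup>2 \<le> \<nu> * (h \<bullet> (hessian F x *v h)))"

definition dual_norm :: "(real ^ 'n \<Rightarrow> real) \<Rightarrow> real ^ 'n \<Rightarrow> real ^ 'n \<Rightarrow> real" where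
  "dual_norm F x v = sqrt (v \<bullet> (matrix_inv (hessian F x) *v v))"


subsection \<open>Notions common to both algorithms\<close>

definition beta :: real where "beta = 1/9"

definition gamma :: real where "gamma = 5/36"

text \<open>The Newton direction of \<open>x \<mapsto> t * (d \<bullet> x) + F x\<close>, to be subtracted from \<open>x\<close>. The vector
  \<open>d\<close> is the cost \<open>c\<close> in the main phase and \<open>G\<close> in the auxiliary phase.\<close>

definition newton_dir ::
  "(real ^ 'n \<Rightarrow> real) \<Rightarrow> real ^ 'n \<Rightarrow> real \<Rightarrow> real ^ 'n \<Rightarrow> real ^ 'n" where
  "newton_dir F d t x = matrix_inv (hessian F x) *v (t *\<^sub>R d + gradient F x)"

definition aux_stop :: "(real ^ 'n \<Rightarrow> real) \<Rightarrow> real ^ 'n \<Rightarrow> bool" where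
  "aux_stop F x \<longleftrightarrow> dual_norm F x (gradient F x) \<le> sqrt beta / (1 + sqrt beta)"

definition main_stop :: "real \<Rightarrow> real \<Rightarrow> real \<Rightarrow> bool" where
  "main_stop \<nu> \<epsilon> t \<longleftrightarrow>
     t \<ge> (\<nu> + (beta + sqrt \<nu>) * beta / (1 - beta)) * inverse \<epsilon>"

text \<open>The first index satisfying \<open>P\<close>, and \<open>\<infinity>\<close> if there is none (the algorithm does not stop).\<close>

definition first_time :: "(nat \<Rightarrow> bool) \<Rightarrow> enat" where
  "first_time P = (INF k\<in>{k. P k}. enat k)"


subsection \<open>Short step algorithm\<close>

text \<open>A state is a pair \<open>(x, t)\<close>. Every iteration is one Newton step. If \<open>c = 0\<close>, then
  \<open>gamma / dual_norm F x c\<close> is \<open>0\<close>, so that \<open>t\<close> never increases in the main phase and the number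
  of Newton steps is \<open>\<infinity>\<close>.\<close>

definition short_aux_step ::
  "(real ^ 'n \<Rightarrow> real) \<Rightarrow> real ^ 'n \<Rightarrow> (real ^ 'n) \<times> real \<Rightarrow> (real ^ 'n) \<times> real" where
  "short_aux_step F G = (\<lambda>(x, t).
     let t' = t - gamma / dual_norm F x G in (x - newton_dir F G t' x, t'))"

definition short_main_step ::
  "(real ^ 'n \<Rightarrow> real) \<Rightarrow> real ^ 'n \<Rightarrow> (real ^ 'n) \<times> real \<Rightarrow> (real ^ 'n) \<times> real" where
  "short_main_step F c = (\<lambda>(x, t).
     let t' = t + gamma / dual_norm F x c in (x - newton_dir F c t' x, t'))"

definition short_aux ::
  "(real ^ 'n \<Rightarrow> real) \<Rightarrow> real ^ 'n \<Rightarrow> nat \<Rightarrow> (real ^ 'n) \<times> real" where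
  "short_aux F xhat k = (short_aux_step F (- gradient F xhat) ^^ k) (xhat, 1)"

definition short_main ::
  "(real ^ 'n \<Rightarrow> real) \<Rightarrow> real ^ 'n \<Rightarrow> real ^ 'n \<Rightarrow> nat \<Rightarrow> (real ^ 'n) \<times> real" where
  "short_main F c xbar k = (short_main_step F c ^^ k) (xbar, 0)"

text \<open>The summand \<open>1\<close> is the Newton step that produces \<open>xbar\<close>.\<close>

definition N_short ::
  "(real ^ 'n \<Rightarrow> real) \<Rightarrow> real \<Rightarrow> real ^ 'n \<Rightarrow> real ^ 'n \<Rightarrow> real \<Rightarrow> enat" where
  "N_short F \<nu> xhat c \<epsilon> =
     (case first_time (\<lambda>k. aux_stop F (fst (short_aux F xhat k))) of
        \<infinity> \<Rightarrow> \<infinity>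
      | enat k \<Rightarrow>
          (let x = fst (short_aux F xhat k);
               xbar = x - newton_dir F 0 0 x
           in enat k + 1 + first_time (\<lambda>m. main_stop \<nu> \<epsilon> (snd (short_main F c xbar m)))))"


subsection \<open>Adaptive step algorithm\<close>

text \<open>Backtracking for \<open>x \<mapsto> t * (d \<bullet> x) + F x\<close>; a trial point outside the interior of \<open>Q\<close>,
  where \<open>F = +\<infinity>\<close>, fails the test.\<close>

definition armijo ::
  "(real ^ 'n) set \<Rightarrow> (real ^ 'n \<Rightarrow> real) \<Rightarrow> real ^ 'n \<Rightarrow> real \<Rightarrow> real ^ 'n \<Rightarrow> real \<Rightarrow> bool" where
  "armijo Q F d t x r \<longleftrightarrow>
     (let p = newton_dir F d t x; \<phi> = (\<lambda>y. t * (d \<bullet> y) + F y)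
      in x - r *\<^sub>R p \<in> interior Q \<and>
         \<phi> (x - r *\<^sub>R p) \<le> \<phi> x - 0.01 * r * ((t *\<^sub>R d + gradient F x) \<bullet> p))"

definition backtracking ::
  "(real ^ 'n) set \<Rightarrow> (real ^ 'n \<Rightarrow> real) \<Rightarrow> real ^ 'n \<Rightarrow> real \<Rightarrow> real ^ 'n \<Rightarrow> real" where
  "backtracking Q F d t x = 0.25 ^ (LEAST j. armijo Q F d t x (0.25 ^ j))"

definition damped_newton ::
  "(real ^ 'n) set \<Rightarrow> (real ^ 'n \<Rightarrow> real) \<Rightarrow> real ^ 'n \<Rightarrow> real \<Rightarrow> real ^ 'n \<Rightarrow> real ^ 'n" where
  "damped_newton Q F d t x = x - backtracking Q F d t x *\<^sub>R newton_dir F d t x"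

text \<open>The state at iteration \<open>k\<close>: the iterate, the parameter \<open>t\<close> and the step parameter \<open>\<kappa>\<close>; the
  number \<open>slow\<close> of consecutive slow steps immediately preceding the iterate; the most recently
  accepted iterate and its \<open>t\<close>; whether the iterate has just been restored by a rejection; and
  the number of Newton steps so far.\<close>

record 'n adaptive_state =
  iterate :: "real ^ 'n"
  param :: real
  kappa :: real
  slow :: nat
  last_iterate :: "real ^ 'n"
  last_param :: real
  restored :: bool
  newton_steps :: nat

definition kappa0 :: real where "kappa0 = 10"

definition initial_state :: "real ^ 'n \<Rightarrow> real \<Rightarrow> 'n adaptive_state" where
  "initial_state x t =
     \<lparr>iterate = x, param = t, kappa = kappa0, slow = 0, last_iterate = x, last_param = t,
      restored = False, newton_steps = 0\<rparr>"

definition accepted ::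
  "(real ^ 'n \<Rightarrow> real) \<Rightarrow> real ^ 'n \<Rightarrow> 'n adaptive_state \<Rightarrow> bool" where
  "accepted F d s \<longleftrightarrow>
     dual_norm F (iterate s) (param s *\<^sub>R d + gradient F (iterate s)) \<le> beta"

text \<open>The step parameter after an accepted iterate. An iterate restored by a rejection is not
  newly accepted, so it keeps the value that the rejection has just assigned.\<close>

definition accepted_kappa :: "'n::finite adaptive_state \<Rightarrow> real" where
  "accepted_kappa s =
     (if restored s then kappa s
      else if slow s \<le> 2 then min kappa0 ((kappa s)\<^sup>2)
      else if slow s \<ge> 8 then sqrt (kappa s)
      else kappa s)"

text \<open>One iteration. The argument \<open>upd\<close> maps \<open>\<kappa>\<close>, \<open>x\<close>, \<open>t\<close> to the new value of \<open>t\<close> at an accepted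
  iterate. A rejection performs no Newton step. That a step to the short step value of \<open>t\<close> is always
  accepted is a consequence, not a separate rule: the Newton decrement is then at most
  \<open>beta + gamma = 1/4\<close>, so the line search takes the full Newton step, after which the decrement
  is at most \<open>((1/4) / (1 - 1/4))\<^sup>2 = beta\<close>.\<close>

definition adaptive_step ::
  "(real ^ 'n) set \<Rightarrow> (real ^ 'n \<Rightarrow> real) \<Rightarrow> real ^ 'n \<Rightarrow>
   (real \<Rightarrow> real ^ 'n \<Rightarrow> real \<Rightarrow> real) \<Rightarrow> 'n adaptive_state \<Rightarrow> 'n adaptive_state" where
  "adaptive_step Q F d upd s =
     (if accepted F d s then
        (let \<kappa>' = accepted_kappa s; t' = upd \<kappa>' (iterate s) (param s)
         in \<lparr>iterate = damped_newton Q F d t' (iterate s), param = t', kappa = \<kappa>', slow = 0,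
             last_iterate = iterate s, last_param = param s, restored = False,
             newton_steps = newton_steps s + 1\<rparr>)
      else if slow s \<ge> 15 then
        s\<lparr>iterate := last_iterate s, param := last_param s, kappa := root 4 (kappa s),
          slow := 0, restored := True\<rparr>
      else
        s\<lparr>iterate := damped_newton Q F d (param s) (iterate s), slow := slow s + 1,
          newton_steps := newton_steps s + 1\<rparr>)"

definition aux_update ::
  "(real ^ 'n \<Rightarrow> real) \<Rightarrow> real ^ 'n \<Rightarrow> real \<Rightarrow> real ^ 'n \<Rightarrow> real \<Rightarrow> real" where
  "aux_update F G \<kappa> x t = min (t / \<kappa>) (t - gamma / dual_norm F x G)"

definition main_update ::
  "(real ^ 'n \<Rightarrow> real) \<Rightarrow> real ^ 'n \<Rightarrow> real \<Rightarrow> real ^ 'n \<Rightarrow> real \<Rightarrow> real" where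
  "main_update F c \<kappa> x t = max (\<kappa> * t) (t + gamma / dual_norm F x c)"

definition adaptive_aux ::
  "(real ^ 'n) set \<Rightarrow> (real ^ 'n \<Rightarrow> real) \<Rightarrow> real ^ 'n \<Rightarrow> nat \<Rightarrow> 'n adaptive_state" where
  "adaptive_aux Q F xhat k =
     (let G = - gradient F xhat
      in (adaptive_step Q F G (aux_update F G) ^^ k) (initial_state xhat 1))"

definition adaptive_main ::
  "(real ^ 'n) set \<Rightarrow> (real ^ 'n \<Rightarrow> real) \<Rightarrow> real ^ 'n \<Rightarrow> real ^ 'n \<Rightarrow> nat \<Rightarrow> 'n adaptive_state" where
  "adaptive_main Q F c xbar k =
     (adaptive_step Q F c (main_update F c) ^^ k) (initial_state xbar 0)"

definition N_adaptive ::
  "(real ^ 'n) set \<Rightarrow> (real ^ 'n \<Rightarrow> real) \<Rightarrow> real \<Rightarrow> real ^ 'n \<Rightarrow> real ^ 'n \<Rightarrow> real \<Rightarrow> enat" where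
  "N_adaptive Q F \<nu> xhat c \<epsilon> =
     (case first_time (\<lambda>k. aux_stop F (iterate (adaptive_aux Q F xhat k))) of
        \<infinity> \<Rightarrow> \<infinity>
      | enat k \<Rightarrow>
          (let s = adaptive_aux Q F xhat k;
               xbar = iterate s - newton_dir F 0 0 (iterate s)
           in case first_time (\<lambda>m. main_stop \<nu> \<epsilon> (param (adaptive_main Q F c xbar m))) of
                \<infinity> \<Rightarrow> \<infinity>
              | enat m \<Rightarrow>
                  enat (newton_steps s + 1 + newton_steps (adaptive_main Q F c xbar m))))"

end

theory Submission
  imports Defs
begin

text \<open>The adaptive algorithm is compared with the short step algorithm along the parameter \<open>t\<close>. Let
\<open>K\<^sub>a\<close> and \<open>K\<^sub>m\<close> be the numbers of short steps in the auxiliary and in the main phase.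

At an accepted iterate \<open>x\<close> the adaptive algorithm moves \<open>t\<close> at least as far as a
short step from \<open>x\<close> would, that is by \<open>gamma / \<parallel>c\<parallel>\<^sup>*\<close>, the dual norm being taken at \<open>x\<close>. The iterate of
the short step algorithm is a different point, but for the same \<open>t\<close> both are close to the minimizer
of \<open>t * (c \<bullet> x) + F x\<close>: the accepted one has Newton decrement at most \<open>1/9\<close>, and the short step one
has decrement at most \<open>1/4\<close> for every \<open>t\<close> in the interval that its next step covers. So the two dual
norms of \<open>c\<close> differ by a factor of at most \<open>12/7\<close> (\<open>dual_norm_compare_near_path\<close>), an accepted step
covers at least \<open>7/12\<close> of a short step, and two of them cover a whole one. In the auxiliary phase the
same comparison shows that at most four more accepted steps are needed once the parameter of the last
short step iterate has been passed.

Measure \<open>\<kappa>\<close> by its level \<open>log\<^sub>4 (ln \<kappa>)\<close>. A rejection lowers the level by \<open>1\<close>, an acceptance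
after at most 2 slow steps raises it by at most \<open>1/2\<close>, and one after at least 8 slow steps lowers it
by \<open>1/2\<close>. If one unit of level is worth 16 Newton steps, then the 16 Newton steps of a rejected trial
are paid for by the drop in level, and an accepted trial costs at most 11. Because \<open>t \<parallel>c\<parallel>\<^sup>* \<le> beta + sqrt \<nu>\<close>
at accepted iterates, a trial with \<open>\<kappa> \<le> 1 + (5/4) / (1 + 9 * sqrt \<nu>)\<close> takes the short step value of \<open>t\<close> and
is accepted automatically (\<open>short_step_accepted\<close>). Hence the level never falls more than one unit below
the level of this number; the total drop is where the logarithm of \<open>1 + 9 * sqrt \<nu>\<close> in the bound comes from
(\<open>rejection_depth_bound\<close>).

The two estimates bound the Newton steps of each phase by a multiple of the number of short
steps plus a constant that is logarithmic in \<open>\<nu>\<close> (\<open>auxiliary_phase\<close>, \<open>main_phase\<close>). Since \<open>\<nu> \<ge> 1\<close>, the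
integer \<open>M = \<lceil>0.76 + 0.73 * ln (1 + 9 * sqrt \<nu>)\<rceil>\<close> is at least 3, and \<open>16 * M * (K\<^sub>a + 1 + K\<^sub>m)\<close> is large enough to
absorb the sum (\<open>newton_count_arithmetic\<close>).

The facts about Newton's method rest on the comparison of Hessians at nearby points. This needs a bound
on the third derivative in mixed directions, whereas self-concordance is an inequality on the diagonal
only; \<open>trilinear_form_bound\<close> bridges the gap.\<close>

section \<open>Symmetric derivatives and trilinear forms\<close>

text \<open>The second difference \<open>f (x + su + sv) - f (x + su) - f (x + sv) + f x\<close> is symmetric in \<open>u\<close> and \<open>v\<close>.
By the mean value theorem along \<open>v\<close> it equals \<open>s\<^sup>2 * (A u \<bullet> v)\<close> up to \<open>o(s\<^sup>2)\<close>, and along \<open>u\<close> it equals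
\<open>s\<^sup>2 * (A v \<bullet> u)\<close>.\<close>

lemma mixed_derivative_symmetric:
  fixes f :: "'a::real_inner \<Rightarrow> real"
  assumes "open S" "x \<in> S"
    and f: "\<And>y. y \<in> S \<Longrightarrow> (f has_derivative (\<lambda>h. g y \<bullet> h)) (at y)"
    and g: "(g has_derivative A) (at x)"
  shows "A u \<bullet> v = A v \<bullet> u"
proof -
  interpret A: bounded_linear A using g by (rule has_derivative_bounded_linear)
  obtain r where r: "r > 0" "ball x r \<subseteq> S"
    using assms(1,2) openE by blast
  have key: "\<bar>A u \<bullet> v - A v \<bullet> u\<bar> \<le> e * (4 * (norm u + norm v)\<^sup>2)" if e: "e > 0" for e
  proof -
    obtain d where d: "d > 0" "\<And>y. norm (y - x) < d \<Longrightarrow> norm (g y - g x - A (y - x)) \<le> e * norm (y - x)"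
      using g e unfolding has_derivative_at_alt by blast
    define n where "n = norm u + norm v"
    define s where "s = min d r / (2 * (n + 1))"
    have n: "n \<ge> 0" by (simp add: n_def)
    have s: "s > 0" using d r n by (simp add: s_def)
    have "s * n < min d r"
    proof -
      have "s * n \<le> s * (n + 1)" using s by simp
      also have "\<dots> = min d r / 2" using n by (simp add: s_def field_simps)
      also have "\<dots> < min d r" using d(1) r(1) by (simp add: min_def)
      finally show ?thesis .
    qed
    have one: "\<bar>(f (x + s *\<^sub>R p + s *\<^sub>R q) - f (x + s *\<^sub>R p) - f (x + s *\<^sub>R q) + f x) - s\<^sup>2 * (A p \<bullet> q)\<bar>
        \<le> s\<^sup>2 * (2 * e * n\<^sup>2)" if pq: "norm p + norm q = n" for p q
    proof -
      define k where "k \<tau> = f (x + s *\<^sub>R p + \<tau> *\<^sub>R s *\<^sub>R q) - f (x + \<tau> *\<^sub>R s *\<^sub>R q)" for \<tau>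
      have small: "norm (c *\<^sub>R s *\<^sub>R p + \<tau> *\<^sub>R s *\<^sub>R q) \<le> s * n" if "0 \<le> \<tau>" "\<tau> \<le> 1" "0 \<le> c" "c \<le> 1" for \<tau> c
      proof -
        have "norm (c *\<^sub>R s *\<^sub>R p + \<tau> *\<^sub>R s *\<^sub>R q) \<le> c * (s * norm p) + \<tau> * (s * norm q)"
          using norm_triangle_ineq[of "c *\<^sub>R s *\<^sub>R p" "\<tau> *\<^sub>R s *\<^sub>R q"] that s by simp
        also have "\<dots> \<le> 1 * (s * norm p) + 1 * (s * norm q)"
          using that s by (intro add_mono mult_right_mono) auto
        also have "\<dots> = s * n" by (simp flip: pq add: distrib_left)
        finally show ?thesis .
      qed
      have inS: "x + c *\<^sub>R s *\<^sub>R p + \<tau> *\<^sub>R s *\<^sub>R q \<in> S" if "0 \<le> \<tau>" "\<tau> \<le> 1" "0 \<le> c" "c \<le> 1" for \<tau> c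
      proof -
        have "dist x (x + c *\<^sub>R s *\<^sub>R p + \<tau> *\<^sub>R s *\<^sub>R q) < r"
          using small[OF that] \<open>s * n < min d r\<close>
          by (metis add.assoc dist_add_cancel2 dist_0_norm dist_commute dist_norm add_diff_cancel_left' min_less_iff_conj order_le_less_trans)
        then show ?thesis using r(2) by (intro subsetD[OF r(2)]) (simp only: mem_ball)
      qed
      have "(k has_real_derivative ((g (x + s *\<^sub>R p + \<tau> *\<^sub>R s *\<^sub>R q) - g (x + \<tau> *\<^sub>R s *\<^sub>R q)) \<bullet> (s *\<^sub>R q))) (at \<tau>)"
        if "0 \<le> \<tau>" "\<tau> \<le> 1" for \<tau>
      proof -
        have "((\<lambda>\<tau>. f (x + c *\<^sub>R s *\<^sub>R p + \<tau> *\<^sub>R s *\<^sub>R q)) has_derivative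
            (\<lambda>h. g (x + c *\<^sub>R s *\<^sub>R p + \<tau> *\<^sub>R s *\<^sub>R q) \<bullet> (h *\<^sub>R s *\<^sub>R q))) (at \<tau>)" if "0 \<le> c" "c \<le> 1" for c
        proof (rule has_derivative_compose[OF _ f])
          show "((\<lambda>\<tau>. x + c *\<^sub>R s *\<^sub>R p + \<tau> *\<^sub>R s *\<^sub>R q) has_derivative (\<lambda>h. h *\<^sub>R s *\<^sub>R q)) (at \<tau>)"
            by (auto intro!: derivative_eq_intros)
        qed (rule inS[OF \<open>0 \<le> \<tau>\<close> \<open>\<tau> \<le> 1\<close> that])
        from has_derivative_diff[OF this[of 1] this[of 0]]
        have "(k has_derivative (\<lambda>h. g (x + s *\<^sub>R p + \<tau> *\<^sub>R s *\<^sub>R q) \<bullet> (h *\<^sub>R s *\<^sub>R q)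
            - g (x + \<tau> *\<^sub>R s *\<^sub>R q) \<bullet> (h *\<^sub>R s *\<^sub>R q))) (at \<tau>)"
          unfolding k_def by simp
        then show ?thesis unfolding has_field_derivative_def
          by (rule has_derivative_eq_rhs) (auto simp: fun_eq_iff inner_diff_left algebra_simps)
      qed
      then obtain z where z: "0 < z" "z < 1"
        "k 1 - k 0 = (1 - 0) * ((g (x + s *\<^sub>R p + z *\<^sub>R s *\<^sub>R q) - g (x + z *\<^sub>R s *\<^sub>R q)) \<bullet> (s *\<^sub>R q))"
        using MVT2[of 0 1 k "\<lambda>\<tau>. (g (x + s *\<^sub>R p + \<tau> *\<^sub>R s *\<^sub>R q) - g (x + \<tau> *\<^sub>R s *\<^sub>R q)) \<bullet> (s *\<^sub>R q)"] by auto
      define R where "R c = g (x + c *\<^sub>R s *\<^sub>R p + z *\<^sub>R s *\<^sub>R q) - g x - A (c *\<^sub>R s *\<^sub>R p + z *\<^sub>R s *\<^sub>R q)" for c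
      have R: "norm (R c) \<le> e * (s * n)" if "0 \<le> c" "c \<le> 1" for c
      proof -
        have sm: "norm (c *\<^sub>R s *\<^sub>R p + z *\<^sub>R s *\<^sub>R q) \<le> s * n" using small that z by simp
        have "norm (R c) \<le> e * norm (c *\<^sub>R s *\<^sub>R p + z *\<^sub>R s *\<^sub>R q)"
          using d(2)[of "x + c *\<^sub>R s *\<^sub>R p + z *\<^sub>R s *\<^sub>R q"] sm \<open>s * n < min d r\<close>
          by (simp add: R_def add.assoc)
        also have "\<dots> \<le> e * (s * n)" using sm e by simp
        finally show ?thesis .
      qed
      have gd: "g (x + s *\<^sub>R p + z *\<^sub>R s *\<^sub>R q) - g (x + z *\<^sub>R s *\<^sub>R q) = s *\<^sub>R A p + (R 1 - R 0)"
        by (simp add: R_def A.add A.scaleR)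
      have "k 1 - k 0 - s\<^sup>2 * (A p \<bullet> q) = s * ((R 1 - R 0) \<bullet> q)"
        unfolding z(3) gd by (simp add: inner_add_left power2_eq_square algebra_simps)
      also have "\<bar>\<dots>\<bar> \<le> s * ((2 * (e * (s * n))) * n)"
      proof -
        have "\<bar>(R 1 - R 0) \<bullet> q\<bar> \<le> norm (R 1 - R 0) * norm q" by (rule Cauchy_Schwarz_ineq2)
        also have "\<dots> \<le> (2 * (e * (s * n))) * n"
          using R[of 1] R[of 0] norm_triangle_ineq4[of "R 1" "R 0"] pq e s n
          by (intro mult_mono) auto
        finally show ?thesis using s by (simp add: abs_mult)
      qed
      finally show ?thesis by (simp add: k_def power2_eq_square algebra_simps)
    qed
    have "s\<^sup>2 * \<bar>A u \<bullet> v - A v \<bullet> u\<bar> = \<bar>s\<^sup>2 * (A u \<bullet> v) - s\<^sup>2 * (A v \<bullet> u)\<bar>"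
      by (metis abs_mult abs_power2 right_diff_distrib)
    also have "\<dots> \<le> s\<^sup>2 * (4 * e * n\<^sup>2)"
    proof -
      have e1: "x + s *\<^sub>R v + s *\<^sub>R u = x + s *\<^sub>R u + s *\<^sub>R v" by (simp add: algebra_simps)
      show ?thesis using one[of u v] one[of v u] unfolding n_def e1 by (simp add: algebra_simps)
    qed
    finally show ?thesis using s by (simp add: n_def algebra_simps)
  qed
  have "\<bar>A u \<bullet> v - A v \<bullet> u\<bar> \<le> 0"
  proof (rule field_le_epsilon)
    fix e :: real assume "e > 0"
    let ?m = "4 * (norm u + norm v)\<^sup>2 + 1"
    have m: "?m > 0" by (intro add_nonneg_pos) auto
    have "\<bar>A u \<bullet> v - A v \<bullet> u\<bar> \<le> e / ?m * (4 * (norm u + norm v)\<^sup>2)"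
      using key[of "e / ?m"] \<open>e > 0\<close> m by simp
    also have "\<dots> \<le> e / ?m * ?m" using \<open>e > 0\<close> m by (intro mult_left_mono) auto
    also have "\<dots> = e" using m by simp
    finally show "\<bar>A u \<bullet> v - A v \<bullet> u\<bar> \<le> 0 + e" by simp
  qed
  then show ?thesis by simp
qed

text \<open>For a binary cubic form \<open>p\<close>, the value of its polarization at \<open>(e, u, u)\<close>, where \<open>\<phi>\<close> is the angle from
the unit vector \<open>e\<close> to the unit vector \<open>u\<close>, is a convex combination of three values of \<open>p\<close> on the unit
circle. They are taken at the angles \<open>\<theta>\<close> with \<open>3 * \<theta> = 2 * \<phi>\<close> modulo \<open>2 * pi\<close>, with weights \<open>(1 + 2 * cos \<theta>)\<^sup>2 / 9\<close>.
The cubic has only the frequencies 1 and 3; the choice of the angles matches frequency 3, and the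
weights are then determined by frequency 1.\<close>

lemma cubic_trisection:
  fixes a b c d \<phi> :: real
  assumes p: "\<And>\<theta>. \<bar>a * cos \<theta> ^ 3 + 3 * b * (cos \<theta>)\<^sup>2 * sin \<theta> + 3 * c * cos \<theta> * (sin \<theta>)\<^sup>2 + d * sin \<theta> ^ 3\<bar> \<le> K"
  shows "\<bar>a * (cos \<phi>)\<^sup>2 + 2 * b * cos \<phi> * sin \<phi> + c * (sin \<phi>)\<^sup>2\<bar> \<le> K"
proof -
  define \<psi> where "\<psi> = 2 * \<phi> / 3"
  define C where "C = cos \<psi>"
  define S where "S = sin \<psi>"
  define r where "r = sqrt 3"
  define pp where "pp x y = a * x ^ 3 + 3 * b * x\<^sup>2 * y + 3 * c * x * y\<^sup>2 + d * y ^ 3" for x y :: real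
  have r: "r\<^sup>2 = 3" by (simp add: r_def)
  have CS: "S\<^sup>2 = 1 - C\<^sup>2" by (simp add: C_def S_def sin_squared_eq)
  have c1: "cos (\<psi> + 2 * pi / 3) = - (C + r * S) / 2" "sin (\<psi> + 2 * pi / 3) = (r * C - S) / 2"
    by (simp_all add: cos_add sin_add cos_120 sin_120 C_def S_def r_def)
  have c2: "cos (\<psi> - 2 * pi / 3) = (r * S - C) / 2" "sin (\<psi> - 2 * pi / 3) = - (r * C + S) / 2"
    by (simp_all add: cos_diff sin_diff cos_120 sin_120 C_def S_def r_def)
  define x1 where "x1 = - (C + r * S) / 2"
  define y1 where "y1 = (r * C - S) / 2"
  define x2 where "x2 = (r * S - C) / 2"
  define y2 where "y2 = - (r * C + S) / 2"
  have b0: "\<bar>pp C S\<bar> \<le> K" using p[of \<psi>] by (simp add: pp_def C_def S_def)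
  have b1: "\<bar>pp x1 y1\<bar> \<le> K" using p[of "\<psi> + 2 * pi / 3"] unfolding c1 pp_def x1_def y1_def by simp
  have b2: "\<bar>pp x2 y2\<bar> \<le> K" using p[of "\<psi> - 2 * pi / 3"] unfolding c2 pp_def x2_def y2_def by simp
  have dbl: "2 * \<phi> = 3 * \<psi>" by (simp add: \<psi>_def)
  have "cos (2 * \<phi>) = 4 * C ^ 3 - 3 * C" unfolding dbl C_def by (rule cos_treble_cos)
  then have cc: "(cos \<phi>)\<^sup>2 = (1 + 4 * C ^ 3 - 3 * C) / 2" "(sin \<phi>)\<^sup>2 = (1 - 4 * C ^ 3 + 3 * C) / 2"
    using cos_double_cos[of \<phi>] cos_double_sin[of \<phi>] by simp_all
  have "sin (3 * \<psi>) = sin (2 * \<psi>) * C + cos (2 * \<psi>) * S"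
    using sin_add[of "2 * \<psi>" \<psi>] by (simp add: C_def S_def)
  also have "\<dots> = S * (4 * C\<^sup>2 - 1)"
    unfolding sin_double cos_double_cos C_def S_def by algebra
  finally have sc: "2 * cos \<phi> * sin \<phi> = S * (4 * C\<^sup>2 - 1)"
    unfolding dbl[symmetric] sin_double by (simp add: mult_ac)
  have h: "2 * x1 = - (C + r * S)" "2 * y1 = r * C - S" "2 * x2 = r * S - C" "2 * y2 = - (r * C + S)"
    by (simp_all add: x1_def y1_def x2_def y2_def)
  \<comment> \<open>the weights add up to 1, and the four coefficients of the cubic agree\<close>
  have w: "(1 + 2 * C)\<^sup>2 + (1 + 2 * x1)\<^sup>2 + (1 + 2 * x2)\<^sup>2 = 9"
    using h r CS by algebra
  have i1: "(1 + 2 * C)\<^sup>2 * C ^ 3 + (1 + 2 * x1)\<^sup>2 * x1 ^ 3 + (1 + 2 * x2)\<^sup>2 * x2 ^ 3 = 9 * (1 + 4 * C ^ 3 - 3 * C) / 2"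
    using h r CS by algebra
  have i2: "(1 + 2 * C)\<^sup>2 * (3 * C\<^sup>2 * S) + (1 + 2 * x1)\<^sup>2 * (3 * x1\<^sup>2 * y1) + (1 + 2 * x2)\<^sup>2 * (3 * x2\<^sup>2 * y2) = 9 * (S * (4 * C\<^sup>2 - 1))"
    using h r CS by algebra
  have i3: "(1 + 2 * C)\<^sup>2 * (3 * C * S\<^sup>2) + (1 + 2 * x1)\<^sup>2 * (3 * x1 * y1\<^sup>2) + (1 + 2 * x2)\<^sup>2 * (3 * x2 * y2\<^sup>2) = 9 * (1 - 4 * C ^ 3 + 3 * C) / 2"
    using h r CS by algebra
  have i4: "(1 + 2 * C)\<^sup>2 * S ^ 3 + (1 + 2 * x1)\<^sup>2 * y1 ^ 3 + (1 + 2 * x2)\<^sup>2 * y2 ^ 3 = 0"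
    using h r CS by algebra
  have "9 * (a * (cos \<phi>)\<^sup>2 + 2 * b * cos \<phi> * sin \<phi> + c * (sin \<phi>)\<^sup>2)
      = a * (9 * (1 + 4 * C ^ 3 - 3 * C) / 2) + b * (9 * (S * (4 * C\<^sup>2 - 1))) + c * (9 * (1 - 4 * C ^ 3 + 3 * C) / 2)"
    unfolding cc sc[symmetric] by (simp add: algebra_simps)
  also have "\<dots> = (1 + 2 * C)\<^sup>2 * pp C S + (1 + 2 * x1)\<^sup>2 * pp x1 y1 + (1 + 2 * x2)\<^sup>2 * pp x2 y2"
    unfolding i1[symmetric] i2[symmetric] i3[symmetric] pp_def using i4 by algebra
  also have "\<bar>\<dots>\<bar> \<le> (1 + 2 * C)\<^sup>2 * K + (1 + 2 * x1)\<^sup>2 * K + (1 + 2 * x2)\<^sup>2 * K"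
  proof -
    have *: "\<bar>u * v\<bar> \<le> u * K" if "\<bar>v\<bar> \<le> K" "u \<ge> 0" for u v :: real
      using that by (simp add: abs_mult mult_left_mono)
    show ?thesis
      using *[OF b0, of "(1 + 2 * C)\<^sup>2"] *[OF b1, of "(1 + 2 * x1)\<^sup>2"] *[OF b2, of "(1 + 2 * x2)\<^sup>2"] by simp
  qed
  also have "\<dots> = 9 * K" by (simp add: w flip: distrib_right)
  finally show ?thesis by (simp add: abs_mult)
qed


text \<open>A symmetric trilinear form that is bounded on the diagonal of a Euclidean space satisfies the same
bound, with the same constant, in mixed arguments. Only the plane spanned by \<open>h\<close> and \<open>u\<close> matters, and
there the statement is \<open>cubic_trisection\<close> in an orthonormal basis \<open>e\<close>, \<open>f\<close> with \<open>e\<close> parallel to \<open>h\<close>.\<close>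

lemma trilinear_form_bound:
  fixes T :: "'a::real_vector \<Rightarrow> 'a \<Rightarrow> 'a \<Rightarrow> real" and B :: "'a \<Rightarrow> 'a \<Rightarrow> real"
  assumes linT: "\<And>u v. linear (T u v)" and T12: "\<And>u v w. T u v w = T v u w" and T23: "\<And>u v w. T u v w = T u w v"
    and linB: "\<And>u. linear (B u)" and B12: "\<And>u v. B u v = B v u" and Bpos: "\<And>u. u \<noteq> 0 \<Longrightarrow> B u u > 0"
    and diag: "\<And>h. \<bar>T h h h\<bar> \<le> 2 * sqrt (B h h) ^ 3"
  shows "\<bar>T h u u\<bar> \<le> 2 * sqrt (B h h) * B u u"
proof (cases "h = 0 \<or> u = 0")
  case True
  have "T 0 u u = 0" "T h u 0 = 0"
    using linear_0[OF linT] T12 T23 by metis+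
  then show ?thesis using True linear_0[OF linB] by (metis abs_zero mult_eq_0_iff order_refl real_sqrt_zero)
next
  case False
  note Tadd = linear_add[OF linT] and Tsc = linear_scale[OF linT] and Badd = linear_add[OF linB] and Bsc = linear_scale[OF linB]
  have Tsc2: "T u (c *\<^sub>R v) w = c * T u v w" "T (c *\<^sub>R u) v w = c * T u v w" for u v w c
    using Tsc T12 T23 by (metis real_scaleR_def)+
  have Tadd2: "T u (v + v') w = T u v w + T u v' w" "T (u + u') v w = T u v w + T u' v w" for u u' v v' w
    using Tadd T12 T23 by metis+
  have Bsc2: "B (c *\<^sub>R v) w = c * B v w" for v w c
    using Bsc B12 by (metis real_scaleR_def)
  have Badd2: "B (v + v') w = B v w + B v' w" for v v' w
    using Badd B12 by metis
  note Ts = Tadd Tsc Tsc2 Tadd2 and Bs = Badd Bsc Bsc2 Badd2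
  define H where "H = sqrt (B h h)"
  define U where "U = sqrt (B u u)"
  have H: "H > 0" "H\<^sup>2 = B h h" using Bpos[of h] False by (auto simp: H_def)
  have U: "U > 0" "U\<^sup>2 = B u u" using Bpos[of u] False by (auto simp: U_def)
  define e where "e = (1 / H) *\<^sub>R h"
  define v where "v = (1 / U) *\<^sub>R u"
  have h: "h = H *\<^sub>R e" using H by (simp add: e_def)
  have u: "u = U *\<^sub>R v" using U by (simp add: v_def)
  have ee: "B e e = 1" using H(1) unfolding e_def by (simp add: Bs flip: H(2)) (simp add: power2_eq_square)
  have vv: "B v v = 1" using U(1) unfolding v_def by (simp add: Bs flip: U(2)) (simp add: power2_eq_square)
  define co where "co = B e v"
  define x where "x = v + (- co) *\<^sub>R e"
  have "B (v + k *\<^sub>R e) (v + k *\<^sub>R e) = 1 + 2 * k * co + k\<^sup>2" for k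
    by (simp add: Bs ee vv co_def B12[of v e] power2_eq_square algebra_simps)
  from this[of "- co"] have xx: "B x x = 1 - co\<^sup>2"
    by (simp add: x_def power2_eq_square)
  have ex: "B e x = 0" unfolding x_def by (simp only: Bs ee) (simp add: co_def)
  have v: "v = co *\<^sub>R e + x" by (simp add: x_def)
  have "\<bar>T e v v\<bar> \<le> 2"
  proof (cases "x = 0")
    case True
    have "T e v v = co\<^sup>2 * T e e e" unfolding v True by (simp add: Ts power2_eq_square)
    moreover have "co\<^sup>2 = 1" using xx True linear_0[OF linB] by simp
    ultimately show ?thesis using diag[of e] ee by simp
  next
    case False
    define w where "w = sqrt (1 - co\<^sup>2)"
    have w: "w > 0" "w\<^sup>2 = 1 - co\<^sup>2" using Bpos[OF False] xx by (auto simp: w_def)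
    define f where "f = (1 / w) *\<^sub>R x"
    have xf: "x = w *\<^sub>R f" using w by (simp add: f_def)
    have ff: "B f f = 1" using w unfolding f_def by (simp add: Bs xx flip: w(2)) (simp add: power2_eq_square)
    have ef: "B e f = 0" unfolding f_def by (simp add: Bs ex)
    have "co\<^sup>2 \<le> 1" using w by (smt (verit) zero_le_power2)
    then have "\<bar>co\<bar> \<le> 1" by (simp add: abs_square_le_1)
    define \<phi> where "\<phi> = arccos co"
    have cs: "cos \<phi> = co" "sin \<phi> = w"
      using \<open>\<bar>co\<bar> \<le> 1\<close> by (auto simp: \<phi>_def w_def sin_arccos)
    have pq: "T e f e = T e e f" "T f e e = T e e f" "T f e f = T e f f" "T f f e = T e f f"
      by (metis T12 T23)+
    have "\<bar>T e e e * cos \<theta> ^ 3 + 3 * T e e f * (cos \<theta>)\<^sup>2 * sin \<theta> + 3 * T e f f * cos \<theta> * (sin \<theta>)\<^sup>2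
        + T f f f * sin \<theta> ^ 3\<bar> \<le> 2" for \<theta>
    proof -
      let ?z = "cos \<theta> *\<^sub>R e + sin \<theta> *\<^sub>R f"
      have "B ?z ?z = (cos \<theta>)\<^sup>2 + (sin \<theta>)\<^sup>2"
        by (simp add: Bs ee ff ef B12[of f e] power2_eq_square)
      then have "B ?z ?z = 1" by simp
      moreover have "T ?z ?z ?z = T e e e * cos \<theta> ^ 3 + 3 * T e e f * (cos \<theta>)\<^sup>2 * sin \<theta>
          + 3 * T e f f * cos \<theta> * (sin \<theta>)\<^sup>2 + T f f f * sin \<theta> ^ 3"
        by (simp add: Ts pq power2_eq_square power3_eq_cube algebra_simps)
      ultimately show ?thesis using diag[of ?z] by simp
    qed
    from cubic_trisection[OF this, of \<phi>]
    have "\<bar>T e e e * co\<^sup>2 + 2 * T e e f * co * w + T e f f * w\<^sup>2\<bar> \<le> 2" unfolding cs .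
    moreover have "T e v v = T e e e * co\<^sup>2 + 2 * T e e f * co * w + T e f f * w\<^sup>2"
      unfolding v xf by (simp add: Ts pq power2_eq_square algebra_simps)
    ultimately show ?thesis by simp
  qed
  moreover have "T h u u = H * U\<^sup>2 * T e v v"
    unfolding h u by (simp add: Ts power2_eq_square)
  ultimately have "\<bar>T h u u\<bar> \<le> H * U\<^sup>2 * 2"
    using H(1) by (simp add: abs_mult mult_left_mono)
  then show ?thesis unfolding U(2) by (simp add: H_def algebra_simps)
qed

section \<open>Differential inequalities on a segment\<close>

lemma DERIV_le_imp_diff_le:
  fixes f g :: "real \<Rightarrow> real"
  assumes "a \<le> b"
    and f: "\<And>x. a \<le> x \<Longrightarrow> x \<le> b \<Longrightarrow> (f has_real_derivative f' x) (at x)"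
    and g: "\<And>x. a \<le> x \<Longrightarrow> x \<le> b \<Longrightarrow> (g has_real_derivative g' x) (at x)"
    and le: "\<And>x. a \<le> x \<Longrightarrow> x \<le> b \<Longrightarrow> f' x \<le> g' x"
  shows "f b - f a \<le> g b - g a"
proof -
  have "(\<lambda>x. g x - f x) a \<le> (\<lambda>x. g x - f x) b"
  proof (rule DERIV_nonneg_imp_nondecreasing[OF \<open>a \<le> b\<close>])
    fix x assume x: "a \<le> x" "x \<le> b"
    show "\<exists>y. ((\<lambda>x. g x - f x) has_real_derivative y) (at x) \<and> 0 \<le> y"
      using DERIV_diff[OF g[OF x] f[OF x]] le[OF x] by (intro exI[of _ "g' x - f' x"]) auto
  qed
  then show ?thesis by simp
qed

lemma second_derivative_upper_bound:
  fixes f f1 f2 :: "real \<Rightarrow> real"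
  assumes "0 \<le> s"
    and f: "\<And>\<tau>. 0 \<le> \<tau> \<Longrightarrow> \<tau> \<le> s \<Longrightarrow> (f has_real_derivative f1 \<tau>) (at \<tau>)"
    and f1: "\<And>\<tau>. 0 \<le> \<tau> \<Longrightarrow> \<tau> \<le> s \<Longrightarrow> (f1 has_real_derivative f2 \<tau>) (at \<tau>)"
    and C: "\<And>\<tau>. 0 \<le> \<tau> \<Longrightarrow> \<tau> \<le> s \<Longrightarrow> f2 \<tau> \<le> C"
  shows "f s \<le> f 0 + f1 0 * s + C / 2 * s\<^sup>2"
proof -
  have 1: "f1 \<tau> \<le> f1 0 + C * \<tau>" if "0 \<le> \<tau>" "\<tau> \<le> s" for \<tau>
  proof -
    have "f1 \<tau> - f1 0 \<le> C * \<tau> - C * 0"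
      by (rule DERIV_le_imp_diff_le[OF that(1) f1]) (use that C in \<open>auto intro!: derivative_eq_intros\<close>)
    then show ?thesis by simp
  qed
  have "f s - f 0 \<le> (f1 0 * s + C / 2 * s\<^sup>2) - (f1 0 * 0 + C / 2 * 0\<^sup>2)"
    by (rule DERIV_le_imp_diff_le[OF assms(1) f, where g' = "\<lambda>\<tau>. f1 0 + C * \<tau>"])
      (use 1 in \<open>auto intro!: derivative_eq_intros\<close>)
  then show ?thesis by simp
qed

text \<open>The differential inequality says that \<open>1 / sqrt g\<close> is 1-Lipschitz, and the conclusion is this
Lipschitz bound multiplied by \<open>sqrt (g s) * sqrt (g 0)\<close>. In this form it also covers zeros of \<open>g\<close>: if
\<open>g 0 = 0\<close>, then \<open>g s = 0\<close>. The proof works with \<open>1 / sqrt (g + e)\<close>, which is 1-Lipschitz as well, and lets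
\<open>e\<close> tend to 0.\<close>

lemma sqrt_self_concordant:
  fixes g g' :: "real \<Rightarrow> real"
  assumes "0 \<le> s"
    and g: "\<And>\<tau>. 0 \<le> \<tau> \<Longrightarrow> \<tau> \<le> s \<Longrightarrow> (g has_real_derivative g' \<tau>) (at \<tau>)"
    and pos: "\<And>\<tau>. 0 \<le> \<tau> \<Longrightarrow> \<tau> \<le> s \<Longrightarrow> 0 \<le> g \<tau>"
    and bd: "\<And>\<tau>. 0 \<le> \<tau> \<Longrightarrow> \<tau> \<le> s \<Longrightarrow> \<bar>g' \<tau>\<bar> \<le> 2 * sqrt (g \<tau>) ^ 3"
  shows "\<bar>sqrt (g s) - sqrt (g 0)\<bar> \<le> s * sqrt (g s) * sqrt (g 0)"
proof -
  have eps: "\<bar>sqrt (g s + e) - sqrt (g 0 + e)\<bar> \<le> s * sqrt (g s + e) * sqrt (g 0 + e)" if e: "e > 0" for e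
  proof -
    define w where "w \<tau> = 1 / sqrt (g \<tau> + e)" for \<tau>
    define w' where "w' \<tau> = - g' \<tau> / (2 * sqrt (g \<tau> + e) ^ 3)" for \<tau>
    have w: "(w has_real_derivative w' \<tau>) (at \<tau>)" if "0 \<le> \<tau>" "\<tau> \<le> s" for \<tau>
    proof -
      have ge: "g \<tau> + e > 0" using pos[OF that] e by simp
      have "(w has_real_derivative - (inverse (sqrt (g \<tau> + e)) / 2 * g' \<tau>) / (sqrt (g \<tau> + e) * sqrt (g \<tau> + e))) (at \<tau>)"
        unfolding w_def using ge by (auto intro!: derivative_eq_intros g that)
      also have "- (inverse (sqrt (g \<tau> + e)) / 2 * g' \<tau>) / (sqrt (g \<tau> + e) * sqrt (g \<tau> + e)) = w' \<tau>"
        unfolding w'_def using ge by (simp add: power3_eq_cube field_simps)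
      finally show ?thesis .
    qed
    have w': "\<bar>w' \<tau>\<bar> \<le> 1" if "0 \<le> \<tau>" "\<tau> \<le> s" for \<tau>
    proof -
      have ge: "g \<tau> + e > 0" using pos[OF that] e by simp
      have "\<bar>g' \<tau>\<bar> \<le> 2 * sqrt (g \<tau>) ^ 3" by (rule bd[OF that])
      also have "\<dots> \<le> 2 * sqrt (g \<tau> + e) ^ 3"
        using pos[OF that] e by (intro mult_left_mono power_mono) auto
      finally show ?thesis using ge by (simp add: w'_def abs_mult power_abs)
    qed
    have "w s - w 0 \<le> s - 0"
      by (rule DERIV_le_imp_diff_le[OF assms(1) w]) (use w' abs_le_D1 in \<open>auto intro!: derivative_eq_intros\<close>)
    moreover have "- s - (- 0) \<le> w s - w 0"
    proof (rule DERIV_le_imp_diff_le[OF assms(1) _ w])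
      show "((\<lambda>\<tau>. - \<tau>) has_real_derivative - 1) (at \<tau>)" for \<tau> :: real
        by (auto intro!: derivative_eq_intros)
      show "- 1 \<le> w' \<tau>" if "0 \<le> \<tau>" "\<tau> \<le> s" for \<tau>
        using w'[OF that] by simp
    qed
    ultimately have *: "\<bar>w s - w 0\<bar> \<le> s" by simp
    have p: "sqrt (g s + e) > 0" "sqrt (g 0 + e) > 0"
      using pos[of s] pos[of 0] assms(1) e by simp_all
    have "sqrt (g s + e) - sqrt (g 0 + e) = - (w s - w 0) * (sqrt (g s + e) * sqrt (g 0 + e))"
      using p unfolding w_def by (simp add: field_simps)
    then have "\<bar>sqrt (g s + e) - sqrt (g 0 + e)\<bar> = \<bar>w s - w 0\<bar> * (sqrt (g s + e) * sqrt (g 0 + e))"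
      using p by (simp add: abs_mult)
    also have "\<dots> \<le> s * (sqrt (g s + e) * sqrt (g 0 + e))"
      using p * by (intro mult_right_mono) auto
    finally show ?thesis by (simp add: mult.assoc)
  qed
  let ?D = "\<lambda>e. s * sqrt (g s + e) * sqrt (g 0 + e) - \<bar>sqrt (g s + e) - sqrt (g 0 + e)\<bar>"
  have lim: "(?D \<longlongrightarrow> ?D 0) (at_right 0)"
    by (intro tendsto_intros)
  have "0 \<le> ?D 0"
    by (rule tendsto_lowerbound[OF lim]) (use eps in \<open>auto simp: eventually_at_filter\<close>)
  then show ?thesis by simp
qed

section \<open>Hessians of a self-concordant barrier\<close>

locale bounded_barrier =
  fixes Q :: "(real ^ 'n) set" and F :: "real ^ 'n \<Rightarrow> real" and \<nu> :: real
  assumes bounded_Q: "bounded Q" and closed_Q: "closed Q" and convex_Q: "convex Q"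
    and barrier: "self_concordant_barrier \<nu> Q F"
begin

abbreviation "S \<equiv> interior Q"

definition hess_form :: "real ^ 'n \<Rightarrow> real ^ 'n \<Rightarrow> real ^ 'n \<Rightarrow> real" where
  "hess_form x u v = u \<bullet> (hessian F x *v v)"

definition third_form :: "real ^ 'n \<Rightarrow> real ^ 'n \<Rightarrow> real ^ 'n \<Rightarrow> real ^ 'n \<Rightarrow> real" where
  "third_form x h u v = u \<bullet> (third_deriv F x h *v v)"

definition local_norm :: "real ^ 'n \<Rightarrow> real ^ 'n \<Rightarrow> real" where
  "local_norm x h = sqrt (hess_form x h h)"

lemma convex_S: "convex S"
  using convex_Q by (rule convex_interior)

lemma F_has_derivative:
  assumes "x \<in> S"
  shows "(F has_derivative (\<lambda>h. gradient F x \<bullet> h)) (at x)"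
proof -
  let ?f = "frechet_derivative F (at x)"
  have f: "(F has_derivative ?f) (at x)"
    using barrier assms unfolding self_concordant_barrier_def C3_on_def
    by (simp add: frechet_derivative_works)
  have lin: "linear ?f" by (rule has_derivative_linear[OF f])
  have "?f h = gradient F x \<bullet> h" for h
  proof -
    have "?f h = ?f (\<Sum>i\<in>UNIV. (h $ i) *\<^sub>R axis i 1)"
      using basis_expansion[of h] by (simp add: scalar_mult_eq_scaleR)
    also have "\<dots> = (\<Sum>i\<in>UNIV. (h $ i) * ?f (axis i 1))"
      by (simp add: linear_sum[OF lin] linear_scale[OF lin])
    also have "\<dots> = gradient F x \<bullet> h"
      by (simp add: gradient_def inner_vec_def mult.commute)
    finally show ?thesis .
  qed
  then have "?f = (\<lambda>h. gradient F x \<bullet> h)" by auto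
  then show ?thesis using f by simp
qed

lemma gradient_has_derivative:
  assumes "x \<in> S"
  shows "(gradient F has_derivative (\<lambda>h. hessian F x *v h)) (at x)"
proof -
  have f: "(gradient F has_derivative frechet_derivative (gradient F) (at x)) (at x)"
    using barrier assms unfolding self_concordant_barrier_def C3_on_def
    by (simp add: frechet_derivative_works)
  have "(\<lambda>h. hessian F x *v h) = frechet_derivative (gradient F) (at x)"
    unfolding hessian_def by (rule matrix_vector_mul(2)[OF has_derivative_linear[OF f]])
  then show ?thesis using f by simp
qed

lemma hessian_has_derivative:
  assumes "x \<in> S"
  shows "(hessian F has_derivative third_deriv F x) (at x)"
proof -
  have f: "(hessian F has_derivative frechet_derivative (hessian F) (at x)) (at x)"
    using barrier assms unfolding self_concordant_barrier_def C3_on_def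
    by (simp add: frechet_derivative_works)
  moreover have "third_deriv F x = frechet_derivative (hessian F) (at x)"
    by (rule ext) (simp add: third_deriv_def)
  ultimately show ?thesis by simp
qed

lemma hessian_mult_has_derivative:
  assumes "x \<in> S"
  shows "((\<lambda>y. hessian F y *v v) has_derivative (\<lambda>h. third_deriv F x h *v v)) (at x)"
proof -
  have "linear (\<lambda>A :: real ^ 'n ^ 'n. A *v v)"
    by (rule linearI) (simp_all add: matrix_vector_mult_add_rdistrib scaleR_matrix_vector_assoc)
  then have "bounded_linear (\<lambda>A :: real ^ 'n ^ 'n. A *v v)"
    by (simp add: linear_conv_bounded_linear)
  from bounded_linear.has_derivative[OF this hessian_has_derivative[OF assms]]
  show ?thesis .
qed

lemma hess_form_has_derivative:
  assumes "x \<in> S"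
  shows "((\<lambda>y. hess_form y u v) has_derivative (\<lambda>h. third_form x h u v)) (at x)"
  unfolding hess_form_def third_form_def
  by (rule has_derivative_inner_right[OF hessian_mult_has_derivative[OF assms]])

lemma line_has_derivative:
  "((\<lambda>s. x + s *\<^sub>R h) has_derivative (\<lambda>k. k *\<^sub>R h)) (at s)"
  by (auto intro!: derivative_eq_intros)

lemma F_line_deriv:
  assumes "x + s *\<^sub>R h \<in> S"
  shows "((\<lambda>s. F (x + s *\<^sub>R h)) has_real_derivative gradient F (x + s *\<^sub>R h) \<bullet> h) (at s)"
  using has_derivative_compose[OF line_has_derivative F_has_derivative[OF assms]]
  by (simp add: has_field_derivative_def mult_commute_abs)

lemma hess_form_linear: "linear (hess_form x u)" "linear (\<lambda>u. hess_form x u v)"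
  unfolding hess_form_def
  by (auto intro!: linearI simp: matrix_vector_right_distrib inner_add_right inner_add_left matrix_vector_mult_scaleR)

lemma gradient_line_deriv:
  assumes "x + s *\<^sub>R h \<in> S"
  shows "((\<lambda>s. gradient F (x + s *\<^sub>R h) \<bullet> w) has_real_derivative hess_form (x + s *\<^sub>R h) w h) (at s)"
  using has_derivative_inner_left[OF has_derivative_compose[OF line_has_derivative gradient_has_derivative[OF assms]], of w]
  by (simp add: has_field_derivative_def hess_form_def matrix_vector_mult_scaleR inner_commute mult_commute_abs)

lemma third_form_scale: 
  assumes "x \<in> S" shows "third_form x (k *\<^sub>R h) u v = k * third_form x h u v"
  using linear_scale[OF has_derivative_linear[OF hess_form_has_derivative[OF assms, of u v]], of k h] by simp

lemma hess_form_line_deriv: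
  assumes "x + s *\<^sub>R h \<in> S"
  shows "((\<lambda>s. hess_form (x + s *\<^sub>R h) u v) has_real_derivative third_form (x + s *\<^sub>R h) h u v) (at s)"
  using has_derivative_compose[OF line_has_derivative hess_form_has_derivative[OF assms], of u v]
  by (simp add: has_field_derivative_def third_form_scale[OF assms] mult_commute_abs)

lemma hess_form_sym:
  assumes "x \<in> S" shows "hess_form x u v = hess_form x v u"
  using mixed_derivative_symmetric[OF open_interior assms F_has_derivative gradient_has_derivative[OF assms], of v u]
  by (simp add: hess_form_def inner_commute)

lemma third_form_sym23:
  assumes "x \<in> S" shows "third_form x h u v = third_form x h v u"
proof -
  have "((\<lambda>y. hess_form y u v) has_derivative (\<lambda>h. third_form x h v u)) (at x)"
    by (rule has_derivative_transform_within_open[OF hess_form_has_derivative[OF assms] open_interior assms])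
      (rule hess_form_sym)
  from has_derivative_unique[OF this hess_form_has_derivative[OF assms]]
  show ?thesis by (rule fun_cong[symmetric])
qed

lemma third_form_sym12:
  assumes "x \<in> S" shows "third_form x h u v = third_form x u h v"
proof -
  have "((\<lambda>y. gradient F y \<bullet> v) has_derivative (\<lambda>h. (hessian F y *v v) \<bullet> h)) (at y)" if "y \<in> S" for y
    using has_derivative_inner_left[OF gradient_has_derivative[OF that], of v] hess_form_sym[OF that, of v]
    by (simp add: hess_form_def inner_commute)
  from mixed_derivative_symmetric[OF open_interior assms this hessian_mult_has_derivative[OF assms], of h u]
  show ?thesis by (simp add: third_form_def inner_commute)
qed

lemma segment_in_S:
  assumes "x \<in> S" "x + s *\<^sub>R h \<in> S" "0 \<le> \<tau>" "\<tau> \<le> s"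
  shows "x + \<tau> *\<^sub>R h \<in> S"
proof (cases "s = 0")
  case True
  then show ?thesis using assms by simp
next
  case False
  have "(1 - \<tau> / s) *\<^sub>R x + (\<tau> / s) *\<^sub>R (x + s *\<^sub>R h) \<in> S"
    using convexD_alt[OF convex_S assms(1,2), of "\<tau> / s"] assms(3,4) False by (simp add: field_simps)
  also have "(1 - \<tau> / s) *\<^sub>R x + (\<tau> / s) *\<^sub>R (x + s *\<^sub>R h) = x + \<tau> *\<^sub>R h"
    using False by (simp add: algebra_simps)
  finally show ?thesis .
qed

lemma open_line: "open {s. x + s *\<^sub>R h \<in> S}"
proof -
  have "open ((\<lambda>s. x + s *\<^sub>R h) -` S)"
    by (intro open_vimage continuous_intros) simp
  then show ?thesis by (simp add: vimage_def)
qed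

text \<open>If the second derivative along a line were negative at \<open>x\<close>, the slope would decrease to the right of
\<open>x\<close>, which contradicts the two tangent inequalities of a convex function.\<close>

lemma hess_form_nonneg:
  assumes x: "x \<in> S" shows "hess_form x h h \<ge> 0"
proof (rule ccontr)
  assume "\<not> ?thesis"
  then have neg: "hess_form x h h < 0" by simp
  define A where "A = {s. x + s *\<^sub>R h \<in> S}"
  have "open A" unfolding A_def by (rule open_line)
  have "convex A"
  proof (rule convexI)
    fix a b u v :: real assume *: "a \<in> A" "b \<in> A" "0 \<le> u" "0 \<le> v" "u + v = 1"
    have "u *\<^sub>R (x + a *\<^sub>R h) + v *\<^sub>R (x + b *\<^sub>R h) \<in> S"
      using * convexD[OF convex_S] by (auto simp: A_def)
    also have "u *\<^sub>R (x + a *\<^sub>R h) + v *\<^sub>R (x + b *\<^sub>R h) = (u + v) *\<^sub>R x + (u * a + v * b) *\<^sub>R h"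
      by (simp add: algebra_simps)
    finally show "u *\<^sub>R a + v *\<^sub>R b \<in> A" using * by (simp add: A_def)
  qed
  have conv: "convex_on A (\<lambda>s. F (x + s *\<^sub>R h))"
  proof (rule convex_onI)
    fix t a b :: real assume *: "0 < t" "t < 1" "a \<in> A" "b \<in> A"
    have "F ((1 - t) *\<^sub>R (x + a *\<^sub>R h) + t *\<^sub>R (x + b *\<^sub>R h)) \<le> (1 - t) * F (x + a *\<^sub>R h) + t * F (x + b *\<^sub>R h)"
      using barrier * convex_onD[of S F t "x + a *\<^sub>R h" "x + b *\<^sub>R h"]
      by (auto simp: self_concordant_barrier_def A_def)
    moreover have "(1 - t) *\<^sub>R (x + a *\<^sub>R h) + t *\<^sub>R (x + b *\<^sub>R h) = x + ((1 - t) *\<^sub>R a + t *\<^sub>R b) *\<^sub>R h"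
      by (simp add: algebra_simps)
    ultimately show "F (x + ((1 - t) *\<^sub>R a + t *\<^sub>R b) *\<^sub>R h) \<le> (1 - t) * F (x + a *\<^sub>R h) + t * F (x + b *\<^sub>R h)"
      by simp
  qed (rule \<open>convex A\<close>)
  have tangent: "F (x + b *\<^sub>R h) - F (x + a *\<^sub>R h) \<ge> (gradient F (x + a *\<^sub>R h) \<bullet> h) * (b - a)"
    if "a \<in> A" "b \<in> A" for a b
  proof (rule convex_on_imp_above_tangent[OF conv convex_connected[OF \<open>convex A\<close>] _ that(2)])
    show "a \<in> interior A" using \<open>open A\<close> that(1) by (simp add: interior_open)
    show "((\<lambda>s. F (x + s *\<^sub>R h)) has_real_derivative gradient F (x + a *\<^sub>R h) \<bullet> h) (at a within A)"
      using F_line_deriv that(1) by (auto intro: has_field_derivative_at_within simp: A_def)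
  qed
  have "((\<lambda>s. gradient F (x + s *\<^sub>R h) \<bullet> h) has_real_derivative hess_form x h h) (at 0)"
    using gradient_line_deriv[of x 0 h h] x by simp
  from DERIV_neg_dec_right[OF this neg] obtain d where
    d: "d > 0" "\<And>s. 0 < s \<Longrightarrow> s < d \<Longrightarrow> gradient F (x + s *\<^sub>R h) \<bullet> h < gradient F x \<bullet> h"
    by auto
  have "0 \<in> A" using x by (simp add: A_def)
  then obtain e where e: "e > 0" "ball 0 e \<subseteq> A" using \<open>open A\<close> openE by blast
  define s where "s = min d e / 2"
  have s: "0 < s" "s < d" "s \<in> A"
    using d(1) e by (auto simp: s_def min_def intro!: subsetD[OF e(2)])
  have "F (x + s *\<^sub>R h) - F x \<ge> (gradient F x \<bullet> h) * s"
    using tangent[OF \<open>0 \<in> A\<close> s(3)] by simp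
  moreover have "F x - F (x + s *\<^sub>R h) \<ge> - (gradient F (x + s *\<^sub>R h) \<bullet> h) * s"
    using tangent[OF s(3) \<open>0 \<in> A\<close>] by simp
  ultimately have "(gradient F x \<bullet> h) * s \<le> (gradient F (x + s *\<^sub>R h) \<bullet> h) * s" by linarith
  then show False using d(2)[OF s(1,2)] s(1) by simp
qed

lemma third_form_diag:
  assumes "x \<in> S" shows "\<bar>third_form x h h h\<bar> \<le> 2 * local_norm x h ^ 3"
proof -
  have "\<bar>third_form x h h h\<bar> \<le> 2 * hess_form x h h powr (3/2)"
    using barrier assms by (simp add: self_concordant_barrier_def third_form_def hess_form_def)
  also have "hess_form x h h powr (3/2) = local_norm x h ^ 3"
  proof (cases "hess_form x h h = 0")
    case False
    then have "hess_form x h h > 0" using hess_form_nonneg[OF assms, of h] by simp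
    then have "sqrt (hess_form x h h) ^ 3 = (hess_form x h h powr (1/2)) powr 3"
      by (simp add: powr_half_sqrt powr_numeral)
    then show ?thesis unfolding local_norm_def by (simp add: powr_powr)
  qed (simp add: local_norm_def)
  finally show ?thesis .
qed

lemma local_norm_nonneg: "x \<in> S \<Longrightarrow> local_norm x h \<ge> 0"
  using hess_form_nonneg by (simp add: local_norm_def)

lemma local_norm_sq: "x \<in> S \<Longrightarrow> (local_norm x h)\<^sup>2 = hess_form x h h"
  using hess_form_nonneg by (simp add: local_norm_def)

text \<open>Read as \<open>\<bar>1 / v s - 1 / v 0\<bar> \<le> s\<close> for the local norm \<open>v s\<close> of \<open>h\<close> at \<open>x + s *\<^sub>R h\<close>.\<close>

lemma local_norm_line:
  assumes "x \<in> S" "x + s *\<^sub>R h \<in> S" "0 \<le> s"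
  shows "\<bar>local_norm (x + s *\<^sub>R h) h - local_norm x h\<bar> \<le> s * local_norm (x + s *\<^sub>R h) h * local_norm x h"
proof -
  have in_S: "x + \<tau> *\<^sub>R h \<in> S" if "0 \<le> \<tau>" "\<tau> \<le> s" for \<tau>
    using segment_in_S[OF assms(1,2) that] .
  have "\<bar>sqrt (hess_form (x + s *\<^sub>R h) h h) - sqrt (hess_form (x + 0 *\<^sub>R h) h h)\<bar>
      \<le> s * sqrt (hess_form (x + s *\<^sub>R h) h h) * sqrt (hess_form (x + 0 *\<^sub>R h) h h)"
  proof (rule sqrt_self_concordant[OF assms(3)])
    show "((\<lambda>s. hess_form (x + s *\<^sub>R h) h h) has_real_derivative third_form (x + \<tau> *\<^sub>R h) h h h) (at \<tau>)"
      if "0 \<le> \<tau>" "\<tau> \<le> s" for \<tau> using hess_form_line_deriv[OF in_S[OF that]] .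
    show "0 \<le> hess_form (x + \<tau> *\<^sub>R h) h h" if "0 \<le> \<tau>" "\<tau> \<le> s" for \<tau>
      using hess_form_nonneg[OF in_S[OF that]] .
    show "\<bar>third_form (x + \<tau> *\<^sub>R h) h h h\<bar> \<le> 2 * sqrt (hess_form (x + \<tau> *\<^sub>R h) h h) ^ 3"
      if "0 \<le> \<tau>" "\<tau> \<le> s" for \<tau>
      using third_form_diag[OF in_S[OF that], of h] by (simp add: local_norm_def)
  qed
  then show ?thesis by (simp add: local_norm_def)
qed

lemma frontier_ray:
  assumes "x \<in> S" "h \<noteq> 0"
  obtains d where "d > 0" "x + d *\<^sub>R h \<in> frontier Q" "\<And>e. 0 \<le> e \<Longrightarrow> e < d \<Longrightarrow> x + e *\<^sub>R h \<in> S"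
  using ray_to_frontier[OF bounded_Q assms] by blast

lemma F_unbounded_on_ray:
  assumes "d > 0" "x + d *\<^sub>R h \<in> frontier Q" and in_S: "\<And>e. 0 \<le> e \<Longrightarrow> e < d \<Longrightarrow> x + e *\<^sub>R h \<in> S"
    and le: "\<And>e. 0 \<le> e \<Longrightarrow> e < d \<Longrightarrow> F (x + e *\<^sub>R h) \<le> C"
  shows False
proof -
  have ev: "eventually (\<lambda>e. 0 \<le> e \<and> e < d) (at_left d)"
    using eventually_at_left_real[OF assms(1)] by eventually_elim auto
  have nS: "x + d *\<^sub>R h \<notin> S" using assms(2) by (simp add: frontier_def)
  have "filterlim (\<lambda>e. x + e *\<^sub>R h) (at (x + d *\<^sub>R h) within S) (at_left d)"
    unfolding filterlim_at
  proof
    show "eventually (\<lambda>e. x + e *\<^sub>R h \<in> S \<and> x + e *\<^sub>R h \<noteq> x + d *\<^sub>R h) (at_left d)"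
    proof (rule eventually_mono[OF ev])
      fix e assume "0 \<le> e \<and> e < d"
      then have "x + e *\<^sub>R h \<in> S" using in_S by simp
      then show "x + e *\<^sub>R h \<in> S \<and> x + e *\<^sub>R h \<noteq> x + d *\<^sub>R h" using nS by auto
    qed
    show "((\<lambda>e. x + e *\<^sub>R h) \<longlongrightarrow> x + d *\<^sub>R h) (at_left d)" by (intro tendsto_intros)
  qed
  moreover have "filterlim F at_top (at (x + d *\<^sub>R h) within S)"
    using barrier assms(2) by (simp add: self_concordant_barrier_def)
  ultimately have "filterlim (\<lambda>e. F (x + e *\<^sub>R h)) at_top (at_left d)"
    by (rule filterlim_compose[rotated])
  then have "eventually (\<lambda>e. F (x + e *\<^sub>R h) > C) (at_left d)"
    by (simp add: filterlim_at_top_dense)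
  then have "eventually (\<lambda>e. (0 \<le> e \<and> e < d) \<and> F (x + e *\<^sub>R h) > C) (at_left d)"
    by (rule eventually_conj[OF ev])
  then obtain e where "0 \<le> e" "e < d" "F (x + e *\<^sub>R h) > C"
    using eventually_happens[of _ "at_left d"] trivial_limit_at_left_real by blast
  then show False using le[of e] by simp
qed

text \<open>If the second derivative in direction \<open>h\<close> vanished at \<open>x\<close>, it would vanish along the whole ray by
\<open>local_norm_line\<close>. Then \<open>F\<close> would be affine on a ray that reaches the boundary of the bounded set \<open>Q\<close>,
where \<open>F\<close> tends to infinity.\<close>

lemma hess_form_pos:
  assumes "x \<in> S" "h \<noteq> 0" shows "hess_form x h h > 0"
proof (rule ccontr)
  assume "\<not> ?thesis"
  then have z: "local_norm x h = 0"
    using hess_form_nonneg[OF assms(1), of h] by (simp add: local_norm_def)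
  obtain d where d: "d > 0" "x + d *\<^sub>R h \<in> frontier Q" "\<And>e. 0 \<le> e \<Longrightarrow> e < d \<Longrightarrow> x + e *\<^sub>R h \<in> S"
    using frontier_ray[OF assms] by metis
  have zero: "hess_form (x + e *\<^sub>R h) h h = 0" if "0 \<le> e" "e < d" for e
    using local_norm_line[OF assms(1) d(3)[OF that] that(1)] z by (simp add: local_norm_def)
  have "F (x + e *\<^sub>R h) \<le> F x + \<bar>gradient F x \<bullet> h\<bar> * d" if "0 \<le> e" "e < d" for e
  proof -
    have "F (x + e *\<^sub>R h) \<le> F (x + 0 *\<^sub>R h) + (gradient F (x + 0 *\<^sub>R h) \<bullet> h) * e + 0 / 2 * e\<^sup>2"
      by (rule second_derivative_upper_bound[OF that(1) F_line_deriv gradient_line_deriv])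
        (use that d zero in auto)
    also have "\<dots> \<le> F x + \<bar>gradient F x \<bullet> h\<bar> * d"
      using mult_mono[of "gradient F x \<bullet> h" "\<bar>gradient F x \<bullet> h\<bar>" e d] that by simp
    finally show ?thesis .
  qed
  then show False using F_unbounded_on_ray[OF d] by blast
qed

text \<open>Before leaving the interior, the ray from \<open>x\<close> to \<open>x + h\<close> would have to make \<open>F\<close> unbounded. But the second
derivative of \<open>F\<close> along it is bounded, since the local norm of \<open>h\<close> grows at most to \<open>r / (1 - r)\<close>, where
\<open>r < 1\<close> is its value at \<open>x\<close>.\<close>

lemma dikin_ellipsoid:
  assumes "x \<in> S" "local_norm x h < 1"
  shows "x + h \<in> S"
proof (cases "h = 0")
  case False
  obtain d where d: "d > 0" "x + d *\<^sub>R h \<in> frontier Q" "\<And>e. 0 \<le> e \<Longrightarrow> e < d \<Longrightarrow> x + e *\<^sub>R h \<in> S"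
    using frontier_ray[OF assms(1) False] by metis
  show ?thesis
  proof (cases "d > 1")
    case True
    then show ?thesis using d(3)[of 1] by simp
  next
    case False
    let ?r = "local_norm x h"
    let ?C = "(?r / (1 - ?r))\<^sup>2"
    have r: "?r \<ge> 0" using assms local_norm_nonneg by simp
    have bd: "hess_form (x + e *\<^sub>R h) h h \<le> ?C" if "0 \<le> e" "e < d" for e
    proof -
      let ?v = "local_norm (x + e *\<^sub>R h) h"
      have v: "?v \<ge> 0" using local_norm_nonneg[OF d(3)[OF that]] .
      have "?v - ?r \<le> e * ?v * ?r"
        using local_norm_line[OF assms(1) d(3)[OF that] that(1)] by simp
      also have "\<dots> \<le> 1 * ?v * ?r" using that False r v by (intro mult_right_mono) auto
      finally have "?v * (1 - ?r) \<le> ?r" by (simp add: algebra_simps)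
      then have "?v \<le> ?r / (1 - ?r)" using assms by (simp add: field_simps)
      then have "?v\<^sup>2 \<le> ?C" using v by (intro power_mono)
      then show ?thesis using local_norm_sq[OF d(3)[OF that]] by simp
    qed
    have "F (x + e *\<^sub>R h) \<le> F x + \<bar>gradient F x \<bullet> h\<bar> + ?C / 2" if "0 \<le> e" "e < d" for e
    proof -
      have "F (x + e *\<^sub>R h) \<le> F (x + 0 *\<^sub>R h) + (gradient F (x + 0 *\<^sub>R h) \<bullet> h) * e + ?C / 2 * e\<^sup>2"
        by (rule second_derivative_upper_bound[OF that(1) F_line_deriv gradient_line_deriv])
          (use that d bd in auto)
      also have "\<dots> \<le> F x + \<bar>gradient F x \<bullet> h\<bar> + ?C / 2"
      proof -
        have e: "e \<le> 1" "e\<^sup>2 \<le> 1" using that False by (auto simp: power_le_one)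
        have "(gradient F x \<bullet> h) * e \<le> \<bar>gradient F x \<bullet> h\<bar> * 1"
          using e that by (intro mult_mono) auto
        moreover have "?C / 2 * e\<^sup>2 \<le> ?C / 2 * 1"
          using e by (intro mult_left_mono) auto
        ultimately show ?thesis by simp
      qed
      finally show ?thesis .
    qed
    then show ?thesis using F_unbounded_on_ray[OF d] by blast
  qed
qed (use assms in simp)

lemma third_form_bound:
  assumes "x \<in> S"
  shows "\<bar>third_form x h u u\<bar> \<le> 2 * local_norm x h * hess_form x u u"
  unfolding local_norm_def
proof (rule trilinear_form_bound[where T = "third_form x" and B = "hess_form x"])
  show "linear (third_form x u v)" for u v
    unfolding third_form_def
    by (auto intro!: linearI simp: matrix_vector_right_distrib inner_add_right matrix_vector_mult_scaleR)
  show "linear (hess_form x u)" for u by (rule hess_form_linear)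
  show "third_form x u v w = third_form x v u w" for u v w by (rule third_form_sym12[OF assms])
  show "third_form x u v w = third_form x u w v" for u v w by (rule third_form_sym23[OF assms])
  show "hess_form x u v = hess_form x v u" for u v by (rule hess_form_sym[OF assms])
  show "u \<noteq> 0 \<Longrightarrow> hess_form x u u > 0" for u by (rule hess_form_pos[OF assms])
  show "\<bar>third_form x h h h\<bar> \<le> 2 * sqrt (hess_form x h h) ^ 3" for h
    using third_form_diag[OF assms, of h] by (simp add: local_norm_def)
qed

text \<open>Let \<open>g s\<close> be the Hessian form at \<open>x + s *\<^sub>R h\<close> in the fixed direction \<open>u\<close> and \<open>r\<close> the local norm of \<open>h\<close> at \<open>x\<close>.
The local norm of \<open>h\<close> at \<open>x + s *\<^sub>R h\<close> is at most \<open>r / (1 - r * s)\<close>, so the mixed bound on the third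
derivative gives \<open>\<bar>g'\<bar> \<le> 2 * r / (1 - r * s) * g\<close>. Consequently \<open>(1 - r * s)\<^sup>2 * g s\<close> is nonincreasing and
\<open>g s / (1 - r * s)\<^sup>2\<close> is nondecreasing.\<close>

lemma hess_form_compare:
  assumes x: "x \<in> S" and r: "local_norm x h < 1"
  shows "(1 - local_norm x h)\<^sup>2 * hess_form (x + h) u u \<le> hess_form x u u"
    and "(1 - local_norm x h)\<^sup>2 * hess_form x u u \<le> hess_form (x + h) u u"
proof -
  define r where "r = local_norm x h"
  have r0: "0 \<le> r" "r < 1" using r local_norm_nonneg[OF x] by (auto simp: r_def)
  have in_S: "x + s *\<^sub>R h \<in> S" if "0 \<le> s" "s \<le> 1" for s
    using segment_in_S[of x 1 h s] dikin_ellipsoid[OF x r] x that by simp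
  define g where "g s = hess_form (x + s *\<^sub>R h) u u" for s
  define g' where "g' s = third_form (x + s *\<^sub>R h) h u u" for s
  have g: "(g has_real_derivative g' s) (at s)" if "0 \<le> s" "s \<le> 1" for s
    unfolding g_def g'_def by (rule hess_form_line_deriv[OF in_S[OF that]])
  have gpos: "g s \<ge> 0" if "0 \<le> s" "s \<le> 1" for s
    unfolding g_def by (rule hess_form_nonneg[OF in_S[OF that]])
  have pos: "1 - r * s > 0" if "0 \<le> s" "s \<le> 1" for s
  proof -
    have "r * s \<le> r * 1" using that r0 by (intro mult_left_mono) auto
    then show ?thesis using r0 by simp
  qed
  have g': "(1 - r * s) * \<bar>g' s\<bar> \<le> 2 * r * g s" if s: "0 \<le> s" "s \<le> 1" for s
  proof -
    let ?v = "local_norm (x + s *\<^sub>R h) h"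
    have "?v - r \<le> s * ?v * r"
      using local_norm_line[OF x in_S[OF s] s(1)] by (simp add: r_def)
    then have v: "(1 - r * s) * ?v \<le> r" by (simp add: algebra_simps)
    have "(1 - r * s) * \<bar>g' s\<bar> \<le> (1 - r * s) * (2 * ?v * g s)"
      unfolding g'_def g_def using pos[OF s] third_form_bound[OF in_S[OF s]] by (intro mult_left_mono) auto
    also have "\<dots> = ((1 - r * s) * ?v) * (2 * g s)" by simp
    also have "\<dots> \<le> r * (2 * g s)" using v gpos[OF s] by (intro mult_right_mono) auto
    finally show ?thesis by (simp add: mult_ac)
  qed
  have "(1 - r * 1)\<^sup>2 * g 1 \<le> (1 - r * 0)\<^sup>2 * g 0"
  proof (rule DERIV_nonpos_imp_nonincreasing[of 0 1 "\<lambda>s. (1 - r * s)\<^sup>2 * g s"])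
    fix s :: real assume s: "0 \<le> s" "s \<le> 1"
    have "((\<lambda>s. (1 - r * s)\<^sup>2) has_real_derivative - 2 * r * (1 - r * s)) (at s)"
      by (auto intro!: derivative_eq_intros)
    from DERIV_mult[OF this g[OF s]]
    have "((\<lambda>s. (1 - r * s)\<^sup>2 * g s) has_real_derivative (1 - r * s) * ((1 - r * s) * g' s - 2 * r * g s)) (at s)"
      by (simp add: power2_eq_square algebra_simps)
    moreover have "(1 - r * s) * ((1 - r * s) * g' s - 2 * r * g s) \<le> 0"
    proof (rule mult_nonneg_nonpos)
      have "(1 - r * s) * g' s \<le> (1 - r * s) * \<bar>g' s\<bar>" using pos[OF s] by (intro mult_left_mono) auto
      then show "(1 - r * s) * g' s - 2 * r * g s \<le> 0" using g'[OF s] by simp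
    qed (use pos[OF s] in simp)
    ultimately show "\<exists>y. ((\<lambda>s. (1 - r * s)\<^sup>2 * g s) has_real_derivative y) (at s) \<and> y \<le> 0" by blast
  qed simp
  then show "(1 - local_norm x h)\<^sup>2 * hess_form (x + h) u u \<le> hess_form x u u"
    by (simp add: g_def r_def)
  have "g 0 / (1 - r * 0)\<^sup>2 \<le> g 1 / (1 - r * 1)\<^sup>2"
  proof (rule DERIV_nonneg_imp_nondecreasing[of 0 1 "\<lambda>s. g s / (1 - r * s)\<^sup>2"])
    fix s :: real assume s: "0 \<le> s" "s \<le> 1"
    have ne: "(1 - r * s)\<^sup>2 \<noteq> 0" using pos[OF s] by simp
    have "((\<lambda>s. (1 - r * s)\<^sup>2) has_real_derivative - 2 * r * (1 - r * s)) (at s)"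
      by (auto intro!: derivative_eq_intros)
    from DERIV_divide[OF g[OF s] this ne]
    have "((\<lambda>s. g s / (1 - r * s)\<^sup>2) has_real_derivative
        (g' s * (1 - r * s)\<^sup>2 - g s * (- 2 * r * (1 - r * s))) / ((1 - r * s)\<^sup>2 * (1 - r * s)\<^sup>2)) (at s)" .
    also have "g' s * (1 - r * s)\<^sup>2 - g s * (- 2 * r * (1 - r * s)) = (1 - r * s) * ((1 - r * s) * g' s + 2 * r * g s)"
      by (simp add: power2_eq_square algebra_simps)
    also have "\<dots> / ((1 - r * s)\<^sup>2 * (1 - r * s)\<^sup>2) = ((1 - r * s) * g' s + 2 * r * g s) / (1 - r * s) ^ 3"
      using pos[OF s] by (simp add: power2_eq_square power3_eq_cube)
    finally have "((\<lambda>s. g s / (1 - r * s)\<^sup>2) has_real_derivative ((1 - r * s) * g' s + 2 * r * g s) / (1 - r * s) ^ 3) (at s)" .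
    moreover have "((1 - r * s) * g' s + 2 * r * g s) / (1 - r * s) ^ 3 \<ge> 0"
    proof (rule divide_nonneg_pos)
      have "(1 - r * s) * (- g' s) \<le> (1 - r * s) * \<bar>g' s\<bar>" using pos[OF s] by (intro mult_left_mono) auto
      then show "(1 - r * s) * g' s + 2 * r * g s \<ge> 0" using g'[OF s] by simp
    qed (use pos[OF s] in simp)
    ultimately show "\<exists>y. ((\<lambda>s. g s / (1 - r * s)\<^sup>2) has_real_derivative y) (at s) \<and> 0 \<le> y" by blast
  qed simp
  then show "(1 - local_norm x h)\<^sup>2 * hess_form x u u \<le> hess_form (x + h) u u"
    using r0 by (simp add: g_def r_def field_simps)
qed

lemma local_norm_compare:
  assumes x: "x \<in> S" and r: "local_norm x h < 1"
  shows "(1 - local_norm x h) * local_norm (x + h) u \<le> local_norm x u"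
    and "(1 - local_norm x h) * local_norm x u \<le> local_norm (x + h) u"
proof -
  have r0: "1 - local_norm x h \<ge> 0" using r by simp
  show "(1 - local_norm x h) * local_norm (x + h) u \<le> local_norm x u"
    using real_sqrt_le_mono[OF hess_form_compare(1)[OF assms, of u]] r0
    by (simp add: real_sqrt_mult local_norm_def)
  show "(1 - local_norm x h) * local_norm x u \<le> local_norm (x + h) u"
    using real_sqrt_le_mono[OF hess_form_compare(2)[OF assms, of u]] r0
    by (simp add: real_sqrt_mult local_norm_def)
qed

end

section \<open>Dual norms and Newton steps\<close>

text \<open>Polarization, applied to the multiples of \<open>u\<close> and \<open>v\<close> that have equal length. For \<open>D = E\<close> and \<open>k = 1\<close> this is
the Cauchy-Schwarz inequality.\<close>

lemma symmetric_form_bound: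
  fixes D E :: "'a::real_vector \<Rightarrow> 'a \<Rightarrow> real"
  assumes linD: "\<And>u. linear (D u)" and D12: "\<And>u v. D u v = D v u"
    and linE: "\<And>u. linear (E u)" and E12: "\<And>u v. E u v = E v u" and Epos: "\<And>u. u \<noteq> 0 \<Longrightarrow> E u u > 0"
    and D: "\<And>z. \<bar>D z z\<bar> \<le> k * E z z"
  shows "\<bar>D u v\<bar> \<le> k * sqrt (E u u) * sqrt (E v v)"
proof (cases "u = 0 \<or> v = 0")
  case True
  then have "D u v = 0" using linear_0[OF linD] D12 by metis
  moreover have "E 0 0 = 0" using linear_0[OF linE] by simp
  ultimately show ?thesis using True by auto
next
  case False
  have lin: "D x (y + z) = D x y + D x z" "D x (c *\<^sub>R y) = c * D x y"
    "D (y + z) x = D y x + D z x" "D (c *\<^sub>R y) x = c * D y x" for x y z c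
    using linear_add[OF linD] linear_scale[OF linD] D12 by (metis real_scaleR_def)+
  have linE: "E x (y + z) = E x y + E x z" "E x (c *\<^sub>R y) = c * E x y"
    "E (y + z) x = E y x + E z x" "E (c *\<^sub>R y) x = c * E y x" for x y z c
    using linear_add[OF linE] linear_scale[OF linE] E12 by (metis real_scaleR_def)+
  define U where "U = sqrt (E u u)"
  define V where "V = sqrt (E v v)"
  have U: "U > 0" "U * U = E u u" using Epos[of u] False by (auto simp: U_def)
  have V: "V > 0" "V * V = E v v" using Epos[of v] False by (auto simp: V_def)
  define a where "a = V *\<^sub>R u"
  define b where "b = U *\<^sub>R v"
  have ab: "E a a = (U * V)\<^sup>2" "E b b = (U * V)\<^sup>2" "D a b = U * V * D u v"
    unfolding a_def b_def by (simp_all add: lin linE U(2)[symmetric] V(2)[symmetric] power2_eq_square)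
  have "D (a + b) (a + b) - D (a + (- 1) *\<^sub>R b) (a + (- 1) *\<^sub>R b) = 4 * D a b"
    by (simp only: lin D12[of b a]) simp
  moreover have "E (a + b) (a + b) + E (a + (- 1) *\<^sub>R b) (a + (- 1) *\<^sub>R b) = 4 * (U * V)\<^sup>2"
    by (simp only: linE ab E12[of b a]) simp
  moreover have "\<bar>D (a + b) (a + b) - D (a + (- 1) *\<^sub>R b) (a + (- 1) *\<^sub>R b)\<bar>
      \<le> k * (E (a + b) (a + b) + E (a + (- 1) *\<^sub>R b) (a + (- 1) *\<^sub>R b))"
    using D[of "a + b"] D[of "a + (- 1) *\<^sub>R b"] unfolding distrib_left by linarith
  ultimately have "\<bar>4 * D a b\<bar> \<le> k * (4 * (U * V)\<^sup>2)" by simp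
  then have "U * V * \<bar>D u v\<bar> \<le> U * V * (k * U * V)"
    using U(1) V(1) unfolding ab by (simp add: abs_mult power2_eq_square)
  then show ?thesis using U(1) V(1) by (simp add: U_def V_def)
qed

context bounded_barrier
begin

lemma hess_form_scale: "hess_form x (k *\<^sub>R h) (k *\<^sub>R h) = k\<^sup>2 * hess_form x h h"
  using linear_scale[OF hess_form_linear(1)] linear_scale[OF hess_form_linear(2)]
  by (simp add: power2_eq_square)

lemma local_norm_scale: "local_norm x (k *\<^sub>R h) = \<bar>k\<bar> * local_norm x h"
  by (simp add: local_norm_def hess_form_scale real_sqrt_mult)

lemma hessian_inverse:
  assumes "x \<in> S" shows "hessian F x *v (matrix_inv (hessian F x) *v v) = v"
proof -
  have "h = 0" if "hessian F x *v h = 0" for h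
    using hess_form_pos[OF assms, of h] that by (auto simp: hess_form_def)
  then obtain A where "A ** hessian F x = mat 1"
    using matrix_left_invertible_ker[of "hessian F x"] by blast
  then have "\<exists>A. hessian F x ** A = mat 1 \<and> A ** hessian F x = mat 1"
    using matrix_left_right_inverse by blast
  then have "hessian F x ** matrix_inv (hessian F x) = mat 1"
    unfolding matrix_inv_def by (rule someI2_ex) simp
  then show ?thesis by (simp add: matrix_vector_mul_assoc)
qed

lemma hess_form_inverse:
  assumes "x \<in> S" shows "hess_form x u (matrix_inv (hessian F x) *v v) = u \<bullet> v"
  by (simp add: hess_form_def hessian_inverse[OF assms])

lemma dual_norm_eq_local_norm:
  assumes "x \<in> S" shows "dual_norm F x v = local_norm x (matrix_inv (hessian F x) *v v)"
  by (simp add: dual_norm_def local_norm_def hess_form_inverse[OF assms] inner_commute)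

lemma dual_norm_nonneg: "x \<in> S \<Longrightarrow> dual_norm F x v \<ge> 0"
  by (simp add: dual_norm_eq_local_norm local_norm_nonneg)

lemma dual_norm_sq:
  assumes "x \<in> S" shows "(dual_norm F x v)\<^sup>2 = v \<bullet> (matrix_inv (hessian F x) *v v)"
  using local_norm_sq[OF assms] hess_form_inverse[OF assms]
  by (simp add: dual_norm_eq_local_norm[OF assms] inner_commute)

lemma inner_le_local_dual:
  assumes "x \<in> S" shows "\<bar>v \<bullet> h\<bar> \<le> dual_norm F x v * local_norm x h"
proof -
  have "\<bar>hess_form x h (matrix_inv (hessian F x) *v v)\<bar>
      \<le> 1 * sqrt (hess_form x h h) * sqrt (hess_form x (matrix_inv (hessian F x) *v v) (matrix_inv (hessian F x) *v v))"
    by (rule symmetric_form_bound)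
      (use hess_form_linear hess_form_sym[OF assms] hess_form_pos[OF assms] hess_form_nonneg[OF assms] in auto)
  then show ?thesis
    unfolding hess_form_inverse[OF assms] dual_norm_eq_local_norm[OF assms] local_norm_def
    by (simp add: inner_commute mult.commute)
qed

lemma dual_norm_leI:
  assumes "x \<in> S" "0 \<le> C" "\<And>h. v \<bullet> h \<le> C * local_norm x h"
  shows "dual_norm F x v \<le> C"
proof -
  have "(dual_norm F x v)\<^sup>2 \<le> C * dual_norm F x v"
    using assms(3)[of "matrix_inv (hessian F x) *v v"]
    unfolding dual_norm_eq_local_norm[OF assms(1), symmetric] dual_norm_sq[OF assms(1), symmetric] .
  then show ?thesis
    using dual_norm_nonneg[OF assms(1), of v] assms(2)
    by (cases "dual_norm F x v = 0") (auto simp: power2_eq_square)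
qed

lemma dual_norm_add_scale:
  assumes "x \<in> S" shows "dual_norm F x (a *\<^sub>R u + v) \<le> \<bar>a\<bar> * dual_norm F x u + dual_norm F x v"
proof (rule dual_norm_leI[OF assms])
  show "0 \<le> \<bar>a\<bar> * dual_norm F x u + dual_norm F x v" using dual_norm_nonneg[OF assms] by simp
  fix h
  have "(a *\<^sub>R u + v) \<bullet> h \<le> \<bar>a\<bar> * \<bar>u \<bullet> h\<bar> + \<bar>v \<bullet> h\<bar>"
    by (simp add: inner_add_left) (metis abs_ge_self abs_mult add_mono)
  also have "\<dots> \<le> \<bar>a\<bar> * (dual_norm F x u * local_norm x h) + dual_norm F x v * local_norm x h"
    using inner_le_local_dual[OF assms] by (intro add_mono mult_left_mono) auto
  finally show "(a *\<^sub>R u + v) \<bullet> h \<le> (\<bar>a\<bar> * dual_norm F x u + dual_norm F x v) * local_norm x h"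
    by (simp add: algebra_simps)
qed

lemma dual_norm_pos:
  assumes "x \<in> S" "v \<noteq> 0" shows "dual_norm F x v > 0"
proof -
  have "matrix_inv (hessian F x) *v v \<noteq> 0"
    using hessian_inverse[OF assms(1), of v] assms(2) by auto
  then show ?thesis
    using hess_form_pos[OF assms(1)] by (simp add: dual_norm_eq_local_norm[OF assms(1)] local_norm_def)
qed

text \<open>The barrier inequality in the direction of the Newton step of \<open>F\<close>.\<close>

lemma dual_norm_gradient:
  assumes "x \<in> S" shows "dual_norm F x (gradient F x) \<le> sqrt \<nu>"
proof -
  let ?g = "gradient F x" and ?a = "dual_norm F x (gradient F x)"
  have "(?g \<bullet> (matrix_inv (hessian F x) *v ?g))\<^sup>2
      \<le> \<nu> * hess_form x (matrix_inv (hessian F x) *v ?g) (matrix_inv (hessian F x) *v ?g)"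
    using barrier assms unfolding self_concordant_barrier_def hess_form_def by blast
  then have "(?a\<^sup>2)\<^sup>2 \<le> \<nu> * ?a\<^sup>2"
    by (simp add: hess_form_inverse[OF assms] dual_norm_sq[OF assms] inner_commute)
  then have *: "?a\<^sup>2 * ?a\<^sup>2 \<le> \<nu> * ?a\<^sup>2" by (simp add: power2_eq_square)
  show ?thesis
  proof (cases "?g = 0")
    case True
    have "\<nu> * hess_form x h h \<ge> 0" for h
      using barrier assms True unfolding self_concordant_barrier_def hess_form_def
      by (metis inner_zero_left power_zero_numeral)
    from this[of "axis undefined 1"] have "\<nu> \<ge> 0"
      using hess_form_pos[OF assms, of "axis undefined 1"] by (simp add: zero_le_mult_iff axis_eq_0_iff)
    then show ?thesis using True by (simp add: dual_norm_def)
  next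
    case False
    then have "?a > 0" using dual_norm_pos[OF assms] by simp
    then have "?a\<^sup>2 \<le> \<nu>" using mult_right_le_imp_le[OF *] by simp
    then show ?thesis by (rule real_le_rsqrt)
  qed
qed

text \<open>The derivative of the left-hand side along the segment is the difference of the Hessian forms at
\<open>x + s *\<^sub>R h\<close> and \<open>x\<close>, which is at most \<open>1 / (1 - r * s)\<^sup>2 - 1\<close> times the product of local norms. Integrating
gives \<open>r\<^sup>2 / (1 - r)\<close>.\<close>

lemma gradient_linearization:
  assumes x: "x \<in> S" and r: "local_norm x h < 1"
  shows "\<bar>(gradient F (x + h) - gradient F x) \<bullet> w - hess_form x w h\<bar>
    \<le> local_norm x w * ((local_norm x h)\<^sup>2 / (1 - local_norm x h))"
proof -
  define r where "r = local_norm x h"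
  define W where "W = local_norm x w"
  have r0: "0 \<le> r" "r < 1" using r local_norm_nonneg[OF x] by (auto simp: r_def)
  have W0: "W \<ge> 0" using local_norm_nonneg[OF x] by (simp add: W_def)
  have in_S: "x + s *\<^sub>R h \<in> S" if "0 \<le> s" "s \<le> 1" for s
    using segment_in_S[of x 1 h s] dikin_ellipsoid[OF x r] x that by simp
  have pos: "1 - r * s > 0" if "0 \<le> s" "s \<le> 1" for s
  proof -
    have "r * s \<le> r * 1" using that r0 by (intro mult_left_mono) auto
    then show ?thesis using r0 by simp
  qed
  define k where "k s = gradient F (x + s *\<^sub>R h) \<bullet> w - s * hess_form x w h" for s
  define k' where "k' s = hess_form (x + s *\<^sub>R h) w h - hess_form x w h" for s
  define l where "l s = W * (1 / (1 - r * s) - r * s)" for s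
  define l' where "l' s = W * (r / (1 - r * s)\<^sup>2 - r)" for s
  have k: "(k has_real_derivative k' s) (at s)" if "0 \<le> s" "s \<le> 1" for s
    unfolding k_def k'_def by (auto intro!: derivative_eq_intros gradient_line_deriv in_S that)
  have l: "(l has_real_derivative l' s) (at s)" if "0 \<le> s" "s \<le> 1" for s
    unfolding l_def l'_def using pos[OF that]
    by (auto intro!: derivative_eq_intros simp: power2_eq_square)
  have k': "\<bar>k' s\<bar> \<le> l' s" if s: "0 \<le> s" "s \<le> 1" for s
  proof -
    let ?q = "1 - r * s"
    have q: "0 < ?q" "?q \<le> 1" using pos[OF s] r0 s by auto
    have sh: "local_norm x (s *\<^sub>R h) = r * s" using s by (simp add: local_norm_scale r_def)
    have "\<bar>hess_form (x + s *\<^sub>R h) w h - hess_form x w h\<bar>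
        \<le> (1 / ?q\<^sup>2 - 1) * sqrt (hess_form x w w) * sqrt (hess_form x h h)"
    proof (rule symmetric_form_bound[where D = "\<lambda>u v. hess_form (x + s *\<^sub>R h) u v - hess_form x u v"
          and E = "hess_form x"])
      show "linear (\<lambda>v. hess_form (x + s *\<^sub>R h) u v - hess_form x u v)" for u
        by (intro linear_compose_sub hess_form_linear)
      show "\<bar>hess_form (x + s *\<^sub>R h) z z - hess_form x z z\<bar> \<le> (1 / ?q\<^sup>2 - 1) * hess_form x z z" for z
      proof -
        have b: "?q\<^sup>2 * hess_form (x + s *\<^sub>R h) z z \<le> hess_form x z z"
          "?q\<^sup>2 * hess_form x z z \<le> hess_form (x + s *\<^sub>R h) z z"
          using hess_form_compare[OF x, of "s *\<^sub>R h" z] sh q by auto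
        have z0: "hess_form x z z \<ge> 0" by (rule hess_form_nonneg[OF x])
        have q2: "0 < ?q\<^sup>2" "?q\<^sup>2 \<le> 1" using q by (auto simp: power_le_one)
        have "hess_form (x + s *\<^sub>R h) z z \<le> 1 / ?q\<^sup>2 * hess_form x z z"
          using b(1) q2(1) by (simp add: field_simps)
        moreover have "hess_form x z z \<le> 1 / ?q\<^sup>2 * hess_form (x + s *\<^sub>R h) z z"
          using b(2) q2(1) by (simp add: field_simps)
        \<comment> \<open>the lower deviation \<open>1 - ?q\<^sup>2\<close> is no larger than the upper one \<open>1 / ?q\<^sup>2 - 1\<close>\<close>
        moreover have "2 \<le> ?q\<^sup>2 + 1 / ?q\<^sup>2"
        proof -
          have "0 \<le> (?q\<^sup>2 - 1)\<^sup>2 / ?q\<^sup>2" by simp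
          also have "\<dots> = ?q\<^sup>2 + 1 / ?q\<^sup>2 - 2" using q2(1) by (simp add: power2_diff power2_eq_square field_simps)
          finally show ?thesis by simp
        qed
        then have "2 * hess_form x z z \<le> (?q\<^sup>2 + 1 / ?q\<^sup>2) * hess_form x z z"
          using z0 by (rule mult_right_mono)
        ultimately show ?thesis using b(2) unfolding left_diff_distrib distrib_right abs_le_iff by linarith
      qed
    qed (use hess_form_linear hess_form_sym[OF x] hess_form_sym[OF in_S[OF s]] hess_form_pos[OF x] in auto)
    then show ?thesis
      by (simp add: k'_def l'_def W_def r_def local_norm_def algebra_simps)
  qed
  have "k 1 - k 0 \<le> l 1 - l 0"
    by (rule DERIV_le_imp_diff_le[OF _ k l]) (use k' abs_le_D1 in auto)
  moreover have "- l 1 - (- l 0) \<le> k 1 - k 0"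
    by (rule DERIV_le_imp_diff_le[OF _ DERIV_minus[OF l] k]) (use k' abs_le_D2 in \<open>auto simp: abs_le_iff\<close>, smt (verit) k')
  moreover have "l 1 - l 0 = W * (r\<^sup>2 / (1 - r))"
    unfolding l_def using r0 by (simp add: field_simps power2_eq_square)
  ultimately have "\<bar>k 1 - k 0\<bar> \<le> W * (r\<^sup>2 / (1 - r))" by linarith
  then show ?thesis by (simp add: k_def W_def r_def inner_diff_left algebra_simps)
qed

lemma newton_dir_props:
  assumes "x \<in> S"
  shows "local_norm x (newton_dir F d t x) = dual_norm F x (t *\<^sub>R d + gradient F x)"
    and "hess_form x w (newton_dir F d t x) = (t *\<^sub>R d + gradient F x) \<bullet> w"
    and "(t *\<^sub>R d + gradient F x) \<bullet> newton_dir F d t x = (dual_norm F x (t *\<^sub>R d + gradient F x))\<^sup>2"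
  using assms by (simp_all add: newton_dir_def dual_norm_eq_local_norm[symmetric] hess_form_inverse dual_norm_sq inner_commute)

lemma local_norm_uminus: "local_norm x (- h) = local_norm x h"
  using local_norm_scale[of x "- 1" h] by simp

text \<open>A step of local length \<open>r \<le> 1/4\<close> stays in the Dikin ellipsoid. The linearization error of the gradient
bounds the new decrement by \<open>(r / (1 - r))\<^sup>2 \<le> 1/9\<close>. On the way the second derivative is at most
\<open>16/9 * r\<^sup>2\<close>, so the function decreases by at least \<open>r\<^sup>2 - 8/9 * r\<^sup>2\<close>, more than the line search asks for.\<close>

lemma full_newton_step:
  assumes x: "x \<in> S" and dec: "dual_norm F x (t *\<^sub>R d + gradient F x) \<le> 1/4"
  shows "x - newton_dir F d t x \<in> S"
    and "dual_norm F (x - newton_dir F d t x) (t *\<^sub>R d + gradient F (x - newton_dir F d t x)) \<le> beta"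
    and "armijo Q F d t x 1"
proof -
  define v where "v = t *\<^sub>R d + gradient F x"
  define p where "p = newton_dir F d t x"
  define r where "r = dual_norm F x v"
  have r: "0 \<le> r" "r \<le> 1/4" using dual_norm_nonneg[OF x] dec by (auto simp: r_def v_def)
  have nr: "local_norm x (- p) = r"
    by (simp add: local_norm_uminus p_def r_def v_def newton_dir_props[OF x])
  have lt: "local_norm x (- p) < 1" using nr r by simp
  show y: "x - newton_dir F d t x \<in> S" using dikin_ellipsoid[OF x lt] by (simp add: p_def)
  then have y: "x + - p \<in> S" by (simp add: p_def)
  have "dual_norm F (x + - p) (t *\<^sub>R d + gradient F (x + - p)) \<le> 1/9"
  proof (rule dual_norm_leI[OF y])
    fix w
    have "(t *\<^sub>R d + gradient F (x + - p)) \<bullet> w = (gradient F (x + - p) - gradient F x) \<bullet> w - hess_form x w (- p)"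
      using newton_dir_props(2)[OF x, of w d t] linear_neg[OF hess_form_linear(1), of x w p]
      by (simp add: p_def algebra_simps inner_add_left inner_diff_left)
    also have "\<dots> \<le> local_norm x w * (r\<^sup>2 / (1 - r))"
      using gradient_linearization[OF x lt, of w] unfolding nr by simp
    also have "\<dots> \<le> (local_norm (x + - p) w / (1 - r)) * (r\<^sup>2 / (1 - r))"
      using local_norm_compare(2)[OF x lt, of w] r unfolding nr
      by (intro mult_right_mono) (auto simp: field_simps)
    also have "\<dots> = (r / (1 - r))\<^sup>2 * local_norm (x + - p) w" by (simp add: power2_eq_square)
    also have "\<dots> \<le> 1/9 * local_norm (x + - p) w"
    proof (rule mult_right_mono)
      have "r / (1 - r) \<le> 1/3" using r by (simp add: field_simps)
      then have "(r / (1 - r))\<^sup>2 \<le> (1/3)\<^sup>2" using r by (intro power_mono) auto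
      then show "(r / (1 - r))\<^sup>2 \<le> 1/9" by (simp add: power2_eq_square)
    qed (rule local_norm_nonneg[OF y])
    finally show "(t *\<^sub>R d + gradient F (x + - p)) \<bullet> w \<le> 1/9 * local_norm (x + - p) w" .
  qed simp
  then show "dual_norm F (x - newton_dir F d t x) (t *\<^sub>R d + gradient F (x - newton_dir F d t x)) \<le> beta"
    by (simp add: p_def beta_def)
  have in_S: "x + s *\<^sub>R (- p) \<in> S" if "0 \<le> s" "s \<le> 1" for s
    using segment_in_S[OF x _ that, of "- p"] y by simp
  have "F (x + 1 *\<^sub>R (- p)) \<le> F (x + 0 *\<^sub>R (- p)) + (gradient F (x + 0 *\<^sub>R (- p)) \<bullet> (- p)) * 1 + (16/9 * r\<^sup>2) / 2 * 1\<^sup>2"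
  proof (rule second_derivative_upper_bound[OF _ F_line_deriv gradient_line_deriv])
    fix s :: real assume s: "0 \<le> s" "s \<le> 1"
    have sr: "local_norm x (s *\<^sub>R (- p)) = s * r" unfolding local_norm_scale nr using s by simp
    have "s * r \<le> 1 * r" using s r by (intro mult_right_mono) auto
    then have sr1: "s * r \<le> 1/4" using r by simp
    have "(3/4)\<^sup>2 * hess_form (x + s *\<^sub>R (- p)) (- p) (- p) \<le> (1 - s * r)\<^sup>2 * hess_form (x + s *\<^sub>R (- p)) (- p) (- p)"
      using sr1 by (intro mult_right_mono power_mono hess_form_nonneg in_S s) auto
    also have "\<dots> \<le> hess_form x (- p) (- p)"
      using hess_form_compare(1)[OF x, of "s *\<^sub>R (- p)" "- p"] sr sr1 by simp
    also have "\<dots> = r\<^sup>2" using local_norm_sq[OF x, of "- p"] nr by simp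
    finally show "hess_form (x + s *\<^sub>R (- p)) (- p) (- p) \<le> 16/9 * r\<^sup>2"
      by (simp add: power2_eq_square)
  qed (use in_S in auto)
  then have Fle: "F (x - p) \<le> F x - gradient F x \<bullet> p + 8/9 * r\<^sup>2" by simp
  have vp: "v \<bullet> p = r\<^sup>2" unfolding v_def p_def r_def by (rule newton_dir_props(3)[OF x])
  have "t * (d \<bullet> (x - p)) + F (x - p) \<le> t * (d \<bullet> x) + F x - v \<bullet> p + 8/9 * r\<^sup>2"
    using Fle by (simp add: v_def inner_add_left inner_diff_right algebra_simps)
  also have "\<dots> \<le> t * (d \<bullet> x) + F x - 0.01 * 1 * (v \<bullet> p)"
    unfolding vp using zero_le_power2[of r] by simp
  finally show "armijo Q F d t x 1"
    using y unfolding armijo_def Let_def p_def v_def by simp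
qed

lemma damped_newton_full:
  assumes "x \<in> S" "dual_norm F x (t *\<^sub>R d + gradient F x) \<le> 1/4"
  shows "damped_newton Q F d t x = x - newton_dir F d t x"
proof -
  have "(LEAST j. armijo Q F d t x (0.25 ^ j)) = 0"
    using full_newton_step(3)[OF assms] by (intro Least_eq_0) simp
  then show ?thesis by (simp add: damped_newton_def backtracking_def)
qed

text \<open>The point of this fact is that the line search terminates: the directional derivative is strictly
negative unless the Newton direction vanishes, so all sufficiently small trial steps pass the test.\<close>

lemma damped_newton_in_S:
  assumes x: "x \<in> S" shows "damped_newton Q F d t x \<in> S"
proof -
  define v where "v = t *\<^sub>R d + gradient F x"
  define p where "p = newton_dir F d t x"
  have "\<exists>j. armijo Q F d t x (0.25 ^ j)"
  proof (cases "v = 0")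
    case True
    then have "p = 0" by (simp add: p_def v_def newton_dir_def)
    then have "armijo Q F d t x (0.25 ^ 0)" using x by (simp add: armijo_def Let_def p_def)
    then show ?thesis by blast
  next
    case False
    have vp: "v \<bullet> p > 0"
      using newton_dir_props(3)[OF x, of t d] dual_norm_pos[OF x False] by (simp add: p_def v_def)
    define m where "m s = t * (d \<bullet> (x + s *\<^sub>R (- p))) + F (x + s *\<^sub>R (- p)) + 0.01 * s * (v \<bullet> p)" for s
    have "((\<lambda>s. F (x + s *\<^sub>R (- p))) has_real_derivative gradient F x \<bullet> (- p)) (at 0)"
      using F_line_deriv[of x 0 "- p"] x by simp
    then have "(m has_real_derivative (t * (d \<bullet> (- p)) + gradient F x \<bullet> (- p) + 0.01 * (v \<bullet> p))) (at 0)"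
      unfolding m_def inner_add_right inner_scaleR_right
      by (auto intro!: derivative_eq_intros)
    moreover have "t * (d \<bullet> (- p)) + gradient F x \<bullet> (- p) + 0.01 * (v \<bullet> p) = - 0.99 * (v \<bullet> p)"
      by (simp add: v_def inner_add_left field_simps)
    ultimately have "(m has_real_derivative - 0.99 * (v \<bullet> p)) (at 0)" by simp
    from DERIV_neg_dec_right[OF this] vp obtain e where
      e: "e > 0" "\<And>s. 0 < s \<Longrightarrow> s < e \<Longrightarrow> m s < m 0" by auto
    have "open {s. x + s *\<^sub>R (- p) \<in> S}" "0 \<in> {s. x + s *\<^sub>R (- p) \<in> S}"
      using open_line[of x "- p"] x by auto
    then obtain e' where e': "e' > 0" "ball 0 e' \<subseteq> {s. x + s *\<^sub>R (- p) \<in> S}"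
      using openE by blast
    obtain j where j: "(0.25::real) ^ j < min e e'"
      using real_arch_pow_inv[of "min e e'" "0.25"] e(1) e'(1) by auto
    define s where "s = (0.25::real) ^ j"
    have s: "0 < s" "s < e" "s < e'" using j by (auto simp: s_def)
    have "s \<in> ball 0 e'" using s by simp
    then have "x + s *\<^sub>R (- p) \<in> S" using e'(2) by blast
    then have "armijo Q F d t x s"
      using e(2)[OF s(1,2)] unfolding armijo_def Let_def m_def p_def v_def by simp
    then show ?thesis unfolding s_def by blast
  qed
  from LeastI_ex[OF this] show ?thesis
    by (simp add: armijo_def Let_def damped_newton_def backtracking_def)
qed

section \<open>The parameter of the barrier and the central path\<close>

text \<open>Let \<open>f\<close> be the slope of \<open>F\<close> along a ray that meets the boundary at \<open>s = d\<close>. The Dikin ellipsoid lies in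
the interior, hence \<open>f' \<ge> 1 / (d - s)\<^sup>2\<close> and \<open>f s \<ge> 1 / (d - s) - K\<close> for a constant \<open>K\<close>. On the other hand the
barrier inequality \<open>f\<^sup>2 \<le> \<nu> * f'\<close> says that \<open>1 / f\<close> decreases at rate at least \<open>1 / \<nu>\<close> while it stays
positive up to \<open>d\<close>, so \<open>f s \<le> \<nu> / (d - s)\<close>. Multiply by \<open>d - s\<close> and let \<open>s\<close> tend to \<open>d\<close>.\<close>

lemma nu_ge_1:
  assumes "S \<noteq> {}" shows "\<nu> \<ge> 1"
proof -
  obtain x where x: "x \<in> S" using assms by blast
  define h :: "real ^ 'n" where "h = axis undefined 1"
  have h: "h \<noteq> 0" by (simp add: h_def axis_eq_0_iff)
  obtain d where d: "d > 0" "x + d *\<^sub>R h \<in> frontier Q" "\<And>e. 0 \<le> e \<Longrightarrow> e < d \<Longrightarrow> x + e *\<^sub>R h \<in> S"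
    using frontier_ray[OF x h] by metis
  have dS: "x + d *\<^sub>R h \<notin> S" using d(2) by (simp add: frontier_def)
  define f where "f s = gradient F (x + s *\<^sub>R h) \<bullet> h" for s
  define g where "g s = hess_form (x + s *\<^sub>R h) h h" for s
  have f: "(f has_real_derivative g s) (at s)" if "0 \<le> s" "s < d" for s
    unfolding f_def g_def by (rule gradient_line_deriv[OF d(3)[OF that]])
  have fg: "(f s)\<^sup>2 \<le> \<nu> * g s" if "0 \<le> s" "s < d" for s
    using barrier d(3)[OF that] unfolding self_concordant_barrier_def f_def g_def hess_form_def by blast
  have g: "1 / (d - s)\<^sup>2 \<le> g s" if s: "0 \<le> s" "s < d" for s
  proof -
    have "\<not> local_norm (x + s *\<^sub>R h) ((d - s) *\<^sub>R h) < 1"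
      using dikin_ellipsoid[OF d(3)[OF s], of "(d - s) *\<^sub>R h"] dS by (auto simp: algebra_simps)
    then have "1\<^sup>2 \<le> (local_norm (x + s *\<^sub>R h) ((d - s) *\<^sub>R h))\<^sup>2" by (intro power_mono) auto
    also have "\<dots> = (d - s)\<^sup>2 * g s"
      using local_norm_sq[OF d(3)[OF s]] by (simp add: hess_form_scale g_def)
    finally show ?thesis using s by (simp add: field_simps)
  qed
  define K where "K = 1 / d - f 0"
  have lower: "f s \<ge> 1 / (d - s) - K" if s: "0 \<le> s" "s < d" for s
  proof -
    have "1 / (d - s) - 1 / (d - 0) \<le> f s - f 0"
    proof (rule DERIV_le_imp_diff_le[OF s(1) _ f])
      fix \<tau> assume "0 \<le> \<tau>" "\<tau> \<le> s"
      then show "((\<lambda>s. 1 / (d - s)) has_real_derivative 1 / (d - \<tau>)\<^sup>2) (at \<tau>)" "\<tau> < d" "1 / (d - \<tau>)\<^sup>2 \<le> g \<tau>"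
        using s g[of \<tau>] by (auto intro!: derivative_eq_intros simp: power2_eq_square)
    qed
    then show ?thesis by (simp add: K_def)
  qed
  \<comment> \<open>from here on \<open>1 / (d - s) > K\<close>, so that the slope is positive\<close>
  define s0 where "s0 = d - min d (1 / (\<bar>K\<bar> + 1))"
  have s0: "0 \<le> s0" "s0 < d" using d(1) by (auto simp: s0_def)
  have fpos: "f s > 0" if s: "s0 \<le> s" "s < d" for s
  proof -
    have "d - s \<le> 1 / (\<bar>K\<bar> + 1)" using s by (simp add: s0_def)
    then have "\<bar>K\<bar> + 1 \<le> 1 / (d - s)" using s by (simp add: field_simps)
    then show ?thesis using lower[of s] s s0 by simp
  qed
  have nu: "\<nu> > 0"
  proof -
    have "0 < (f s0)\<^sup>2" using fpos[of s0] s0 by simp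
    then have "0 < \<nu> * g s0" using fg[OF s0] by (rule less_le_trans)
    moreover have "g s0 > 0" unfolding g_def by (rule hess_form_pos[OF d(3)[OF s0] h])
    ultimately show ?thesis by (simp add: zero_less_mult_iff)
  qed
  have upper: "f s * (d - s) \<le> \<nu>" if s: "s0 \<le> s" "s < d" for s
  proof -
    have "f s * (s2 - s) \<le> \<nu>" if s2: "s < s2" "s2 < d" for s2
    proof -
      have "s2 / \<nu> - s / \<nu> \<le> - (1 / f s2) - (- (1 / f s))"
      proof (rule DERIV_le_imp_diff_le)
        fix \<tau> assume t: "s \<le> \<tau>" "\<tau> \<le> s2"
        then have t': "0 \<le> \<tau>" "\<tau> < d" and fp: "f \<tau> > 0" using s s2 s0 fpos[of \<tau>] by auto
        show "((\<lambda>s. - (1 / f s)) has_real_derivative g \<tau> / (f \<tau>)\<^sup>2) (at \<tau>)"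
          using fp by (auto intro!: derivative_eq_intros f t' simp: power2_eq_square)
        show "((\<lambda>s. s / \<nu>) has_real_derivative 1 / \<nu>) (at \<tau>)"
          using nu by (auto intro!: derivative_eq_intros)
        show "1 / \<nu> \<le> g \<tau> / (f \<tau>)\<^sup>2"
          using fg[OF t'] fp nu by (simp add: field_simps)
      qed (use s2 in simp)
      moreover have "1 / f s2 > 0" using fpos[of s2] s s2 by simp
      ultimately have "s2 / \<nu> - s / \<nu> \<le> 1 / f s" by linarith
      then have "(s2 / \<nu> - s / \<nu>) * (\<nu> * f s) \<le> 1 / f s * (\<nu> * f s)"
        using nu fpos[OF s] by (intro mult_right_mono) auto
      moreover have "(s2 / \<nu> - s / \<nu>) * (\<nu> * f s) = f s * (s2 - s)"
        using nu by (simp add: left_diff_distrib right_diff_distrib)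
      moreover have "1 / f s * (\<nu> * f s) = \<nu>" using fpos[OF s] by simp
      ultimately show ?thesis by simp
    qed
    then have ev: "eventually (\<lambda>s2. f s * (s2 - s) \<le> \<nu>) (at_left d)"
      using eventually_at_left_real[OF s(2)] by (auto elim: eventually_mono)
    have "((\<lambda>s2. f s * (s2 - s)) \<longlongrightarrow> f s * (d - s)) (at_left d)" by (intro tendsto_intros)
    from tendsto_upperbound[OF this ev] show ?thesis by simp
  qed
  have "eventually (\<lambda>s. 1 - K * (d - s) \<le> \<nu>) (at_left d)"
    using eventually_at_left_real[OF s0(2)]
  proof (rule eventually_mono)
    fix s assume "s \<in> {s0<..<d}"
    then have s: "s0 \<le> s" "s < d" "0 \<le> s" using s0 by auto
    have "(1 / (d - s) - K) * (d - s) \<le> f s * (d - s)"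
      using lower[of s] s by (intro mult_right_mono) auto
    then show "1 - K * (d - s) \<le> \<nu>" using upper[OF s(1,2)] s by (simp add: left_diff_distrib)
  qed
  moreover have "((\<lambda>s. 1 - K * (d - s)) \<longlongrightarrow> 1 - K * (d - d)) (at_left d)" by (intro tendsto_intros)
  ultimately show ?thesis using tendsto_upperbound[of "\<lambda>s. 1 - K * (d - s)" "1 - K * (d - d)" "at_left d" \<nu>] by simp
qed

text \<open>The function \<open>y \<mapsto> t * (d \<bullet> y) + F y\<close> attains its minimum: its sublevel sets are bounded with \<open>Q\<close>, and they
are closed because \<open>F\<close> tends to infinity at the boundary.\<close>

lemma central_point_exists:
  assumes x0: "x0 \<in> S"
  obtains z where "z \<in> S" "t *\<^sub>R d + gradient F z = 0"
proof -
  define \<phi> where "\<phi> y = t * (d \<bullet> y) + F y" for y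
  have deriv: "(\<phi> has_derivative (\<lambda>h. (t *\<^sub>R d + gradient F y) \<bullet> h)) (at y)" if "y \<in> S" for y
    unfolding \<phi>_def
    by (rule has_derivative_eq_rhs, (rule derivative_intros F_has_derivative that)+)
      (simp add: inner_add_left)
  have cont: "isCont \<phi> y" if "y \<in> S" for y
    using has_derivative_continuous[OF deriv[OF that]] .
  define C where "C = {y \<in> S. \<phi> y \<le> \<phi> x0}"
  have "closed C"
    unfolding closed_sequential_limits
  proof (intro allI impI, elim conjE)
    fix y l assume y: "\<forall>n. y n \<in> C" and l: "y \<longlonglongrightarrow> l"
    have yS: "y n \<in> S" "\<phi> (y n) \<le> \<phi> x0" for n using y by (auto simp: C_def)
    have lQ: "l \<in> Q"
      using closed_Q l yS(1) interior_subset unfolding closed_sequential_limits by blast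
    have "l \<in> S"
    proof (rule ccontr)
      assume nl: "l \<notin> S"
      then have "l \<in> frontier Q" using lQ closed_Q by (simp add: frontier_def)
      then have "filterlim F at_top (at l within S)"
        using barrier by (simp add: self_concordant_barrier_def)
      moreover have "filterlim y (at l within S) sequentially"
        unfolding filterlim_at
      proof
        have "y n \<in> S \<and> y n \<noteq> l" for n using yS(1)[of n] nl by metis
        then show "eventually (\<lambda>n. y n \<in> S \<and> y n \<noteq> l) sequentially" by simp
      qed (rule l)
      ultimately have "filterlim (\<lambda>n. F (y n)) at_top sequentially"
        by (rule filterlim_compose)
      then have "eventually (\<lambda>n. F (y n) > \<phi> x0 - t * (d \<bullet> l) + 1) sequentially"
        by (simp add: filterlim_at_top_dense)
      moreover have "(\<lambda>n. \<phi> x0 - t * (d \<bullet> y n)) \<longlonglongrightarrow> \<phi> x0 - t * (d \<bullet> l)"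
        by (intro tendsto_intros l)
      then have "eventually (\<lambda>n. \<phi> x0 - t * (d \<bullet> y n) < \<phi> x0 - t * (d \<bullet> l) + 1) sequentially"
        by (rule order_tendstoD) simp
      ultimately have "eventually (\<lambda>n. False) sequentially"
      proof eventually_elim
        case (elim n)
        then show False using yS(2)[of n] by (simp add: \<phi>_def)
      qed
      then show False by simp
    qed
    moreover have "(\<lambda>n. \<phi> (y n)) \<longlonglongrightarrow> \<phi> l"
      using isCont_tendsto_compose[OF cont[OF \<open>l \<in> S\<close>] l] .
    then have "\<phi> l \<le> \<phi> x0"
      by (rule LIMSEQ_le_const2) (use yS in auto)
    ultimately show "l \<in> C" by (simp add: C_def)
  qed
  moreover have "bounded C"
    using bounded_Q by (rule bounded_subset) (use interior_subset in \<open>auto simp: C_def\<close>)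
  ultimately have "compact C" by (simp add: compact_eq_bounded_closed)
  moreover have "x0 \<in> C" using x0 by (simp add: C_def)
  moreover have "continuous_on C \<phi>"
    using cont by (auto simp: C_def intro!: continuous_at_imp_continuous_on)
  ultimately obtain z where z: "z \<in> C" "\<And>y. y \<in> C \<Longrightarrow> \<phi> z \<le> \<phi> y"
    using continuous_attains_inf[of C \<phi>] by blast
  have zS: "z \<in> S" using z(1) by (simp add: C_def)
  have "\<phi> z \<le> \<phi> y" if "y \<in> S" for y
    using z(2)[of y] z(1) that by (cases "y \<in> C") (auto simp: C_def)
  then have "(\<lambda>h. (t *\<^sub>R d + gradient F z) \<bullet> h) = (\<lambda>h. 0)"
    using differential_zero_maxmin[OF zS open_interior deriv[OF zS]] by blast
  then have "(t *\<^sub>R d + gradient F z) \<bullet> (t *\<^sub>R d + gradient F z) = 0" by meson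
  then have "t *\<^sub>R d + gradient F z = 0" by simp
  with zS show ?thesis using that by blast
qed

text \<open>Let \<open>r\<close> be the distance from \<open>x\<close> to \<open>z\<close> in the local norm at \<open>x\<close>. The slope of \<open>F\<close> increases by at least
\<open>r\<^sup>2 / (1 + r)\<close> between \<open>x\<close> and \<open>z\<close>, and since the total gradient vanishes at \<open>z\<close>, this increase is at most
\<open>l * r\<close>.\<close>

lemma distance_to_central_point:
  assumes x: "x \<in> S" and z: "z \<in> S" and cen: "t *\<^sub>R d + gradient F z = 0"
    and dec: "dual_norm F x (t *\<^sub>R d + gradient F x) \<le> l"
  shows "local_norm x (z - x) * (1 - l) \<le> l"
proof -
  define h where "h = z - x"
  define r where "r = local_norm x h"
  have r: "r \<ge> 0" using local_norm_nonneg[OF x] by (simp add: r_def)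
  have in_S: "x + s *\<^sub>R h \<in> S" if "0 \<le> s" "s \<le> 1" for s
    using segment_in_S[OF x _ that, of h] z by (simp add: h_def)
  have l: "l \<ge> 0" using dec dual_norm_nonneg[OF x] order_trans by blast
  have "(- (r / (1 + r * 1))) - (- (r / (1 + r * 0))) \<le> gradient F (x + 1 *\<^sub>R h) \<bullet> h - gradient F (x + 0 *\<^sub>R h) \<bullet> h"
  proof (rule DERIV_le_imp_diff_le)
    fix s :: real assume s: "0 \<le> s" "s \<le> 1"
    have q: "1 + r * s > 0" using r s by (simp add: add_pos_nonneg)
    show "((\<lambda>s. gradient F (x + s *\<^sub>R h) \<bullet> h) has_real_derivative hess_form (x + s *\<^sub>R h) h h) (at s)"
      by (rule gradient_line_deriv[OF in_S[OF s]])
    show "((\<lambda>s. - (r / (1 + r * s))) has_real_derivative (r / (1 + r * s))\<^sup>2) (at s)"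
      using q by (auto intro!: derivative_eq_intros simp: power2_eq_square)
    let ?v = "local_norm (x + s *\<^sub>R h) h"
    have "r - ?v \<le> s * ?v * r" using local_norm_line[OF x in_S[OF s] s(1)] by (simp add: r_def)
    then have "r / (1 + r * s) \<le> ?v" using q by (simp add: field_simps)
    then have "(r / (1 + r * s))\<^sup>2 \<le> ?v\<^sup>2" using q r by (intro power_mono) auto
    then show "(r / (1 + r * s))\<^sup>2 \<le> hess_form (x + s *\<^sub>R h) h h"
      using local_norm_sq[OF in_S[OF s]] by simp
  qed simp
  also have "gradient F (x + 1 *\<^sub>R h) \<bullet> h - gradient F (x + 0 *\<^sub>R h) \<bullet> h = - ((t *\<^sub>R d + gradient F x) \<bullet> h)"
  proof -
    have "gradient F z = - (t *\<^sub>R d)" using cen by (simp add: eq_neg_iff_add_eq_0 add.commute)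
    then show ?thesis by (simp add: h_def inner_add_left)
  qed
  also have "\<dots> \<le> dual_norm F x (t *\<^sub>R d + gradient F x) * r"
    using inner_le_local_dual[OF x, of "t *\<^sub>R d + gradient F x" h] by (simp add: r_def)
  also have "\<dots> \<le> l * r" using dec r by (rule mult_right_mono)
  finally have "r - r / (1 + r) \<le> l * r" by simp
  moreover have "r - r / (1 + r) = r / (1 + r) * r" using r by (simp add: field_simps)
  ultimately have *: "r / (1 + r) * r \<le> l * r" by (rule subst[rotated])
  have "r \<le> l * (1 + r)"
  proof (cases "r = 0")
    case False
    then have "r / (1 + r) \<le> l" using r by (intro mult_right_le_imp_le[OF *]) simp
    then show ?thesis using r by (simp add: pos_divide_le_eq)
  qed (use l in simp)
  then show ?thesis unfolding r_def h_def by (simp add: algebra_simps)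
qed

text \<open>Pass through the minimizer \<open>z\<close> for the parameter \<open>t\<close>. Its distance to \<open>x\<close> is at most \<open>1/8\<close> and its distance to
\<open>y\<close> at most \<open>1/3\<close>, so the two comparisons of norms contribute the factors \<open>8/7\<close> and \<open>3/2\<close>.\<close>

lemma dual_norm_compare_near_path:
  assumes x: "x \<in> S" and y: "y \<in> S"
    and dx: "dual_norm F x (t *\<^sub>R d + gradient F x) \<le> 1/9"
    and dy: "dual_norm F y (t *\<^sub>R d + gradient F y) \<le> 1/4"
  shows "dual_norm F x v \<le> 12/7 * dual_norm F y v"
proof -
  obtain z where z: "z \<in> S" "t *\<^sub>R d + gradient F z = 0"
    using central_point_exists[OF x] by metis
  have rx: "local_norm x (z - x) \<le> 1/8" using distance_to_central_point[OF x z dx] by simp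
  have ry: "local_norm y (z - y) \<le> 1/3" using distance_to_central_point[OF y z dy] by simp
  have "dual_norm F z v \<le> 3/2 * dual_norm F y v"
  proof (rule dual_norm_leI[OF z(1)])
    fix h
    have "2/3 * local_norm y h \<le> (1 - local_norm y (z - y)) * local_norm y h"
      using ry local_norm_nonneg[OF y] by (intro mult_right_mono) auto
    also have "\<dots> \<le> local_norm z h"
      using local_norm_compare(2)[OF y, of "z - y" h] ry by simp
    finally have *: "local_norm y h \<le> 3/2 * local_norm z h" by simp
    have "v \<bullet> h \<le> dual_norm F y v * local_norm y h" using inner_le_local_dual[OF y, of v h] by simp
    also have "\<dots> \<le> dual_norm F y v * (3/2 * local_norm z h)"
      using * dual_norm_nonneg[OF y] by (rule mult_left_mono)
    finally show "v \<bullet> h \<le> 3/2 * dual_norm F y v * local_norm z h" by simp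
  qed (use dual_norm_nonneg[OF y] in simp)
  moreover have "dual_norm F x v \<le> 8/7 * dual_norm F z v"
  proof (rule dual_norm_leI[OF x])
    fix h
    have "7/8 * local_norm z h \<le> (1 - local_norm x (z - x)) * local_norm z h"
      using rx local_norm_nonneg[OF z(1)] by (intro mult_right_mono) auto
    also have "\<dots> \<le> local_norm x h"
      using local_norm_compare(1)[OF x, of "z - x" h] rx by simp
    finally have *: "local_norm z h \<le> 8/7 * local_norm x h" by simp
    have "v \<bullet> h \<le> dual_norm F z v * local_norm z h" using inner_le_local_dual[OF z(1), of v h] by simp
    also have "\<dots> \<le> dual_norm F z v * (8/7 * local_norm x h)"
      using * dual_norm_nonneg[OF z(1)] by (rule mult_left_mono)
    finally show "v \<bullet> h \<le> 8/7 * dual_norm F z v * local_norm x h" by simp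
  qed (use dual_norm_nonneg[OF z(1)] in simp)
  ultimately show ?thesis by simp
qed

end

section \<open>Amortized cost of the step parameter\<close>

text \<open>In base 4, the fourth root taken at a rejection is exactly one unit of level.\<close>

definition kappa_level :: "real \<Rightarrow> real" where
  "kappa_level \<kappa> = ln (ln \<kappa>) / ln 4"

text \<open>Level already spent, in Newton steps: a rejected trial consists of 16 of them.\<close>

definition kappa_credit :: "real \<Rightarrow> real" where
  "kappa_credit \<kappa> = 16 * (kappa_level kappa0 - kappa_level \<kappa>)"

lemma ln_4_eq: "ln (4::real) = 2 * ln 2"
  using ln_realpow[of 2 2] by simp

lemma kappa_level_root4:
  assumes "1 < \<kappa>" shows "kappa_level (root 4 \<kappa>) = kappa_level \<kappa> - 1"
  using assms by (simp add: kappa_level_def ln_root ln_div diff_divide_distrib)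

lemma kappa_level_sqrt:
  assumes "1 < \<kappa>" shows "kappa_level (sqrt \<kappa>) = kappa_level \<kappa> - 1/2"
  using assms by (simp add: kappa_level_def ln_sqrt ln_div diff_divide_distrib ln_4_eq)

lemma kappa_level_power2:
  assumes "1 < \<kappa>" shows "kappa_level (\<kappa>\<^sup>2) = kappa_level \<kappa> + 1/2"
  using assms by (simp add: kappa_level_def ln_realpow ln_mult add_divide_distrib ln_4_eq)

lemma kappa_level_mono:
  assumes "1 < a" "a \<le> b" shows "kappa_level a \<le> kappa_level b"
  using assms by (simp add: kappa_level_def divide_right_mono)

lemma kappa_level_le_iff:
  assumes "1 < a" "1 < b" shows "kappa_level a \<le> kappa_level b \<longleftrightarrow> a \<le> b"
  using assms by (simp add: kappa_level_def divide_le_cancel)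

text \<open>The third claim is the amortized cost 11 of an accepted trial, which takes \<open>1 + slow s\<close> Newton steps:
\<open>3 + 8\<close> if the level is raised, at most 8 if it stays, and at most \<open>16 - 8\<close> if it is lowered. By the
fourth claim a trial that is accepted at once does not lower the level.\<close>

lemma accepted_kappa_cases:
  fixes s :: "'n::finite adaptive_state"
  assumes k: "1 < kappa s" "kappa s \<le> kappa0" and r: "\<not> restored s" "slow s \<le> 15"
  shows "1 < accepted_kappa s" "accepted_kappa s \<le> kappa0"
    and "1 + real (slow s) + kappa_credit (kappa s) \<le> 11 + kappa_credit (accepted_kappa s)"
    and "kappa_level (kappa s) - (if slow s = 0 then 0 else 1/2) \<le> kappa_level (accepted_kappa s)"
proof -
  let ?k = "kappa s"
  have sq: "?k \<le> ?k\<^sup>2" using k by (simp add: power2_eq_square)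
  show "1 < accepted_kappa s" using r k sq by (simp add: accepted_kappa_def kappa0_def)
  have "sqrt ?k \<le> ?k" using real_sqrt_le_mono[OF sq] k by simp
  then show "accepted_kappa s \<le> kappa0" using r k by (simp add: accepted_kappa_def)
  consider "slow s \<le> 2" | "2 < slow s" "slow s < 8" | "8 \<le> slow s" by linarith
  then have "1 + real (slow s) + kappa_credit ?k \<le> 11 + kappa_credit (accepted_kappa s) \<and>
    kappa_level ?k - (if slow s = 0 then 0 else 1/2) \<le> kappa_level (accepted_kappa s)"
  proof cases
    case 1
    then have a: "accepted_kappa s = min kappa0 (?k\<^sup>2)" using r by (simp add: accepted_kappa_def)
    have "kappa_level (min kappa0 (?k\<^sup>2)) \<le> kappa_level (?k\<^sup>2)"
      using k sq by (intro kappa_level_mono) (auto simp: kappa0_def)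
    moreover have "kappa_level ?k \<le> kappa_level (min kappa0 (?k\<^sup>2))"
      using k sq by (intro kappa_level_mono) auto
    ultimately show ?thesis using 1 by (simp add: a kappa_credit_def kappa_level_power2[OF k(1)])
  next
    case 2
    then show ?thesis using r by (simp add: accepted_kappa_def)
  next
    case 3
    then have "accepted_kappa s = sqrt ?k" using r by (simp add: accepted_kappa_def)
    then show ?thesis using 3 r by (simp add: kappa_credit_def kappa_level_sqrt[OF k(1)])
  qed
  then show "1 + real (slow s) + kappa_credit (kappa s) \<le> 11 + kappa_credit (accepted_kappa s)"
    "kappa_level (kappa s) - (if slow s = 0 then 0 else 1/2) \<le> kappa_level (accepted_kappa s)" by auto
qed

section \<open>One phase of the adaptive algorithm\<close>

text \<open>What both phases of the adaptive algorithm have in common. The predicate \<open>good a x t\<close> expresses the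
progress guaranteed after \<open>a\<close> accepted steps; the phase has stopped once \<open>a\<close> exceeds \<open>amax\<close>. Trials
with a step parameter of level at most \<open>L\<close> are accepted automatically. The offset \<open>off\<close> is a correction
to the number of Newton steps already performed when the analysis starts.\<close>

locale adaptive_phase = bounded_barrier Q F \<nu>
  for Q :: "(real ^ 'n) set" and F :: "real ^ 'n \<Rightarrow> real" and \<nu> :: real +
  fixes d :: "real ^ 'n" and upd :: "real \<Rightarrow> real ^ 'n \<Rightarrow> real \<Rightarrow> real"
    and stop :: "real ^ 'n \<Rightarrow> real \<Rightarrow> bool" and good :: "nat \<Rightarrow> real ^ 'n \<Rightarrow> real \<Rightarrow> bool"
    and amax :: nat and L :: real and off :: real
  assumes progress: "\<And>a x t \<kappa> x'. \<lbrakk>x \<in> S; dual_norm F x (t *\<^sub>R d + gradient F x) \<le> beta; good a x t;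
        \<not> stop x t; 1 < \<kappa>; x' \<in> S;
        dual_norm F x' (upd \<kappa> x t *\<^sub>R d + gradient F x') \<le> beta\<rbrakk> \<Longrightarrow> good (Suc a) x' (upd \<kappa> x t)"
    and automatic: "\<And>a x t \<kappa>. \<lbrakk>x \<in> S; dual_norm F x (t *\<^sub>R d + gradient F x) \<le> beta; good a x t;
        \<not> stop x t; 1 < \<kappa>; kappa_level \<kappa> \<le> L\<rbrakk> \<Longrightarrow>
        dual_norm F (damped_newton Q F d (upd \<kappa> x t) x)
          (upd \<kappa> x t *\<^sub>R d + gradient F (damped_newton Q F d (upd \<kappa> x t) x)) \<le> beta"
    and amax: "\<And>a x t. \<lbrakk>x \<in> S; dual_norm F x (t *\<^sub>R d + gradient F x) \<le> beta; good a x t;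
        \<not> stop x t\<rbrakk> \<Longrightarrow> a \<le> amax"
begin

text \<open>States at which the next trial starts: newly accepted, restored by a rejection, or initial.\<close>

definition ready :: "nat \<Rightarrow> 'n adaptive_state \<Rightarrow> bool" where
  "ready a s \<longleftrightarrow> iterate s \<in> S \<and> accepted F d s \<and> good a (iterate s) (param s) \<and>
     1 < accepted_kappa s \<and> accepted_kappa s \<le> kappa0 \<and> L - 1 < kappa_level (accepted_kappa s) \<and>
     real (newton_steps s) \<le> 11 * a + off + kappa_credit (accepted_kappa s)"

text \<open>States in the middle of a trial. Since the trial was not accepted at once, its level exceeds \<open>L\<close>, which
is what limits the number of rejections.\<close>

definition pending :: "nat \<Rightarrow> 'n adaptive_state \<Rightarrow> bool" where
  "pending a s \<longleftrightarrow> iterate s \<in> S \<and> \<not> accepted F d s \<and>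
     last_iterate s \<in> S \<and> good a (last_iterate s) (last_param s) \<and> \<not> stop (last_iterate s) (last_param s) \<and>
     dual_norm F (last_iterate s) (last_param s *\<^sub>R d + gradient F (last_iterate s)) \<le> beta \<and>
     (\<forall>x \<in> S. dual_norm F x (param s *\<^sub>R d + gradient F x) \<le> beta \<longrightarrow> good (Suc a) x (param s)) \<and>
     1 < kappa s \<and> kappa s \<le> kappa0 \<and> L < kappa_level (kappa s) \<and> slow s \<le> 15 \<and> \<not> restored s \<and>
     real (newton_steps s) \<le> 11 * a + off + kappa_credit (kappa s) + 1 + slow s"

text \<open>At most \<open>amax\<close> trials are accepted at cost 11, the level drops by at most one unit below \<open>L\<close>, and the
last trial may add one more Newton step.\<close>

definition cap :: real where
  "cap = 11 * amax + off + 16 * (kappa_level kappa0 - L) + 17"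

text \<open>Increases in every iteration, although a rejection performs no Newton step: two rejections never
follow each other directly.\<close>

definition work :: "'n adaptive_state \<Rightarrow> nat" where
  "work s = 2 * newton_steps s + (if restored s then 1 else 0)"

lemma newly_accepted_ready:
  assumes "iterate s \<in> S" "accepted F d s" "good (Suc a) (iterate s) (param s)"
    and k: "1 < kappa s" "kappa s \<le> kappa0" "\<not> restored s" "slow s \<le> 15"
    and "L - 1 < kappa_level (kappa s)" "slow s = 0 \<or> L < kappa_level (kappa s)"
    and "real (newton_steps s) \<le> 11 * a + off + kappa_credit (kappa s) + 1 + slow s"
  shows "ready (Suc a) s"
  using accepted_kappa_cases[OF k] assms unfolding ready_def by (auto split: if_splits)

lemma ready_step:
  assumes r: "ready a s" and ns: "\<not> stop (iterate s) (param s)"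
  defines "s' \<equiv> adaptive_step Q F d upd s"
  shows "ready (Suc a) s' \<or> pending a s'" "real (newton_steps s') \<le> cap" "work s < work s'"
proof -
  define \<kappa> where "\<kappa> = accepted_kappa s"
  define t where "t = upd \<kappa> (iterate s) (param s)"
  have s: "iterate s \<in> S" "accepted F d s" "good a (iterate s) (param s)" "1 < \<kappa>" "\<kappa> \<le> kappa0"
    "L - 1 < kappa_level \<kappa>" "real (newton_steps s) \<le> 11 * a + off + kappa_credit \<kappa>"
    using r by (auto simp: ready_def \<kappa>_def)
  have near: "dual_norm F (iterate s) (param s *\<^sub>R d + gradient F (iterate s)) \<le> beta"
    using s(2) by (simp add: accepted_def)
  have s': "s' = \<lparr>iterate = damped_newton Q F d t (iterate s), param = t, kappa = \<kappa>, slow = 0,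
             last_iterate = iterate s, last_param = param s, restored = False,
             newton_steps = newton_steps s + 1\<rparr>"
    using s(2) by (simp add: s'_def adaptive_step_def \<kappa>_def t_def Let_def)
  have S': "damped_newton Q F d t (iterate s) \<in> S" by (rule damped_newton_in_S[OF s(1)])
  have prog: "good (Suc a) x t" if "x \<in> S" "dual_norm F x (t *\<^sub>R d + gradient F x) \<le> beta" for x
    using progress[OF s(1) near s(3) ns s(4) that(1)] that(2) by (simp add: t_def)
  show "ready (Suc a) s' \<or> pending a s'"
  proof (cases "accepted F d s'")
    case True
    have "ready (Suc a) s'"
    proof (rule newly_accepted_ready)
      show "good (Suc a) (iterate s') (param s')"
        using True S' prog by (simp add: s' accepted_def)
    qed (use True s S' in \<open>auto simp: s'\<close>)
    then show ?thesis ..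
  next
    case False
    have "L < kappa_level \<kappa>"
      using automatic[OF s(1) near s(3) ns s(4)] False by (force simp: s' accepted_def t_def)
    then have "pending a s'"
      using False s S' prog near ns unfolding pending_def by (simp add: s')
    then show ?thesis ..
  qed
  have "a \<le> amax" by (rule amax[OF s(1) near s(3) ns])
  then show "real (newton_steps s') \<le> cap"
    using s(6,7) by (simp add: s' cap_def kappa_credit_def)
  show "work s < work s'" by (simp add: s' work_def)
qed

lemma pending_step:
  assumes p: "pending a s"
  defines "s' \<equiv> adaptive_step Q F d upd s"
  shows "ready a s' \<or> ready (Suc a) s' \<or> pending a s'" "real (newton_steps s') \<le> cap" "work s < work s'"
proof -
  note s = p[unfolded pending_def]
  have aa: "a \<le> amax" using amax s by blast
  have "(ready a s' \<or> ready (Suc a) s' \<or> pending a s') \<and> real (newton_steps s') \<le> cap \<and> work s < work s'"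
  proof (cases "slow s = 15")
    case True
    have s': "s' = s\<lparr>iterate := last_iterate s, param := last_param s, kappa := root 4 (kappa s),
          slow := 0, restored := True\<rparr>"
      using s True by (simp add: s'_def adaptive_step_def)
    have lev: "kappa_level (root 4 (kappa s)) = kappa_level (kappa s) - 1" using s by (intro kappa_level_root4) simp
    have k1: "1 < root 4 (kappa s)" using s by simp
    have "root 4 (kappa s) \<le> root 4 (kappa s ^ 4)"
      using s self_le_power[of "kappa s" 4] by simp
    then have k2: "root 4 (kappa s) \<le> kappa0" using s by (simp add: real_root_power_cancel)
    have "ready a s'"
      using s True lev k1 k2 by (simp add: ready_def s' accepted_def accepted_kappa_def kappa_credit_def)
    moreover have "real (newton_steps s') \<le> cap"
      using s True aa by (simp add: s' cap_def kappa_credit_def)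
    moreover have "work s < work s'" using s by (simp add: s' work_def)
    ultimately show ?thesis by blast
  next
    case False
    have s': "s' = s\<lparr>iterate := damped_newton Q F d (param s) (iterate s), slow := slow s + 1,
          newton_steps := newton_steps s + 1\<rparr>"
      using s False by (simp add: s'_def adaptive_step_def)
    have S': "damped_newton Q F d (param s) (iterate s) \<in> S" using damped_newton_in_S s by simp
    have "ready (Suc a) s' \<or> pending a s'"
    proof (cases "accepted F d s'")
      case True
      have "ready (Suc a) s'"
      proof (rule newly_accepted_ready)
        show "good (Suc a) (iterate s') (param s')"
          using True S' s by (simp add: s' accepted_def)
      qed (use True s S' False in \<open>auto simp: s'\<close>)
      then show ?thesis ..
    next
      case nacc: False
      have "pending a s'"
        using nacc s S' False unfolding pending_def by (simp add: s')
      then show ?thesis ..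
    qed
    moreover have "real (newton_steps s') \<le> cap"
      using s False aa by (simp add: s' cap_def kappa_credit_def)
    moreover have "work s < work s'" by (simp add: s' work_def)
    ultimately show ?thesis by blast
  qed
  then show "ready a s' \<or> ready (Suc a) s' \<or> pending a s'" "real (newton_steps s') \<le> cap" "work s < work s'"
    by auto
qed

definition valid_state :: "'n adaptive_state \<Rightarrow> bool" where
  "valid_state s \<longleftrightarrow> (\<exists>a. ready a s \<or> pending a s)"

lemma valid_state_step:
  assumes "valid_state s" "\<not> stop (iterate s) (param s)"
  defines "s' \<equiv> adaptive_step Q F d upd s"
  shows "valid_state s'" "real (newton_steps s') \<le> cap" "work s < work s'"
proof -
  obtain a where "ready a s \<or> pending a s" using assms(1) by (auto simp: valid_state_def)
  then have "valid_state s' \<and> real (newton_steps s') \<le> cap \<and> work s < work s'"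
    using ready_step[OF _ assms(2)] pending_step unfolding s'_def valid_state_def by blast
  then show "valid_state s'" "real (newton_steps s') \<le> cap" "work s < work s'" by auto
qed

text \<open>As long as the phase runs, \<open>work\<close> increases and the number of Newton steps is at most \<open>cap\<close>; therefore the
phase stops, and the bound holds when it does.\<close>

lemma phase_terminates:
  assumes "valid_state s"
  defines "st \<equiv> \<lambda>k. (adaptive_step Q F d upd ^^ k) s"
  obtains m where "stop (iterate (st m)) (param (st m))" "\<And>j. j < m \<Longrightarrow> \<not> stop (iterate (st j)) (param (st j))"
    "iterate (st m) \<in> S" "m = 0 \<or> real (newton_steps (st m)) \<le> cap"
proof -
  let ?P = "\<lambda>k. stop (iterate (st k)) (param (st k))"
  have run: "valid_state (st k) \<and> (k = 0 \<or> real (newton_steps (st k)) \<le> cap) \<and> k \<le> work (st k)"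
    if "\<forall>j<k. \<not> ?P j" for k
    using that
  proof (induction k)
    case 0
    then show ?case using assms(1) by (simp add: st_def)
  next
    case (Suc k)
    then have IH: "valid_state (st k)" "k \<le> work (st k)" and ns: "\<not> ?P k" by auto
    have "st (Suc k) = adaptive_step Q F d upd (st k)" by (simp add: st_def)
    then show ?case using valid_state_step[OF IH(1) ns] IH(2) by simp
  qed
  have "\<exists>m. ?P m"
  proof (rule ccontr)
    assume "\<nexists>m. ?P m"
    then have run': "(k = 0 \<or> real (newton_steps (st k)) \<le> cap) \<and> k \<le> work (st k)" for k using run by blast
    define k where "k = nat \<lceil>2 * cap + 2\<rceil> + 1"
    have "real k \<le> real (work (st k))" using run' by simp
    also have "\<dots> \<le> 2 * cap + 1" using run'[of k] by (simp add: work_def k_def)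
    also have "\<dots> < real k" unfolding k_def by linarith
    finally show False by simp
  qed
  define m where "m = (LEAST m. ?P m)"
  have m: "?P m" unfolding m_def by (rule LeastI_ex[OF \<open>\<exists>m. ?P m\<close>])
  have least: "\<not> ?P j" if "j < m" for j using not_less_Least that by (auto simp: m_def)
  have "iterate (st m) \<in> S" using run[of m] least by (auto simp: valid_state_def ready_def pending_def)
  then show ?thesis using that m least run[of m] by blast
qed

end

context bounded_barrier
begin

section \<open>Short steps and automatic acceptance\<close>

text \<open>The level below which no rejection takes place.\<close>

definition rejection_level :: real where
  "rejection_level = kappa_level (1 + (5/4) / (1 + 9 * sqrt \<nu>))"

lemma dual_norm_scale: "dual_norm F x (k *\<^sub>R v) = \<bar>k\<bar> * dual_norm F x v"
  by (simp add: dual_norm_def matrix_vector_mult_scaleR real_sqrt_mult flip: power2_eq_square mult.assoc)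

lemma decrement_after_short_step:
  assumes "x \<in> S" "dual_norm F x (t *\<^sub>R d + gradient F x) \<le> beta" "\<bar>t' - t\<bar> * dual_norm F x d \<le> gamma"
  shows "dual_norm F x (t' *\<^sub>R d + gradient F x) \<le> 1/4"
proof -
  have eq: "t' *\<^sub>R d + gradient F x = (t' - t) *\<^sub>R d + (t *\<^sub>R d + gradient F x)" by (simp add: algebra_simps)
  show ?thesis
    unfolding eq using dual_norm_add_scale[OF assms(1), of "t' - t" d "t *\<^sub>R d + gradient F x"] assms(2,3)
    by (simp add: beta_def gamma_def)
qed

text \<open>Moving \<open>t\<close> by a short step raises the decrement from at most \<open>beta = 1/9\<close> to at most \<open>beta + gamma = 1/4\<close>,
which one full Newton step brings back to \<open>beta\<close>.\<close>

lemma short_step_accepted: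
  assumes "x \<in> S" "dual_norm F x (t *\<^sub>R d + gradient F x) \<le> beta" "\<bar>t' - t\<bar> * dual_norm F x d \<le> gamma"
  shows "x - newton_dir F d t' x \<in> S"
    and "dual_norm F (x - newton_dir F d t' x) (t' *\<^sub>R d + gradient F (x - newton_dir F d t' x)) \<le> beta"
    and "damped_newton Q F d t' x = x - newton_dir F d t' x"
  using full_newton_step[OF assms(1) decrement_after_short_step[OF assms]]
    damped_newton_full[OF assms(1) decrement_after_short_step[OF assms]] by auto

lemma param_times_dual_norm:
  assumes "x \<in> S" "dual_norm F x (t *\<^sub>R d + gradient F x) \<le> beta"
  shows "\<bar>t\<bar> * dual_norm F x d \<le> (1 + 9 * sqrt \<nu>) / 9"
proof -
  have "\<bar>t\<bar> * dual_norm F x d = dual_norm F x ((- 1) *\<^sub>R gradient F x + (t *\<^sub>R d + gradient F x))"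
    by (simp flip: dual_norm_scale)
  also have "\<dots> \<le> \<bar>- 1\<bar> * dual_norm F x (gradient F x) + dual_norm F x (t *\<^sub>R d + gradient F x)"
    by (rule dual_norm_add_scale[OF assms(1)])
  also have "\<dots> \<le> (1 + 9 * sqrt \<nu>) / 9"
    using dual_norm_gradient[OF assms(1)] assms(2) by (simp add: beta_def)
  finally show ?thesis .
qed

text \<open>Here \<open>x\<close> is an accepted iterate of the adaptive algorithm and \<open>y\<close> an iterate of the short step algorithm
whose next step passes the parameter \<open>t\<close>.\<close>

lemma adaptive_step_length:
  assumes x: "x \<in> S" and y: "y \<in> S" and d: "d \<noteq> 0"
    and dx: "dual_norm F x (t *\<^sub>R d + gradient F x) \<le> beta"
    and dy: "dual_norm F y (t *\<^sub>R d + gradient F y) \<le> 1/4"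
  shows "7/12 * (gamma / dual_norm F y d) \<le> gamma / dual_norm F x d"
proof -
  have "dual_norm F x d \<le> 12/7 * dual_norm F y d"
    by (rule dual_norm_compare_near_path[OF x y dx[unfolded beta_def] dy])
  then show ?thesis
    using dual_norm_pos[OF x d] dual_norm_pos[OF y d] by (simp add: gamma_def field_simps)
qed

end

lemma newton_steps_le: "newton_steps ((adaptive_step Q F d upd ^^ k) s) \<le> newton_steps s + k"
proof (induction k)
  case (Suc k)
  have "newton_steps (adaptive_step Q F d upd s) \<le> newton_steps s + 1" for s
    by (simp add: adaptive_step_def Let_def)
  from this[of "(adaptive_step Q F d upd ^^ k) s"] Suc show ?case by simp
qed simp

lemma accepted_kappa_initial: "accepted_kappa (initial_state x t) = kappa0"
  by (simp add: accepted_kappa_def initial_state_def kappa0_def)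

lemma kappa_credit_kappa0: "kappa_credit kappa0 = 0"
  by (simp add: kappa_credit_def)

context bounded_barrier
begin

lemma rejection_level_le:
  assumes "x \<in> S" shows "rejection_level \<le> kappa_level kappa0"
proof -
  have "\<nu> \<ge> 1" using nu_ge_1 assms by blast
  then have z: "0 < (5/4) / (1 + 9 * sqrt \<nu>)" "(5/4) / (1 + 9 * sqrt \<nu>) \<le> 5/4"
    by (auto simp: field_simps add_pos_nonneg)
  then show ?thesis
    unfolding rejection_level_def by (intro kappa_level_mono) (auto simp: kappa0_def)
qed

section \<open>Newton steps of the two phases\<close>

text \<open>Two accepted steps cover a short step, so the target is reached no later than with the accepted step
number \<open>2 * K\<close>. The first trial is a single Newton step that leaves \<open>\<kappa>\<close> at its maximum, since \<open>t\<close> starts at 0; this saves 10 of its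
11 amortized Newton steps. If \<open>K = 1\<close>, the second trial multiplies \<open>t\<close> by 10 and thereby reaches the
target.\<close>

lemma main_phase:
  fixes c :: "real ^ 'n"
  assumes c: "c \<noteq> 0" and T: "T > 0"
    and xS: "xS \<in> S" "dual_norm F xS (gradient F xS) \<le> beta"
    and xA: "xA \<in> S" "dual_norm F xA (gradient F xA) \<le> beta"
    and K: "T \<le> snd (short_main F c xS K)"
  obtains m where "T \<le> param (adaptive_main Q F c xA m)"
    "\<And>j. j < m \<Longrightarrow> \<not> T \<le> param (adaptive_main Q F c xA j)"
    "real (newton_steps (adaptive_main Q F c xA m))
      \<le> (if K = 1 then 2 else 22 * real K - 4 + 16 * (kappa_level kappa0 - rejection_level))"
proof -
  define xs where "xs k = fst (short_main F c xS k)" for k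
  define ts where "ts k = snd (short_main F c xS k)" for k
  define \<Delta> where "\<Delta> k = gamma / dual_norm F (xs k) c" for k
  have s0: "xs 0 = xS" "ts 0 = 0" by (simp_all add: xs_def ts_def short_main_def)
  have ss: "ts (Suc k) = ts k + \<Delta> k" "xs (Suc k) = xs k - newton_dir F c (ts (Suc k)) (xs k)" for k
    by (simp_all add: xs_def ts_def \<Delta>_def short_main_def short_main_step_def Let_def split_beta)
  have near: "xs k \<in> S \<and> dual_norm F (xs k) (ts k *\<^sub>R c + gradient F (xs k)) \<le> beta" for k
  proof (induction k)
    case 0
    then show ?case using xS by (simp add: s0)
  next
    case (Suc k)
    then have "\<bar>ts (Suc k) - ts k\<bar> * dual_norm F (xs k) c \<le> gamma"
      using dual_norm_pos[OF _ c, of "xs k"] by (simp add: ss \<Delta>_def gamma_def)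
    then show ?case using short_step_accepted[of "xs k" "ts k" c "ts (Suc k)"] Suc by (simp add: ss(2)[of k])
  qed
  have \<Delta>: "\<Delta> k > 0" for k using dual_norm_pos[OF _ c] near by (simp add: \<Delta>_def gamma_def)
  have mono: "ts i \<le> ts j" if "i \<le> j" for i j
    using lift_Suc_mono_le[of ts i j] that \<Delta> ss(1) by (metis less_add_same_cancel1 less_imp_le)
  have ts0: "ts k \<ge> 0" for k using mono[of 0 k] s0 by simp
  have cmp: "7/12 * \<Delta> k \<le> gamma / dual_norm F x c"
    if "x \<in> S" "dual_norm F x (t *\<^sub>R c + gradient F x) \<le> beta" "ts k \<le> t" "t \<le> ts k + \<Delta> k" for x t k
  proof -
    have p: "dual_norm F (xs k) c > 0" using dual_norm_pos[OF _ c] near by blast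
    have "\<bar>t - ts k\<bar> * dual_norm F (xs k) c \<le> \<Delta> k * dual_norm F (xs k) c"
      using that p by (intro mult_right_mono) auto
    also have "\<dots> = gamma" using p by (simp add: \<Delta>_def)
    finally have "dual_norm F (xs k) (t *\<^sub>R c + gradient F (xs k)) \<le> 1/4"
      using near by (intro decrement_after_short_step[of _ "ts k"]) auto
    then show ?thesis
      using adaptive_step_length[OF that(1) _ c that(2)] near unfolding \<Delta>_def by blast
  qed
  \<comment> \<open>each short step is split into a first part of \<open>7/12\<close> and the rest, and an accepted step covers at least one of them\<close>
  define good where "good a x t \<longleftrightarrow> ts (a div 2) + (if odd a then 7/12 * \<Delta> (a div 2) else 0) \<le> t"
    for a and x :: "real ^ 'n" and t :: real
  have K1: "K \<ge> 1" using K T s0 by (cases K) (auto simp: ts_def)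
  have upd: "t + gamma / dual_norm F x c \<le> main_update F c \<kappa> x t" for \<kappa> x t by (simp add: main_update_def)
  interpret P: adaptive_phase Q F \<nu> c "main_update F c" "\<lambda>x t. T \<le> t" good "2 * K - 1" rejection_level "- 10"
  proof
    fix a x t \<kappa> x'
    assume x: "x \<in> S" "dual_norm F x (t *\<^sub>R c + gradient F x) \<le> beta" and g: "good a x t"
      and ns: "\<not> T \<le> t" and k: "1 < (\<kappa> :: real)"
    define i where "i = a div 2"
    define t' where "t' = main_update F c \<kappa> x t"
    have a: "a = 2 * i \<or> a = 2 * i + 1" unfolding i_def by presburger
    have gi: "ts i + (if odd a then 7/12 * \<Delta> i else 0) \<le> t" using g unfolding good_def i_def .
    have g': "gamma / dual_norm F x c > 0" using dual_norm_pos[OF x(1) c] by (simp add: gamma_def)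
    have t0: "t \<ge> 0" using gi ts0[of i] \<Delta>[of i] by (auto split: if_splits)
    have "good (Suc a) x' t'"
    proof (cases "t \<le> ts i + \<Delta> i")
      case True
      have "7/12 * \<Delta> i \<le> gamma / dual_norm F x c"
        using cmp[OF x _ True] gi \<Delta>[of i] by (auto split: if_splits)
      then have "t + 7/12 * \<Delta> i \<le> t'" using upd[of t x \<kappa>] unfolding t'_def by linarith
      then show ?thesis using gi a \<Delta>[of i] by (auto simp: good_def ss)
    next
      case False
      then have "ts i + \<Delta> i \<le> t'" using upd[of t x \<kappa>] g' by (simp add: t'_def)
      then show ?thesis using a \<Delta>[of i] by (auto simp: good_def ss)
    qed
    then show "good (Suc a) x' (main_update F c \<kappa> x t)" by (simp add: t'_def)
    show "dual_norm F (damped_newton Q F c (main_update F c \<kappa> x t) x)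
          (main_update F c \<kappa> x t *\<^sub>R c + gradient F (damped_newton Q F c (main_update F c \<kappa> x t) x)) \<le> beta"
      if lev: "kappa_level \<kappa> \<le> rejection_level"
    proof -
      let ?y = "1 + 9 * sqrt \<nu>" and ?n = "dual_norm F x c"
      define z where "z = (5/4) / ?y"
      have "\<nu> \<ge> 1" using nu_ge_1 x(1) by blast
      then have y: "?y > 0" by (intro add_pos_nonneg) auto
      have n: "?n > 0" by (rule dual_norm_pos[OF x(1) c])
      have z: "z > 0" unfolding z_def using y by (intro divide_pos_pos) auto
      have kle: "\<kappa> \<le> 1 + z"
        using lev k z unfolding rejection_level_def z_def[symmetric] by (subst (asm) kappa_level_le_iff) auto
      have "t * ?n * 9 \<le> ?y" using param_times_dual_norm[OF x] t0 by simp
      then have "t * ?n / ?y \<le> 1/9" using y by (simp add: field_simps)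
      then have "5/4 * (t * ?n / ?y) \<le> 5/4 * (1/9)" by (rule mult_left_mono) simp
      moreover have "t * z * ?n = 5/4 * (t * ?n / ?y)" by (simp add: z_def)
      ultimately have "t * z * ?n \<le> gamma" by (simp add: gamma_def)
      then have "t * z \<le> gamma / ?n" using n by (simp add: pos_le_divide_eq)
      moreover have "\<kappa> * t \<le> (1 + z) * t" using kle t0 by (rule mult_right_mono)
      moreover have "(1 + z) * t = t + t * z" by (simp add: algebra_simps)
      ultimately have "\<kappa> * t \<le> t + gamma / ?n" by linarith
      then have u: "main_update F c \<kappa> x t = t + gamma / ?n" by (simp add: main_update_def)
      have "\<bar>main_update F c \<kappa> x t - t\<bar> * ?n \<le> gamma" unfolding u using n by (simp add: gamma_def)
      from short_step_accepted[OF x this] show ?thesis by simp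
    qed
  next
    fix a x t
    assume g: "good a x t" and ns: "\<not> T \<le> t"
    define i where "i = a div 2"
    have gi: "ts i + (if odd a then 7/12 * \<Delta> i else 0) \<le> t" using g unfolding good_def i_def .
    show "a \<le> 2 * K - 1"
    proof (rule ccontr)
      assume "\<not> a \<le> 2 * K - 1"
      then have "K \<le> i" unfolding i_def by presburger
      then have "ts K \<le> t" using mono[of K i] gi \<Delta>[of i] by (auto split: if_splits)
      then show False using K ns by (simp add: ts_def)
    qed
  qed
  \<comment> \<open>the analysis starts after the first step, hence with progress 1 and the offset \<open>1 - 11\<close>\<close>
  define s0 where "s0 = initial_state xA 0"
  define s1 where "s1 = adaptive_step Q F c (main_update F c) s0"
  have Smain: "adaptive_main Q F c xA (Suc k) = (adaptive_step Q F c (main_update F c) ^^ k) s1" for k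
    by (simp add: adaptive_main_def s0_def s1_def funpow_swap1)
  define t1 where "t1 = gamma / dual_norm F xA c"
  have nA: "dual_norm F xA c > 0" by (rule dual_norm_pos[OF xA(1) c])
  have near0: "dual_norm F xA (0 *\<^sub>R c + gradient F xA) \<le> beta" using xA(2) by simp
  have "\<bar>t1 - 0\<bar> * dual_norm F xA c \<le> gamma" using nA by (simp add: t1_def gamma_def)
  note sa = short_step_accepted[OF xA(1) near0 this]
  have acc0: "accepted F c s0" using near0 by (simp add: accepted_def s0_def initial_state_def)
  have u1: "main_update F c kappa0 xA 0 = t1" using nA by (simp add: main_update_def t1_def gamma_def)
  have s1: "s1 = \<lparr>iterate = damped_newton Q F c t1 xA, param = t1, kappa = kappa0, slow = 0,
      last_iterate = xA, last_param = 0, restored = False, newton_steps = 1\<rparr>"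
  proof -
    have "accepted_kappa s0 = kappa0" by (simp add: s0_def accepted_kappa_initial)
    moreover have "iterate s0 = xA" "param s0 = 0" "newton_steps s0 = 0" by (simp_all add: s0_def initial_state_def)
    ultimately show ?thesis using acc0 u1 by (simp add: s1_def adaptive_step_def Let_def)
  qed
  have acc1: "accepted F c s1" using sa by (simp add: accepted_def s1)
  have ak1: "accepted_kappa s1 = kappa0" by (simp add: s1 accepted_kappa_def kappa0_def)
  have t1: "7/12 * \<Delta> 0 \<le> t1" unfolding t1_def using cmp[OF xA(1) near0, of 0] \<Delta>[of 0] \<open>ts 0 = 0\<close> by simp
  have "P.ready 1 s1"
    unfolding P.ready_def ak1 kappa_credit_kappa0
    using sa acc1 t1 rejection_level_le[OF xA(1)] xA \<open>ts 0 = 0\<close> by (auto simp: s1 good_def kappa0_def)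
  then have "P.valid_state s1" unfolding P.valid_state_def by blast
  then obtain m where m: "T \<le> param ((adaptive_step Q F c (main_update F c) ^^ m) s1)"
    "\<And>j. j < m \<Longrightarrow> \<not> T \<le> param ((adaptive_step Q F c (main_update F c) ^^ j) s1)"
    "m = 0 \<or> real (newton_steps ((adaptive_step Q F c (main_update F c) ^^ m) s1)) \<le> P.cap"
    by (rule P.phase_terminates) blast
  have first: "\<not> T \<le> param (adaptive_main Q F c xA j)" if "j < Suc m" for j
  proof (cases j)
    case 0
    then show ?thesis using T by (simp add: adaptive_main_def initial_state_def)
  next
    case (Suc i)
    then show ?thesis using m(2) that by (simp add: Smain)
  qed
  have B: "rejection_level \<le> kappa_level kappa0" by (rule rejection_level_le[OF xA(1)])
  have "real (newton_steps (adaptive_main Q F c xA (Suc m)))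
      \<le> (if K = 1 then 2 else 22 * real K - 4 + 16 * (kappa_level kappa0 - rejection_level))"
  proof (cases "K = 1")
    case True
    have "m \<le> 1"
    proof (rule ccontr)
      assume "\<not> m \<le> 1"
      then have m01: "\<not> T \<le> t1" "\<not> T \<le> param (adaptive_step Q F c (main_update F c) s1)"
        using m(2)[of 0] m(2)[of 1] by (auto simp: s1)
      have "T \<le> \<Delta> 0" using K True ss(1)[of 0] \<open>ts 0 = 0\<close> by (simp add: ts_def)
      also have "\<dots> \<le> 10 * t1" using t1 \<Delta>[of 0] by simp
      also have "\<dots> \<le> param (adaptive_step Q F c (main_update F c) s1)"
        using acc1 ak1 by (simp add: adaptive_step_def Let_def main_update_def kappa0_def) (simp add: s1)
      finally show False using m01 by simp
    qed
    then show ?thesis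
      using True newton_steps_le[where k = m and s = s1 and Q = Q and F = F and d = c and upd = "main_update F c"] by (simp add: Smain s1)
  next
    case False
    show ?thesis
    proof (cases "m = 0")
      case True
      then show ?thesis using False K1 B by (simp add: Smain s1)
    next
      case m0: False
      then show ?thesis using m(3)[unfolded P.cap_def] False K1 by (simp add: Smain of_nat_diff)
    qed
  qed
  then show ?thesis using that[of "Suc m"] m(1) first by (simp add: Smain)
qed

text \<open>The first accepted step equals a short step because both algorithms start at \<open>xhat\<close>; two further ones
cover each of the remaining \<open>K - 1\<close> short steps. Let \<open>x\<^sub>K\<close> be the last short step iterate. It has decrement
at most \<open>1/4\<close> both at its own parameter and at 0, hence everywhere in between by convexity, so accepted
steps keep having at least \<open>7/12\<close> of the length \<open>gamma / \<parallel>G\<parallel>\<^sup>*\<close> at \<open>x\<^sub>K\<close>. The remaining parameter is at most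
\<open>13/5\<close> of this length. After four more steps it is at most \<open>13/5 - 28/12 < 7/12\<close> of it, and then the
decrement at 0 is at most \<open>beta + gamma = 1/4\<close>, the stopping criterion.\<close>

lemma auxiliary_phase:
  assumes xhat: "xhat \<in> S"
    and K: "aux_stop F (fst (short_aux F xhat K))" "\<And>k. k < K \<Longrightarrow> \<not> aux_stop F (fst (short_aux F xhat k))"
  obtains m where "aux_stop F (iterate (adaptive_aux Q F xhat m))"
    "\<And>j. j < m \<Longrightarrow> \<not> aux_stop F (iterate (adaptive_aux Q F xhat j))"
    "iterate (adaptive_aux Q F xhat m) \<in> S"
    "real (newton_steps (adaptive_aux Q F xhat m))
      \<le> (if K = 0 then 0 else 22 * real K + 39 + 16 * (kappa_level kappa0 - rejection_level))"
    "fst (short_aux F xhat K) \<in> S"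
proof (cases "K = 0")
  case True
  then have "aux_stop F xhat" using K(1) by (simp add: short_aux_def)
  then show ?thesis
    using that[of 0] xhat True by (simp add: adaptive_aux_def Let_def initial_state_def short_aux_def)
next
  case K0: False
  define G where "G = - gradient F xhat"
  have stop_iff: "aux_stop F x \<longleftrightarrow> dual_norm F x (gradient F x) \<le> 1/4" for x
    by (simp add: aux_stop_def beta_def real_sqrt_divide)
  have G: "G \<noteq> 0"
  proof
    assume "G = 0"
    then have "aux_stop F xhat" by (simp add: stop_iff G_def dual_norm_def)
    then show False using K(2)[of 0] K0 by (simp add: short_aux_def)
  qed
  define xs where "xs k = fst (short_aux F xhat k)" for k
  define ts where "ts k = snd (short_aux F xhat k)" for k
  define \<Delta> where "\<Delta> k = gamma / dual_norm F (xs k) G" for k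
  have s0: "xs 0 = xhat" "ts 0 = 1" by (simp_all add: xs_def ts_def short_aux_def)
  have ss: "ts (Suc k) = ts k - \<Delta> k" "xs (Suc k) = xs k - newton_dir F G (ts (Suc k)) (xs k)" for k
    by (simp_all add: xs_def ts_def \<Delta>_def G_def short_aux_def short_aux_step_def Let_def split_beta)
  have near: "xs k \<in> S \<and> dual_norm F (xs k) (ts k *\<^sub>R G + gradient F (xs k)) \<le> beta" for k
  proof (induction k)
    case 0
    then show ?case using xhat by (simp add: s0 G_def dual_norm_def beta_def)
  next
    case (Suc k)
    then have "\<bar>ts (Suc k) - ts k\<bar> * dual_norm F (xs k) G \<le> gamma"
      using dual_norm_pos[OF _ G, of "xs k"] by (simp add: ss \<Delta>_def gamma_def)
    then show ?case using short_step_accepted[of "xs k" "ts k" G "ts (Suc k)"] Suc by (simp add: ss(2)[of k])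
  qed
  have npos: "dual_norm F (xs k) G > 0" for k using dual_norm_pos[OF _ G] near by blast
  have \<Delta>: "\<Delta> k > 0" for k using npos by (simp add: \<Delta>_def gamma_def)
  have cmp: "7/12 * \<Delta> k \<le> gamma / dual_norm F x G"
    if "x \<in> S" "dual_norm F x (t *\<^sub>R G + gradient F x) \<le> beta" "t \<le> ts k" "ts k - \<Delta> k \<le> t" for x t k
  proof -
    have "\<bar>t - ts k\<bar> * dual_norm F (xs k) G \<le> \<Delta> k * dual_norm F (xs k) G"
      using that npos[of k] by (intro mult_right_mono) auto
    also have "\<dots> = gamma" using npos[of k] by (simp add: \<Delta>_def)
    finally have "dual_norm F (xs k) (t *\<^sub>R G + gradient F (xs k)) \<le> 1/4"
      using near by (intro decrement_after_short_step[of _ "ts k"]) auto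
    then show ?thesis
      using adaptive_step_length[OF that(1) _ G that(2)] near unfolding \<Delta>_def by blast
  qed
  have stopK: "dual_norm F (xs K) (gradient F (xs K)) \<le> 1/4"
    using K(1) by (simp add: stop_iff xs_def)
  have cmpK: "7/12 * \<Delta> K \<le> gamma / dual_norm F x G"
    if "x \<in> S" "dual_norm F x (t *\<^sub>R G + gradient F x) \<le> beta" "t \<le> ts K" "0 < t" for x t
  proof -
    have xK: "xs K \<in> S" using near by blast
    define u where "u = t / ts K"
    have u: "0 \<le> u" "u \<le> 1" using that by (auto simp: u_def)
    have "t *\<^sub>R G + gradient F (xs K) = u *\<^sub>R (ts K *\<^sub>R G + gradient F (xs K)) + (1 - u) *\<^sub>R gradient F (xs K)"
      using that by (simp add: u_def algebra_simps)
    also have "dual_norm F (xs K) \<dots> \<le> \<bar>u\<bar> * dual_norm F (xs K) (ts K *\<^sub>R G + gradient F (xs K))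
        + dual_norm F (xs K) ((1 - u) *\<^sub>R gradient F (xs K))"
      by (rule dual_norm_add_scale[OF xK])
    also have "\<dots> \<le> u * (1/4) + (1 - u) * (1/4)"
      using u near[of K] stopK unfolding dual_norm_scale
      by (intro add_mono mult_mono) (auto simp: beta_def intro!: dual_norm_nonneg)
    also have "\<dots> = 1/4" by (simp add: diff_divide_distrib)
    finally show ?thesis using adaptive_step_length[OF that(1) xK G that(2)] by (simp add: \<Delta>_def)
  qed
  have tsK: "ts K * dual_norm F (xs K) G \<le> 13/36"
  proof -
    have xK: "xs K \<in> S" using near by blast
    have "\<bar>ts K\<bar> * dual_norm F (xs K) G = dual_norm F (xs K) ((- 1) *\<^sub>R gradient F (xs K) + (ts K *\<^sub>R G + gradient F (xs K)))"
      by (simp flip: dual_norm_scale)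
    also have "\<dots> \<le> \<bar>- 1\<bar> * dual_norm F (xs K) (gradient F (xs K)) + dual_norm F (xs K) (ts K *\<^sub>R G + gradient F (xs K))"
      by (rule dual_norm_add_scale[OF xK])
    also have "\<dots> \<le> 13/36" using stopK near[of K] by (simp add: beta_def)
    finally show ?thesis
      using npos[of K] by (smt (verit, best) mult_right_mono)
  qed
  have running: "gamma < t * dual_norm F x G"
    if "x \<in> S" "dual_norm F x (t *\<^sub>R G + gradient F x) \<le> beta" "t > 0" "\<not> aux_stop F x" for x t
  proof -
    have "dual_norm F x (gradient F x) = dual_norm F x ((- t) *\<^sub>R G + (t *\<^sub>R G + gradient F x))" by simp
    also have "\<dots> \<le> \<bar>- t\<bar> * dual_norm F x G + dual_norm F x (t *\<^sub>R G + gradient F x)"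
      by (rule dual_norm_add_scale[OF that(1)])
    finally show ?thesis using that by (simp add: stop_iff beta_def gamma_def)
  qed
  \<comment> \<open>\<open>k\<close> short steps are covered and \<open>j\<close> parts of the next one, where beyond the last iterate \<open>K\<close> the parts continue with equal length\<close>
  define good where "good a x t \<longleftrightarrow> t > 0 \<and> ((a = 0 \<and> x = xhat \<and> t = 1) \<or>
     (\<exists>k j. 1 \<le> k \<and> k \<le> K \<and> a + 1 \<le> 2 * k + j \<and> (k < K \<longrightarrow> j \<le> 1) \<and> t \<le> ts k - real j * (7/12 * \<Delta> k)))"
    for a :: nat and x :: "real ^ 'n" and t :: real
  interpret P: adaptive_phase Q F \<nu> G "aux_update F G" "\<lambda>x t. aux_stop F x" good "2 * K + 2" rejection_level 0
  proof
    fix a x t \<kappa> x'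
    assume x: "x \<in> S" "dual_norm F x (t *\<^sub>R G + gradient F x) \<le> beta" and g: "good a x t"
      and ns: "\<not> aux_stop F x" and k: "1 < (\<kappa> :: real)"
    define t' where "t' = aux_update F G \<kappa> x t"
    let ?n = "dual_norm F x G"
    have t0: "t > 0" using g by (simp add: good_def)
    have n: "?n > 0" by (rule dual_norm_pos[OF x(1) G])
    have run: "gamma / ?n < t" using running[OF x t0 ns] n by (simp add: pos_divide_less_eq)
    have t'0: "t' > 0" using run t0 k by (simp add: t'_def aux_update_def)
    have t'le: "t' \<le> t - gamma / ?n" by (simp add: t'_def aux_update_def)
    have gpos: "gamma / ?n > 0" using n by (simp add: gamma_def)
    have goodI: "good (Suc a) x' t'" if "1 \<le> k" "k \<le> K" "a + 2 \<le> 2 * k + j" "k < K \<longrightarrow> j \<le> 1"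
      "t' \<le> ts k - real j * (7/12 * \<Delta> k)" for k j
      unfolding good_def using that t'0 by (intro conjI disjI2 exI[of _ k] exI[of _ j]) auto
    have cases: "(a = 0 \<and> x = xhat \<and> t = 1) \<or>
     (\<exists>k j. 1 \<le> k \<and> k \<le> K \<and> a + 1 \<le> 2 * k + j \<and> (k < K \<longrightarrow> j \<le> 1) \<and> t \<le> ts k - real j * (7/12 * \<Delta> k))"
      using g by (simp add: good_def)
    then have "good (Suc a) x' t'"
    proof (elim disjE exE)
      assume "a = 0 \<and> x = xhat \<and> t = 1"
      then show ?thesis
        using t'le K0 ss(1)[of 0] s0 by (intro goodI[of 1 0]) (auto simp: \<Delta>_def)
    next
      fix k j assume kj: "1 \<le> k \<and> k \<le> K \<and> a + 1 \<le> 2 * k + j \<and> (k < K \<longrightarrow> j \<le> 1) \<and> t \<le> ts k - real j * (7/12 * \<Delta> k)"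
      have jd: "real j * (7/12 * \<Delta> k) \<ge> 0" using \<Delta>[of k] by simp
      have tk: "t \<le> ts k" using kj jd by linarith
      show ?thesis
      proof (cases "k = K")
        case True
        have "7/12 * \<Delta> K \<le> gamma / ?n" using cmpK[OF x _ t0] tk True by simp
        then have "t' \<le> ts k - real (Suc j) * (7/12 * \<Delta> k)"
          using t'le kj True by (simp only: of_nat_Suc distrib_right) linarith
        then show ?thesis using kj True by (intro goodI[of k "Suc j"]) auto
      next
        case False
        then have kK: "k < K" "j \<le> 1" using kj by auto
        show ?thesis
        proof (cases "t \<le> ts k - \<Delta> k")
          case True
          then have "t' \<le> ts (Suc k)" using t'le gpos by (simp add: ss)
          then show ?thesis using kj kK by (intro goodI[of "Suc k" 0]) auto
        next
          case False
          then have st: "7/12 * \<Delta> k \<le> gamma / ?n" using cmp[OF x tk] by simp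
          show ?thesis
          proof (cases "j = 0")
            case True
            then show ?thesis using kj kK t'le st by (intro goodI[of k 1]) auto
          next
            case False
            then have "j = 1" using kK by simp
            then have "t' \<le> ts (Suc k)" using kj t'le st \<Delta>[of k] by (simp add: ss)
            then show ?thesis using kj kK by (intro goodI[of "Suc k" 0]) auto
          qed
        qed
      qed
    qed
    then show "good (Suc a) x' (aux_update F G \<kappa> x t)" by (simp add: t'_def)
    show "dual_norm F (damped_newton Q F G (aux_update F G \<kappa> x t) x)
          (aux_update F G \<kappa> x t *\<^sub>R G + gradient F (damped_newton Q F G (aux_update F G \<kappa> x t) x)) \<le> beta"
      if lev: "kappa_level \<kappa> \<le> rejection_level"
    proof -
      let ?y = "1 + 9 * sqrt \<nu>"
      define z where "z = (5/4) / ?y"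
      have "\<nu> \<ge> 1" using nu_ge_1 x(1) by blast
      then have y: "?y > 0" by (intro add_pos_nonneg) auto
      have z: "z > 0" unfolding z_def using y by (intro divide_pos_pos) auto
      have kle: "\<kappa> \<le> 1 + z"
        using lev k z unfolding rejection_level_def z_def[symmetric] by (subst (asm) kappa_level_le_iff) auto
      have "t * ?n * 9 \<le> ?y" using param_times_dual_norm[OF x] t0 by simp
      then have "t * ?n / ?y \<le> 1/9" using y by (simp add: field_simps)
      then have "5/4 * (t * ?n / ?y) \<le> 5/4 * (1/9)" by (rule mult_left_mono) simp
      moreover have "t * z * ?n = 5/4 * (t * ?n / ?y)" by (simp add: z_def)
      ultimately have "t * z * ?n \<le> gamma" by (simp add: gamma_def)
      then have tz: "t * z \<le> gamma / ?n" using n by (simp add: pos_le_divide_eq)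
      have "(t - gamma / ?n) * \<kappa> \<le> (t - t * z) * \<kappa>" using tz k by (intro mult_right_mono) auto
      also have "\<dots> \<le> t"
      proof (cases "z \<le> 1")
        case True
        have "t - t * z \<ge> 0" using mult_left_mono[OF True, of t] t0 by simp
        then have "(t - t * z) * \<kappa> \<le> (t - t * z) * (1 + z)"
          using kle by (intro mult_left_mono)
        also have "\<dots> = t - t * (z * z)" by (simp add: algebra_simps)
        also have "\<dots> \<le> t" using t0 by simp
        finally show ?thesis .
      next
        case False
        then have "t - t * z \<le> 0" using mult_left_mono[of 1 z t] t0 by simp
        then have "(t - t * z) * \<kappa> \<le> 0" using k by (intro mult_nonpos_nonneg) auto
        then show ?thesis using t0 by simp
      qed
      finally have "t - gamma / ?n \<le> t / \<kappa>" using k by (simp add: pos_le_divide_eq)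
      then have u: "aux_update F G \<kappa> x t = t - gamma / ?n" by (simp add: aux_update_def)
      have "\<bar>aux_update F G \<kappa> x t - t\<bar> * ?n \<le> gamma" unfolding u using n by (simp add: gamma_def)
      from short_step_accepted[OF x this] show ?thesis by simp
    qed
  next
    fix a x t
    assume x: "x \<in> S" "dual_norm F x (t *\<^sub>R G + gradient F x) \<le> beta" and g: "good a x t"
      and ns: "\<not> aux_stop F x"
    let ?n = "dual_norm F x G"
    have t0: "t > 0" using g by (simp add: good_def)
    have n: "?n > 0" by (rule dual_norm_pos[OF x(1) G])
    have run: "gamma / ?n < t" using running[OF x t0 ns] n by (simp add: pos_divide_less_eq)
    have cases: "(a = 0 \<and> x = xhat \<and> t = 1) \<or>
     (\<exists>k j. 1 \<le> k \<and> k \<le> K \<and> a + 1 \<le> 2 * k + j \<and> (k < K \<longrightarrow> j \<le> 1) \<and> t \<le> ts k - real j * (7/12 * \<Delta> k))"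
      using g by (simp add: good_def)
    show "a \<le> 2 * K + 2"
      using cases
    proof (elim disjE exE)
      fix k j assume kj: "1 \<le> k \<and> k \<le> K \<and> a + 1 \<le> 2 * k + j \<and> (k < K \<longrightarrow> j \<le> 1) \<and> t \<le> ts k - real j * (7/12 * \<Delta> k)"
      show ?thesis
      proof (cases "k = K")
        case True
        have "j \<le> 3"
        proof (rule ccontr)
          assume "\<not> j \<le> 3"
          then have "4 * (7/12 * \<Delta> K) \<le> real j * (7/12 * \<Delta> K)"
            using \<Delta>[of K] by (intro mult_right_mono) auto
          then have t4: "t \<le> ts K - 4 * (7/12 * \<Delta> K)" using kj True by simp
          have "ts K \<le> 13/36 / dual_norm F (xs K) G"
            using tsK npos[of K] by (simp add: pos_le_divide_eq)
          also have "\<dots> = 13/5 * \<Delta> K" by (simp add: \<Delta>_def gamma_def)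
          finally have t7: "t \<le> 7/12 * \<Delta> K" using t4 \<Delta>[of K] by simp
          moreover have "7/12 * \<Delta> K \<le> gamma / ?n" using cmpK[OF x _ t0] t4 \<Delta>[of K] by simp
          ultimately show False using run by simp
        qed
        then show ?thesis using kj True by simp
      qed (use kj in auto)
    qed simp
  qed
  define s0 where "s0 = initial_state xhat 1"
  have st: "adaptive_aux Q F xhat k = (adaptive_step Q F G (aux_update F G) ^^ k) s0" for k
    by (simp add: adaptive_aux_def s0_def G_def Let_def)
  have ak: "accepted_kappa s0 = kappa0" by (simp add: s0_def accepted_kappa_initial)
  have "P.ready 0 s0"
    unfolding P.ready_def ak kappa_credit_kappa0
    using xhat rejection_level_le[OF xhat]
    by (auto simp: s0_def initial_state_def good_def kappa0_def accepted_def G_def dual_norm_def beta_def)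
  then have "P.valid_state s0" unfolding P.valid_state_def by blast
  then obtain m where m: "aux_stop F (iterate ((adaptive_step Q F G (aux_update F G) ^^ m) s0))"
    "\<And>j. j < m \<Longrightarrow> \<not> aux_stop F (iterate ((adaptive_step Q F G (aux_update F G) ^^ j) s0))"
    "iterate ((adaptive_step Q F G (aux_update F G) ^^ m) s0) \<in> S"
    "m = 0 \<or> real (newton_steps ((adaptive_step Q F G (aux_update F G) ^^ m) s0)) \<le> P.cap"
    by (rule P.phase_terminates) blast
  have "m \<noteq> 0"
  proof
    assume "m = 0"
    then have "aux_stop F xhat" using m(1) by (simp add: s0_def initial_state_def)
    then show False using K(2)[of 0] K0 by (simp add: short_aux_def)
  qed
  then have "real (newton_steps (adaptive_aux Q F xhat m))
      \<le> (if K = 0 then 0 else 22 * real K + 39 + 16 * (kappa_level kappa0 - rejection_level))"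
    using m(4)[unfolded P.cap_def] K0 by (simp add: st)
  then show ?thesis using that[of m] m(1-3) near[of K] by (simp add: st xs_def)
qed

end


section \<open>Stopping times\<close>

lemma first_time_eqI:
  assumes "P m" "\<And>j. j < m \<Longrightarrow> \<not> P j" shows "first_time P = enat m"
  unfolding first_time_def
proof (rule antisym)
  show "(INF k\<in>{k. P k}. enat k) \<le> enat m" using assms(1) by (intro INF_lower) simp
  show "enat m \<le> (INF k\<in>{k. P k}. enat k)"
  proof (rule INF_greatest)
    fix k assume "k \<in> {k. P k}"
    then have "\<not> k < m" using assms(2) by auto
    then show "enat m \<le> enat k" by simp
  qed
qed

lemma first_time_enatD:
  assumes "first_time P = enat m" shows "P m" "\<And>j. j < m \<Longrightarrow> \<not> P j"
proof -
  have ex: "\<exists>k. P k"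
  proof (rule ccontr)
    assume "\<nexists>k. P k"
    then have "{k. P k} = {}" by blast
    then show False using assms by (simp add: first_time_def top_enat_def)
  qed
  define l where "l = (LEAST k. P k)"
  have l: "P l" unfolding l_def by (rule LeastI_ex[OF ex])
  have least: "\<not> P j" if "j < l" for j using that unfolding l_def by (rule not_less_Least)
  have "first_time P = enat l" using l least by (rule first_time_eqI)
  then have "m = l" using assms by simp
  then show "P m" "\<And>j. j < m \<Longrightarrow> \<not> P j" using l least by auto
qed

section \<open>The constants\<close>

lemma ln_10_le: "ln (10::real) \<le> 7/3"
proof -
  have "(10::real) ^ 3 \<le> (1 + 1/4 + (1/4)\<^sup>2 / 2) ^ 28" by (simp add: power2_eq_square power_divide)
  also have "\<dots> \<le> exp (1/4) ^ 28"
    using exp_lower_Taylor_quadratic[of "1/4"] by (intro power_mono) auto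
  also have "\<dots> = exp (7::real)" by (simp flip: exp_of_nat_mult)
  finally have "ln ((10::real) ^ 3) \<le> ln (exp 7)" by (subst ln_le_cancel_iff) auto
  then show ?thesis using ln_realpow[of 10 3] by simp
qed

lemma ln_4_ge: "11/8 \<le> ln (4::real)"
proof -
  have "exp (11::real) = exp 1 ^ 11" by (simp flip: exp_of_nat_mult)
  also have "\<dots> \<le> (272/100) ^ 11" using e_less_272 by (intro power_mono) auto
  also have "\<dots> \<le> (4::real) ^ 8" by (simp add: power_divide)
  finally have "11 \<le> ln ((4::real) ^ 8)" by (subst ln_ge_iff) auto
  then show ?thesis using ln_realpow[of 4 8] by simp
qed

lemma ln_10_ge: "2 \<le> ln (10::real)"
proof -
  have "exp (2::real) = exp 1 ^ 2" by (simp flip: exp_of_nat_mult)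
  also have "\<dots> \<le> (272/100) ^ 2" using e_less_272 by (intro power_mono) auto
  also have "\<dots> \<le> 10" by (simp add: power2_eq_square)
  finally show ?thesis by (subst ln_ge_iff) auto
qed

text \<open>With \<open>z = (5/4) / y \<le> 1/8\<close>, the estimate \<open>ln (1 + z) \<ge> z / (1 + z) \<ge> (10/9) / y\<close> and \<open>ln 10 \<le> 7/3\<close> bound the
difference of levels by \<open>log\<^sub>4 (21/10) + log\<^sub>4 y\<close>. Here \<open>log\<^sub>4 (21/10)\<close> is slightly more than \<open>log\<^sub>4 2 = 1/2\<close>, and
\<open>1 / ln 4 \<le> 0.73\<close>.\<close>

lemma rejection_depth_bound:
  assumes y: "y \<ge> (10::real)"
  shows "kappa_level kappa0 - kappa_level (1 + (5/4) / y) \<le> 0.5375 + 0.73 * ln y"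
proof -
  define z where "z = (5/4) / y"
  have z: "0 < z" "z \<le> 1/8" using y by (auto simp: z_def field_simps)
  have "10/9 / y = z * (8/9)" by (simp add: z_def)
  also have "\<dots> \<le> z * (1 / (1 + z))" using z by (intro mult_left_mono) (auto simp: field_simps)
  also have "\<dots> = - (1 / (1 + z) - 1)" using z by (simp add: field_simps)
  also have "\<dots> \<le> - ln (1 / (1 + z))" using ln_le_minus_one[of "1 / (1 + z)"] z by simp
  also have "\<dots> = ln (1 + z)" using z by (simp add: ln_div)
  finally have "ln (10/9 / y) \<le> ln (ln (1 + z))" using y by (subst ln_le_cancel_iff) (auto intro: less_le_trans[of _ "10/9/y"])
  moreover have "ln (10/9 / y) = ln (10/9) - ln y" using y by (subst ln_div) auto
  ultimately have lower: "ln (10/9) - ln y \<le> ln (ln (1 + z))" by linarith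
  have "ln 10 \<le> (7/3::real)" by (rule ln_10_le)
  then have "ln (ln 10) \<le> ln (7/3::real)" using ln_10_ge by (subst ln_le_cancel_iff) auto
  moreover have "ln (7/3::real) - ln (10/9) = ln (21/10)" using ln_div[of "7/3" "10/9 :: real"] by simp
  moreover have "ln (21/10::real) = ln 2 + ln (21/20)" using ln_mult[of 2 "21/20::real"] by simp
  moreover have "ln (21/20::real) \<le> 1/20" using ln_le_minus_one[of "21/20"] by simp
  ultimately have "ln (ln 10) - ln (ln (1 + z)) \<le> ln 4 / 2 + 1/20 + ln y"
    using lower ln_4_eq by linarith
  then have "(ln (ln 10) - ln (ln (1 + z))) / ln 4 \<le> (ln 4 / 2 + 1/20 + ln y) / ln 4"
    by (rule divide_right_mono) simp
  also have "\<dots> = 1/2 + (1/20) / ln 4 + ln y / ln 4" by (simp add: add_divide_distrib)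
  also have "\<dots> \<le> 1/2 + 0.0375 + 0.73 * ln y"
  proof -
    have "0 \<le> ln y" using y by simp
    have "ln y * 1 \<le> ln y * (0.73 * ln 4)" using ln_4_ge \<open>0 \<le> ln y\<close> by (intro mult_left_mono) auto
    then have "ln y / ln 4 \<le> 0.73 * ln y" by (simp add: pos_divide_le_eq mult_ac)
    moreover have "(1/20) / ln 4 \<le> (0.0375::real)" using ln_4_ge by (simp add: pos_divide_le_eq)
    ultimately show ?thesis by linarith
  qed
  finally show ?thesis by (simp add: kappa_level_def kappa0_def z_def diff_divide_distrib)
qed

text \<open>The tight case is \<open>a = 1\<close>, \<open>m = 2\<close>, \<open>M = 3\<close>. There \<open>32 * B\<close>, from the initial drops of the level in both
phases, is only just absorbed; this is why \<open>B\<close> has to be bounded with some margin below \<open>M\<close>.\<close>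

lemma newton_count_arithmetic:
  fixes M a m :: nat and B n_a n_m :: real
  assumes M: "M \<ge> 3" and B: "B \<le> real M - 0.2225" and m: "m \<ge> 1"
    and n_a: "n_a \<le> (if a = 0 then 0 else 22 * real a + 39 + 16 * B)"
    and n_m: "n_m \<le> (if m = 1 then 2 else 22 * real m - 4 + 16 * B)"
  shows "n_a + 1 + n_m \<le> 16 * real M * (real a + 1 + real m)"
proof -
  have prod: "3 * k + real M * c \<le> real M * (k + c)" if "k \<ge> 0" for k c :: real
    using mult_right_mono[of 3 "real M" k] M that by (simp add: distrib_left)
  consider "a = 0" "m = 1" | "a = 0" "m \<ge> 2" | "a \<ge> 1" "m = 1" | "a \<ge> 1" "m \<ge> 2"
    using m by linarith
  then show ?thesis
  proof cases
    case 1
    then show ?thesis using n_a n_m M by simp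
  next
    case 2
    then have "n_a + 1 + n_m \<le> 22 * real m - 3 + 16 * real M" using n_a n_m B by simp
    moreover have "3 * real m + real M * 1 \<le> real M * (real m + 1)" by (rule prod) simp
    moreover have "16 * real M * (real a + 1 + real m) = 16 * (real M * (real m + 1))" using 2 by (simp add: algebra_simps)
    ultimately show ?thesis using M by linarith
  next
    case 3
    then have "n_a + 1 + n_m \<le> 22 * real a + 39 + 16 * real M" using n_a n_m B by simp
    also have "\<dots> \<le> 16 * (3 * (real a + 1) + real M * 1)" by simp
    also have "\<dots> \<le> 16 * (real M * ((real a + 1) + 1))" by (intro mult_left_mono prod) auto
    also have "\<dots> = 16 * real M * (real a + 1 + real m)" using 3 by (simp add: algebra_simps)
    finally show ?thesis .
  next
    case 4
    then have "n_a + 1 + n_m \<le> 22 * (real a + real m) + 28.88 + 32 * real M" using n_a n_m B by simp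
    also have "\<dots> \<le> 16 * (3 * (real a + real m - 1) + real M * 2)" using 4 by simp
    also have "\<dots> \<le> 16 * (real M * ((real a + real m - 1) + 2))"
      using 4 by (intro mult_left_mono prod) auto
    also have "\<dots> = 16 * real M * (real a + 1 + real m)" by (simp add: algebra_simps)
    finally show ?thesis .
  qed
qed

section \<open>Comparison of the two algorithms\<close>

theorem theorem2:
  fixes Q :: "(real ^ 'n) set" and F :: "real ^ 'n \<Rightarrow> real"
    and c xhat :: "real ^ 'n" and \<nu> \<epsilon> :: real
  assumes "bounded Q" and "closed Q" and "convex Q" and "Q = closure (interior Q)"
    and "self_concordant_barrier \<nu> Q F"
    and "xhat \<in> interior Q"
    and "\<epsilon> > 0"
  shows "N_adaptive Q F \<nu> xhat c \<epsilon>
           \<le> enat (16 * nat \<lceil>0.76 + 0.73 * ln (1 + 9 * sqrt \<nu>)\<rceil>) * N_short F \<nu> xhat c \<epsilon>"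
proof -
  interpret bounded_barrier Q F \<nu> using assms by unfold_locales
  define y where "y = 1 + 9 * sqrt \<nu>"
  define M where "M = nat \<lceil>0.76 + 0.73 * ln y\<rceil>"
  define T where "T = (\<nu> + (beta + sqrt \<nu>) * beta / (1 - beta)) * inverse \<epsilon>"
  have nu: "\<nu> \<ge> 1" using nu_ge_1 assms(6) by auto
  then have y: "y \<ge> 10" by (simp add: y_def)
  have "2 \<le> ln y" using ln_10_ge y by (smt (verit) ln_le_cancel_iff)
  have M2: "0.76 + 0.73 * ln y \<le> real M" unfolding M_def by (rule real_nat_ceiling_ge)
  then have "real 2 < real M" using \<open>2 \<le> ln y\<close> by simp
  then have M: "M \<ge> 3" "0.76 + 0.73 * ln y \<le> real M" using M2 by auto
  have B: "kappa_level kappa0 - rejection_level \<le> real M - 0.2225"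
    using rejection_depth_bound[OF y] M(2) by (simp add: rejection_level_def y_def)
  have "T > 0" unfolding T_def using nu assms(7)
    by (intro mult_pos_pos add_pos_nonneg) (auto simp: beta_def)
  show ?thesis
  proof (cases "first_time (\<lambda>k. aux_stop F (fst (short_aux F xhat k)))")
    case infinity
    then have "N_short F \<nu> xhat c \<epsilon> = \<infinity>" by (simp add: N_short_def)
    then show ?thesis using M(1) unfolding y_def[symmetric] M_def[symmetric] by simp
  next
    case (enat a)
    define xS where "xS = fst (short_aux F xhat a) - newton_dir F 0 0 (fst (short_aux F xhat a))"
    have NS: "N_short F \<nu> xhat c \<epsilon> = enat a + 1 + first_time (\<lambda>m. main_stop \<nu> \<epsilon> (snd (short_main F c xS m)))"
      by (simp add: N_short_def enat xS_def Let_def)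
    obtain ka where ka: "aux_stop F (iterate (adaptive_aux Q F xhat ka))"
      "\<And>j. j < ka \<Longrightarrow> \<not> aux_stop F (iterate (adaptive_aux Q F xhat j))"
      "iterate (adaptive_aux Q F xhat ka) \<in> S"
      "real (newton_steps (adaptive_aux Q F xhat ka))
        \<le> (if a = 0 then 0 else 22 * real a + 39 + 16 * (kappa_level kappa0 - rejection_level))"
      "fst (short_aux F xhat a) \<in> S"
      using auxiliary_phase[OF assms(6) first_time_enatD[OF enat]] by blast
    define sA where "sA = adaptive_aux Q F xhat ka"
    define xA where "xA = iterate sA - newton_dir F 0 0 (iterate sA)"
    have ftA: "first_time (\<lambda>k. aux_stop F (iterate (adaptive_aux Q F xhat k))) = enat ka"
      using ka(1,2) by (rule first_time_eqI)
    have start: "x - newton_dir F 0 0 x \<in> S \<and>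
        dual_norm F (x - newton_dir F 0 0 x) (gradient F (x - newton_dir F 0 0 x)) \<le> beta"
      if "x \<in> S" "aux_stop F x" for x
      using full_newton_step(1,2)[OF that(1), of 0 0] that(2) by (simp add: aux_stop_def beta_def real_sqrt_divide)
    have xS: "xS \<in> S" "dual_norm F xS (gradient F xS) \<le> beta"
      using start[OF ka(5) first_time_enatD(1)[OF enat]] by (simp_all add: xS_def)
    have xA: "xA \<in> S" "dual_norm F xA (gradient F xA) \<le> beta"
      using start[OF ka(3,1)] by (simp_all add: xA_def sA_def)
    show ?thesis
    proof (cases "first_time (\<lambda>m. main_stop \<nu> \<epsilon> (snd (short_main F c xS m)))")
      case infinity
      then have "N_short F \<nu> xhat c \<epsilon> = \<infinity>" by (simp add: NS)
      then show ?thesis using M(1) unfolding y_def[symmetric] M_def[symmetric] by simp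
    next
      case enat_m: (enat m)
      have m: "T \<le> snd (short_main F c xS m)"
        using first_time_enatD(1)[OF enat_m] by (simp add: main_stop_def T_def)
      have c: "c \<noteq> 0"
      proof
        assume "c = 0"
        then have "snd (short_main F c xS k) = 0" for k
          by (induction k) (simp_all add: short_main_def short_main_step_def Let_def split_beta dual_norm_def)
        then show False using m \<open>T > 0\<close> by simp
      qed
      have m1: "m \<ge> 1" using m \<open>T > 0\<close> by (cases m) (auto simp: short_main_def)
      obtain km where km: "T \<le> param (adaptive_main Q F c xA km)"
        "\<And>j. j < km \<Longrightarrow> \<not> T \<le> param (adaptive_main Q F c xA j)"
        "real (newton_steps (adaptive_main Q F c xA km))
          \<le> (if m = 1 then 2 else 22 * real m - 4 + 16 * (kappa_level kappa0 - rejection_level))"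
        using main_phase[OF c \<open>T > 0\<close> xS xA m] by blast
      have "first_time (\<lambda>m. main_stop \<nu> \<epsilon> (param (adaptive_main Q F c xA m))) = enat km"
        by (rule first_time_eqI) (use km(1,2) in \<open>auto simp: main_stop_def T_def\<close>)
      then have NA: "N_adaptive Q F \<nu> xhat c \<epsilon>
          = enat (newton_steps sA + 1 + newton_steps (adaptive_main Q F c xA km))"
        by (simp add: N_adaptive_def ftA Let_def sA_def xA_def)
      have "real (newton_steps sA) + 1 + real (newton_steps (adaptive_main Q F c xA km))
          \<le> 16 * real M * (real a + 1 + real m)"
        using newton_count_arithmetic[OF M(1) B m1] ka(4) km(3) by (simp add: sA_def)
      then have "real (newton_steps sA + 1 + newton_steps (adaptive_main Q F c xA km))
          \<le> real (16 * M * (a + 1 + m))"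
        by (simp only: of_nat_add of_nat_mult of_nat_1 of_nat_numeral)
      then have "newton_steps sA + 1 + newton_steps (adaptive_main Q F c xA km) \<le> 16 * M * (a + 1 + m)"
        by (simp only: of_nat_le_iff)
      then have "N_adaptive Q F \<nu> xhat c \<epsilon> \<le> enat (16 * M * (a + 1 + m))"
        unfolding NA by (simp only: enat_ord_simps)
      also have "\<dots> = enat (16 * M) * N_short F \<nu> xhat c \<epsilon>"
        unfolding NS enat_m by (simp add: one_enat_def)
      finally show ?thesis unfolding M_def y_def .
    qed
  qed
qed

end
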